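(* Fix $\epsilon>0$. Then (1) $\displaystyle\lim_{g\to\infty}\mathbb{P}_{g}\left[\left|e(S)-\frac{1}{\sqrt{5}}\, g \right|< \epsilon g\right] = 1$, and (2) $\displaystyle\lim_{g\to\infty}\mathbb{P}_{g}\left[\left|t(S)-(1-\gamma) g \right|< \epsilon g\right] = 1$, where $\gamma=\frac{5+\sqrt{5}}{10}$.
   Context: A numerical semigroup $S$ is a submonoid of $\mathbb{N}_0$ with finite complement; $\mathcal{H}(S)=\mathbb{N}_0\setminus S$ is its set of gaps and $g(S)=|\mathcal{H}(S)|$ its genus. The embedding dimension $e(S)$ is the number of elements of the minimal generating set $(S\setminus\{0\})\setminus((S\setminus\{0\})+(S\setminus\{0\}))$. The pseudo-Frobenius numbers are $PF(S)=\{P\in\mathcal{H}(S): P+s\in S \text{ for all } s\in S\setminus\{0\}\}$ and the type is $t(S)=|PF(S)|$. $\mathcal{S}_g$ denotes the (finite) set of numerical semigroups of genus $g$, and $\mathbb{P}_g$ is the uniform probability distribution on $\mathcal{S}_g$ (with $S$ a random element of $\mathcal{S}_g$). *)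

theory Defs
  imports "HOL-Analysis.Analysis"
begin

definition numerical_semigroup :: "nat set \<Rightarrow> bool" where
  "numerical_semigroup S \<longleftrightarrow> 0 \<in> S \<and> (\<forall>a\<in>S. \<forall>b\<in>S. a + b \<in> S) \<and> finite (UNIV - S)"

definition gaps :: "nat set \<Rightarrow> nat set" where
  "gaps S = UNIV - S"

definition genus :: "nat set \<Rightarrow> nat" where
  "genus S = card (gaps S)"

definition min_gens :: "nat set \<Rightarrow> nat set" where
  "min_gens S = (S - {0}) - {a + b | a b. a \<in> S - {0} \<and> b \<in> S - {0}}"

definition embedding_dimension :: "nat set \<Rightarrow> nat" where
  "embedding_dimension S = card (min_gens S)"

definition pseudo_frobenius :: "nat set \<Rightarrow> nat set" where
  "pseudo_frobenius S = {P \<in> gaps S. \<forall>s \<in> S - {0}. P + s \<in> S}"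

definition semigroup_type :: "nat set \<Rightarrow> nat" where
  "semigroup_type S = card (pseudo_frobenius S)"

definition semigroups_of_genus :: "nat \<Rightarrow> nat set set" where
  "semigroups_of_genus g = {S. numerical_semigroup S \<and> genus S = g}"

definition prob_genus :: "nat \<Rightarrow> (nat set \<Rightarrow> bool) \<Rightarrow> real" where
  "prob_genus g P = real (card {S \<in> semigroups_of_genus g. P S}) / real (card (semigroups_of_genus g))"

end

theory Submission
  imports Defs "HOL-Number_Theory.Fib" "HOL-Real_Asymp.Real_Asymp"
begin

text \<open>A semigroup of multiplicity \<open>m\<close> and genus \<open>g\<close> is a word of \<open>m - 1\<close> positive letters (its Kunz
  coordinates) with sum \<open>g\<close>. Weight a word by \<open>rgold ^ g\<close>, where \<open>rgold\<close> is the inverse of the golden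
  ratio. Words with letters 1 and 2 only are unconstrained, and under the weight their letters are
  independent with probabilities \<open>rgold\<close> and \<open>rgold\<^sup>2\<close>; counting them shows that the total weight in each
  genus is at least \<open>rgold\<close>. It therefore suffices that atypical words have exponentially small weight.

  If \<open>m \<le> g / 8\<close>, there are too few compositions of \<open>g\<close>. Otherwise the letters are at most 16. Suppose that
  there is a gap above \<open>(2 + \<beta>) m\<close>. If few residues have a gap above \<open>(2 + \<delta>) m\<close>, then the word is almost free
  and the high gap forbids two letters 1 at positions with a given sum, which costs a constant factor for
  each of linearly many pairs. If many residues do, two of the gaps are close to each other; the constraints they
  impose form a few long paths, on which the transfer operator has an explicit supersolution of eigenvalue 1,
  so that they cancel the extra weight of the larger letters, and a third gap again costs an
  exponential factor.

  For the remaining words, law of large numbers estimates give \<open>rgold * m\<close> letters 1 and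
  \<open>g = (2 - rgold) * m\<close>, up to small errors. The letters 1 give minimal generators, and almost every
  \<open>2 * m + i\<close> is a sum of two of them; the letters 2 give pseudo-Frobenius numbers \<open>m + i\<close>, and almost no gap below
  \<open>m\<close> is pseudo-Frobenius. So \<open>e\<close> is about \<open>rgold * m\<close> and \<open>t\<close> about \<open>(1 - rgold) * m\<close>.\<close>

section \<open>Weighted words and the transfer operator\<close>

text \<open>The obstacle is that \<open>rgold\<close> is the critical weight: a letter free to take
  the values 1 and 2 has total weight exactly 1, but without a cap the total may approach
  \<open>1 / rgold > 1\<close>. Dropping the Kunz constraints on linearly many large letters would
  therefore lose an exponential factor. The constraint of a single gap does not repay it, because it
  only matches positions in pairs: with letters up to 3, a pair whose letters are not both 1 still
  has total weight \<open>3 * rgold ^ 2 > 1\<close>. A second gap at a small distance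
  \<open>a\<close> links these pairs, since the reflections \<open>i -> r - i\<close> and
  \<open>i -> r - a - i\<close> compose to a translation by \<open>a\<close>. The bound then becomes
  1 for a whole path, up to a factor for its end, and the number of paths is proportional to
  \<open>a\<close>. Hence three nested scales: the height of the gap above \<open>3 * m\<close> in
  the Apery set, a much smaller height that makes a residue count as high, and a still smaller
  distance between two high Apery elements. Each is a small multiple of the previous one, so that
  the loss at one scale is less than the gain at the scale before it.\<close>

definition rgold :: real where
  "rgold = (sqrt 5 - 1) / 2"

lemma rgold_sq: "rgold\<^sup>2 = 1 - rgold"
  by (simp add: rgold_def power2_eq_square field_simps)

lemma rgold_mult_self: "rgold * rgold = 1 - rgold"
  using rgold_sq by (simp add: power2_eq_square)

lemma rgold_pos: "rgold > 0"
  unfolding rgold_def by (simp add: real_less_rsqrt)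

lemma rgold_less_1: "rgold < 1"
proof -
  have "sqrt 5 < sqrt 9" by (rule real_sqrt_less_mono) simp
  moreover have "sqrt 9 = (3::real)" by (rule real_sqrt_unique) auto
  ultimately show ?thesis by (simp add: rgold_def)
qed

lemma rgold_less: "rgold < 5/8"
proof -
  have "sqrt 5 < sqrt ((9/4)\<^sup>2)" by (rule real_sqrt_less_mono) (simp add: power2_eq_square)
  thus ?thesis by (simp add: rgold_def)
qed

lemmas rgold_facts = rgold_pos rgold_less_1

lemma rgold_power_le_1: "rgold ^ n \<le> 1"
  using rgold_facts by (simp add: power_le_one)

lemma rgold_pow_add: "rgold ^ Suc n + rgold ^ Suc (Suc n) = rgold ^ n"
proof -
  have "rgold ^ Suc n + rgold ^ Suc (Suc n) = rgold ^ n * (rgold + rgold * rgold)"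
    by (simp add: algebra_simps)
  thus ?thesis by (simp add: rgold_mult_self)
qed

text \<open>The sum telescopes. Its bound \<open>1 / rgold\<close> is the price of one letter that
  is not restricted to 1 and 2.\<close>

lemma sum_rgold_le: "(\<Sum>k\<in>{1..L}. rgold ^ k) \<le> 1 / rgold"
proof -
  have "(\<Sum>k\<in>{1..L}. rgold ^ k) = 1 / rgold - rgold ^ L / rgold"
  proof (induction L)
    case (Suc L)
    have "rgold ^ L = rgold ^ Suc L + rgold * rgold ^ Suc L"
      using rgold_pow_add[of L] by simp
    thus ?case using Suc rgold_pos by (simp add: field_simps)
  qed simp
  thus ?thesis using rgold_pos by simp
qed

lemma sum_rgold_12: "(\<Sum>k\<in>{1..2}. rgold ^ k) = 1"
proof -
  have "{1..2::nat} = {1,2}" by auto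
  thus ?thesis using rgold_sq by simp
qed

definition wt :: "nat set \<Rightarrow> (nat \<Rightarrow> nat) \<Rightarrow> real" where
  "wt V f = (\<Prod>i\<in>V. rgold ^ f i)"

lemma wt_pos: "wt V f > 0"
  unfolding wt_def by (intro prod_pos) (simp add: rgold_pos)

lemma wt_nonneg: "wt V f \<ge> 0"
  using wt_pos[of V f] by simp

lemma wt_eq_power: "finite V \<Longrightarrow> wt V f = rgold ^ (\<Sum>i\<in>V. f i)"
  unfolding wt_def by (simp add: power_sum)

lemma wt_le_1: "wt V f \<le> 1"
  unfolding wt_def by (intro prod_le_1) (use rgold_facts in \<open>auto simp: power_le_one\<close>)

lemma wt_antimono:
  assumes "finite V" "\<And>i. i \<in> V \<Longrightarrow> f i \<le> h i"
  shows "wt V h \<le> wt V f"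
  unfolding wt_eq_power[OF assms(1)]
  by (rule power_decreasing) (use rgold_facts assms in \<open>auto intro: sum_mono\<close>)

lemma sum_PiE_insert:
  fixes F :: "(nat \<Rightarrow> nat) \<Rightarrow> real"
  assumes "v \<notin> V"
  shows "(\<Sum>f\<in>PiE (insert v V) A. F f) = (\<Sum>f\<in>PiE V A. \<Sum>k\<in>A v. F (f(v := k)))"
proof -
  have "(\<Sum>f\<in>PiE (insert v V) A. F f) = (\<Sum>(k, f)\<in>A v \<times> PiE V A. F (f(v := k)))"
    unfolding PiE_insert_eq using inj_combinator[OF assms, of A]
    by (subst sum.reindex) (auto simp: case_prod_unfold)
  also have "\<dots> = (\<Sum>k\<in>A v. \<Sum>f\<in>PiE V A. F (f(v := k)))"
    by (simp add: sum.cartesian_product)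
  also have "\<dots> = (\<Sum>f\<in>PiE V A. \<Sum>k\<in>A v. F (f(v := k)))"
    by (rule sum.swap)
  finally show ?thesis .
qed

text \<open>Equality holds for \<open>l = 1\<close>, and passing from \<open>l\<close> to
  \<open>l + 1\<close> lowers the left side by a multiple of \<open>l - 1\<close>. The supersolution
  inequality \<open>leafwt_step\<close> reduces to this.\<close>

lemma linear_rgold_le_1: "l \<ge> 1 \<Longrightarrow> real l * rgold ^ l + rgold ^ Suc l \<le> 1"
proof (induction l rule: nat_induct_at_least)
  case base
  thus ?case using rgold_sq by (simp add: power2_eq_square)
next
  case (Suc l)
  have "(real l * rgold ^ l + rgold ^ Suc l) - (real (Suc l) * rgold ^ Suc l + rgold ^ Suc (Suc l))
     = rgold ^ l * (real l * (1 - rgold) - rgold * rgold)"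
    by (simp add: algebra_simps)
  also have "\<dots> = rgold ^ l * (1 - rgold) * (real l - 1)"
    unfolding rgold_mult_self by (simp add: algebra_simps)
  also have "\<dots> \<ge> 0" using rgold_facts Suc.hyps by simp
  finally show ?case using Suc.IH by linarith
qed

text \<open>For \<open>k = T\<close> the exponent is truncated to \<open>0\<close>.\<close>

definition leafwt :: "nat \<Rightarrow> nat \<Rightarrow> real" where
  "leafwt T k = rgold ^ (T - 1 - k)"

lemma leafwt_nonneg: "leafwt T k \<ge> 0"
  unfolding leafwt_def using rgold_pos by simp

text \<open>For \<open>k < T\<close> the product \<open>rgold ^ k * leafwt T k\<close> is the
  constant \<open>rgold ^ (T - 1)\<close>, so the sum only counts the admissible \<open>k\<close>;
  the letter \<open>T\<close> adds one smaller term.\<close>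

lemma leafwt_step:
  assumes "T \<ge> 2" "l \<in> {1..T}"
  shows "(\<Sum>k\<in>{1..T}. if T \<le> k + l then rgold ^ k * leafwt T k else 0) \<le> leafwt T l"
proof -
  \<comment> \<open>The letters \<open>T - 1\<close> and \<open>T\<close> both leave
    \<open>k\<close> unrestricted and both have leaf weight 1, so they form one case.\<close>
  define l' where "l' = min l (T - 1)"
  have l': "l' \<ge> 1" "l' \<le> T - 1" using assms by (auto simp: l'_def)
  have "{1..T} = insert T {1..T-1}" using assms by auto
  hence "(\<Sum>k\<in>{1..T}. if T \<le> k + l then rgold ^ k * leafwt T k else 0)
    = rgold ^ T * leafwt T T + (\<Sum>k\<in>{1..T-1}. if T \<le> k + l then rgold ^ k * leafwt T k else 0)"
    using assms by simp
  also have "(\<Sum>k\<in>{1..T-1}. if T \<le> k + l then rgold ^ k * leafwt T k else 0)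
     = (\<Sum>k\<in>{1..T-1}. if T \<le> k + l then rgold ^ (T - 1) else 0)"
    by (rule sum.cong) (auto simp: leafwt_def simp flip: power_add)
  also have "\<dots> = (\<Sum>k\<in>{1..T-1} \<inter> {k. T \<le> k + l}. rgold ^ (T - 1))"
    by (simp add: sum.inter_restrict[symmetric] sum.If_cases)
  also have "{1..T-1} \<inter> {k. T \<le> k + l} = {T - l'..T-1}" using assms by (auto simp: l'_def)
  also have "(\<Sum>k\<in>{T - l'..T-1}. rgold ^ (T - 1)) = real l' * rgold ^ (T - 1)"
    using l' assms by simp
  also have "rgold ^ T * leafwt T T + real l' * rgold ^ (T - 1)
     = rgold ^ (T - 1 - l') * (real l' * rgold ^ l' + rgold ^ Suc l')"
  proof -
    have "T - 1 = (T - 1 - l') + l'" "T = (T - 1 - l') + Suc l'" using l' assms by auto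
    hence "rgold ^ (T - 1) = rgold ^ (T - 1 - l') * rgold ^ l'"
      "rgold ^ T = rgold ^ (T - 1 - l') * rgold ^ Suc l'" by (metis power_add)+
    moreover have "leafwt T T = 1" by (simp add: leafwt_def)
    ultimately show ?thesis by (simp only: algebra_simps mult_1_right)
  qed
  also have "\<dots> \<le> rgold ^ (T - 1 - l') * 1"
    using linear_rgold_le_1[OF l'(1)] rgold_pos by (intro mult_left_mono) auto
  also have "\<dots> = leafwt T l" unfolding leafwt_def l'_def
    by (cases "l \<le> T - 1") (auto simp: min_def)
  finally show ?thesis .
qed

text \<open>A vertex without parent behaves as if its parent carried the letter \<open>T\<close>,
  which makes the constraint void.\<close>

lemma leafwt_root:
  assumes "T \<ge> 2"
  shows "(\<Sum>k\<in>{1..T}. rgold ^ k * leafwt T k) \<le> 1"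
proof -
  have "(\<Sum>k\<in>{1..T}. rgold ^ k * leafwt T k) =
    (\<Sum>k\<in>{1..T}. if T \<le> k + T then rgold ^ k * leafwt T k else 0)"
    by (rule sum.cong) auto
  also have "\<dots> \<le> leafwt T T" by (rule leafwt_step) (use assms in auto)
  finally show ?thesis by (simp add: leafwt_def)
qed

text \<open>Summing out the letter at a leaf of highest rank leaves the same sum on the smaller forest:
  by \<open>leafwt_step\<close>, the factor \<open>leafwt\<close> is a supersolution of the transfer operator.\<close>

lemma forest_sum_le_1:
  fixes par rk T :: "nat \<Rightarrow> nat"
  assumes "finite V" "E \<subseteq> V" "par ` E \<subseteq> V" "inj_on par E"
    and "\<And>v. v \<in> E \<Longrightarrow> rk (par v) < rk v" and "\<And>v. v \<in> E \<Longrightarrow> T (par v) = T v"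
    and "\<And>v. v \<in> V \<Longrightarrow> T v \<ge> 2"
  shows "(\<Sum>f\<in>PiE V (\<lambda>v. {1..T v}). if \<forall>v\<in>E. T v \<le> f v + f (par v)
            then wt V f * (\<Prod>v\<in>V - par ` E. leafwt (T v) (f v)) else 0) \<le> 1"
  using assms
proof (induction "card V" arbitrary: V E)
  case 0
  thus ?case by (simp add: wt_def)
next
  case (Suc n)
  have "V \<noteq> {}" using Suc.hyps by auto
  hence "Max (rk ` V) \<in> rk ` V" using Suc.prems(1) by simp
  then obtain v where "v \<in> V" "rk v = Max (rk ` V)" by auto
  hence v: "v \<in> V" "\<And>w. w \<in> V \<Longrightarrow> rk w \<le> rk v"
    using Suc.prems(1) by auto
  \<comment> \<open>A vertex of highest rank is nobody's parent.\<close>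
  have vnot: "v \<notin> par ` E"
    using Suc.prems(2,5) v(2) by (metis imageE leD subsetD)
  define V' E' where "V' = V - {v}" and "E' = E - {v}"
  have V: "V = insert v V'" "v \<notin> V'" using v by (auto simp: V'_def)
  have fin': "finite V'" using Suc.prems by (simp add: V'_def)
  let ?A = "\<lambda>v. {1..T v}"
  let ?C = "\<lambda>E f. \<forall>v\<in>E. T v \<le> f v + f (par v)"
  let ?G = "\<lambda>V E f. if ?C E f then wt V f * (\<Prod>v\<in>V - par ` E. leafwt (T v) (f v)) else 0"
  have IH: "(\<Sum>f\<in>PiE V' ?A. ?G V' E' f) \<le> 1"
  proof (rule Suc.hyps(1))
    show "n = card V'" using Suc.hyps(2) Suc.prems(1) v(1) by (simp add: V'_def)
    show "par ` E' \<subseteq> V'" using Suc.prems vnot by (auto simp: E'_def V'_def)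
    show "inj_on par E'" using Suc.prems by (auto simp: E'_def inj_on_def)
  qed (use Suc.prems in \<open>auto simp: V'_def E'_def\<close>)
  have step: "(\<Sum>k\<in>?A v. ?G V E (f(v := k))) \<le> ?G V' E' f" if f: "f \<in> PiE V' ?A" for f
  proof -
    have C: "?C E (f(v := k)) \<longleftrightarrow> ?C E' f \<and> (v \<in> E \<longrightarrow> T v \<le> k + f (par v))" for k
    proof -
      have "(T w \<le> (f(v := k)) w + (f(v := k)) (par w)) \<longleftrightarrow>
          (if w = v then T v \<le> k + f (par v) else T w \<le> f w + f (par w))" if "w \<in> E" for w
        using that vnot by (auto simp: image_iff)
      hence "?C E (f(v := k)) \<longleftrightarrow>
          (\<forall>w\<in>E. if w = v then T v \<le> k + f (par v) else T w \<le> f w + f (par w))" by blast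
      thus ?thesis unfolding E'_def by (metis Diff_iff singletonD singletonI)
    qed
    have W: "wt V (f(v := k)) = rgold ^ k * wt V' f" for k
    proof -
      have "(\<Prod>i\<in>V'. rgold ^ (f(v := k)) i) = (\<Prod>i\<in>V'. rgold ^ f i)"
        using V(2) by (intro prod.cong) auto
      thus ?thesis unfolding V(1) wt_def using fin' V(2) by simp
    qed
    define R where "R = V' - par ` E"
    have R: "V - par ` E = insert v R" "v \<notin> R" "finite R" using V vnot fin' by (auto simp: R_def)
    have Lf: "(\<Prod>w\<in>V - par ` E. leafwt (T w) ((f(v := k)) w))
        = leafwt (T v) k * (\<Prod>w\<in>R. leafwt (T w) (f w))" for k
    proof -
      have "(\<Prod>i\<in>R. leafwt (T i) ((f(v := k)) i)) = (\<Prod>i\<in>R. leafwt (T i) (f i))"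
        using R(2) by (intro prod.cong) auto
      thus ?thesis unfolding R(1) using R by simp
    qed
    let ?P = "wt V' f * (\<Prod>w\<in>R. leafwt (T w) (f w))"
    have P0: "?P \<ge> 0" by (intro mult_nonneg_nonneg prod_nonneg wt_nonneg leafwt_nonneg)
    show ?thesis
    proof (cases "?C E' f")
      case False
      have "?G V E (f(v := k)) = 0" for k
        unfolding C by (simp only: False simp_thms if_False)
      moreover have "?G V' E' f = 0" by (simp only: False if_False)
      ultimately show ?thesis by simp
    next
      case True
      show ?thesis
      proof (cases "v \<in> E")
        case vE: True
        have "par v \<in> par ` E" using vE by blast
        hence pv: "par v \<in> V'" "par v \<notin> R" using vnot Suc.prems(3) by (auto simp: V'_def R_def)
        \<comment> \<open>Since \<open>par\<close> is injective, \<open>par v\<close> loses its only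
          child with \<open>v\<close> and becomes a leaf; its new leaf weight is the right side of
          \<open>leafwt_step\<close>.\<close>
        have "V' - par ` E' = insert (par v) R"
        proof -
          have "par ` E = insert (par v) (par ` E')" using vE by (auto simp: E'_def)
          moreover have "par v \<notin> par ` E'"
            using Suc.prems(4) vE by (auto simp: E'_def inj_on_def)
          ultimately show ?thesis using pv by (auto simp: R_def)
        qed
        hence G': "?G V' E' f = ?P * leafwt (T v) (f (par v))"
          using True pv R Suc.prems(6)[OF vE] by simp
        have "(\<Sum>k\<in>?A v. ?G V E (f(v := k)))
          = (\<Sum>k\<in>?A v. ?P * (if T v \<le> k + f (par v) then rgold ^ k * leafwt (T v) k else 0))"
        proof (rule sum.cong)
          fix k
          show "?G V E (f(v := k)) = ?P * (if T v \<le> k + f (par v) then rgold ^ k * leafwt (T v) k else 0)"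
            unfolding C W Lf using True vE by simp
        qed simp
        also have "\<dots> = ?P * (\<Sum>k\<in>?A v. if T v \<le> k + f (par v) then rgold ^ k * leafwt (T v) k else 0)"
          by (simp add: sum_distrib_left)
        also have "\<dots> \<le> ?P * leafwt (T v) (f (par v))"
        proof (intro mult_left_mono P0 leafwt_step)
          show "T v \<ge> 2" using Suc.prems v by auto
          show "f (par v) \<in> {1..T v}" using f pv Suc.prems(6)[OF vE] by (auto simp: PiE_iff)
        qed
        finally show ?thesis using G' by simp
      next
        \<comment> \<open>Here \<open>v\<close> is isolated, being neither a parent nor in
          \<open>E\<close>, so its letter factors out.\<close>
        case vE: False
        have "E' = E" using vE by (simp add: E'_def)
        hence G': "?G V' E' f = ?P" using True by (simp add: R_def)
        have "(\<Sum>k\<in>?A v. ?G V E (f(v := k))) = (\<Sum>k\<in>?A v. ?P * (rgold ^ k * leafwt (T v) k))"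
        proof (rule sum.cong)
          fix k
          show "?G V E (f(v := k)) = ?P * (rgold ^ k * leafwt (T v) k)"
            unfolding C W Lf using True vE by simp
        qed simp
        also have "\<dots> = ?P * (\<Sum>k\<in>?A v. rgold ^ k * leafwt (T v) k)"
          by (simp add: sum_distrib_left)
        also have "\<dots> \<le> ?P * 1"
          by (intro mult_left_mono P0 leafwt_root) (use Suc.prems v in auto)
        finally show ?thesis using G' by simp
      qed
    qed
  qed
  have "(\<Sum>f\<in>PiE V ?A. ?G V E f) = (\<Sum>f\<in>PiE V' ?A. \<Sum>k\<in>?A v. ?G V E (f(v := k)))"
    by (subst V(1)) (rule sum_PiE_insert[OF V(2)])
  also have "\<dots> \<le> (\<Sum>f\<in>PiE V' ?A. ?G V' E' f)" by (intro sum_mono step)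
  finally show ?case using IH by linarith
qed

section \<open>Local modifications\<close>

lemma sum_fibre_le:
  fixes g :: "'a \<Rightarrow> real" and h :: "'b \<Rightarrow> real"
  assumes "finite A" "finite B" "F ` A \<subseteq> B"
    and fib: "\<And>b. b \<in> B \<Longrightarrow> card {a \<in> A. F a = b} \<le> N"
    and le: "\<And>a. a \<in> A \<Longrightarrow> g a \<le> c * h (F a)"
    and nonneg: "c \<ge> 0" "\<And>b. b \<in> B \<Longrightarrow> h b \<ge> 0"
  shows "(\<Sum>a\<in>A. g a) \<le> real N * c * (\<Sum>b\<in>B. h b)"
proof -
  have "(\<Sum>a\<in>A. g a) = (\<Sum>b\<in>B. \<Sum>a | a \<in> A \<and> F a = b. g a)"
    by (rule sum.group[symmetric]) (use assms in auto)
  also have "\<dots> \<le> (\<Sum>b\<in>B. real N * c * h b)"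
  proof (rule sum_mono)
    fix b assume b: "b \<in> B"
    have "(\<Sum>a | a \<in> A \<and> F a = b. g a) \<le> (\<Sum>a | a \<in> A \<and> F a = b. c * h b)"
      using le by (intro sum_mono) auto
    also have "\<dots> = real (card {a \<in> A. F a = b}) * (c * h b)" by simp
    also have "\<dots> \<le> real N * (c * h b)"
      using fib[OF b] nonneg b by (intro mult_right_mono) auto
    finally show "(\<Sum>a | a \<in> A \<and> F a = b. g a) \<le> real N * c * h b" by (simp add: mult.assoc)
  qed
  finally show ?thesis by (simp add: sum_distrib_left)
qed

lemma finite_PiE_Collect:
  "finite V \<Longrightarrow> finite {f \<in> PiE V (\<lambda>_. {1..L::nat}). P f}"
  by (rule finite_subset[OF Collect_restrict finite_PiE]) auto

lemma card_agree_off_le: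
  assumes "finite V" "finite N" "card N \<le> d" "L \<ge> (1::nat)"
  shows "card {f \<in> PiE V (\<lambda>_. {1..L}). \<forall>i. i \<notin> N \<longrightarrow> f i = h i} \<le> L ^ d"
proof -
  let ?F = "{f \<in> PiE V (\<lambda>_. {1..L}). \<forall>i. i \<notin> N \<longrightarrow> f i = h i}"
  have "card ?F \<le> card (PiE (V \<inter> N) (\<lambda>_. {1..L}))"
  proof (rule card_inj_on_le)
    show "inj_on (\<lambda>f. restrict f (V \<inter> N)) ?F"
    proof (rule inj_onI, rule ext)
      fix f g i assume fg: "f \<in> ?F" "g \<in> ?F" "restrict f (V \<inter> N) = restrict g (V \<inter> N)"
      show "f i = g i"
      proof (cases "i \<in> V \<inter> N")
        case True
        thus ?thesis using fg(3) by (metis restrict_apply')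
      next
        case False
        show ?thesis
        proof (cases "i \<in> V")
          case True
          hence "i \<notin> N" using False by simp
          thus ?thesis using fg(1,2) by simp
        next
          case False
          hence "f i = undefined" "g i = undefined" using fg(1,2) by (auto dest!: PiE_arb)
          thus ?thesis by simp
        qed
      qed
    qed
    show "(\<lambda>f. restrict f (V \<inter> N)) ` ?F \<subseteq> PiE (V \<inter> N) (\<lambda>_. {1..L})"
      by (intro image_subsetI restrict_PiE_iff[THEN iffD2] ballI) (auto simp: PiE_iff)
  qed (use assms in \<open>auto intro!: finite_PiE\<close>)
  also have "\<dots> = L ^ card (V \<inter> N)" using assms by (simp add: card_PiE)
  also have "\<dots> \<le> L ^ d"
    using assms card_mono[of N "V \<inter> N"] by (intro power_increasing) auto
  finally show ?thesis .
qed

lemma wt_agree_off_le: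
  assumes "finite V" "finite N" "card N \<le> d"
    and f: "f \<in> PiE V (\<lambda>_. {1..L})" and h: "h \<in> PiE V (\<lambda>_. {1..L})"
    and agree: "\<And>i. i \<notin> N \<Longrightarrow> f i = h i"
  shows "wt V f \<le> wt V h / rgold ^ (L * d)"
proof -
  have split: "wt V e = wt (V - N) e * wt (V \<inter> N) e" for e
    unfolding wt_def using assms(1)
    by (metis Diff_Diff_Int Diff_subset mult.commute prod.subset_diff)
  have eq: "wt (V - N) f = wt (V - N) h" unfolding wt_def using agree by (intro prod.cong) auto
  have "(\<Sum>i\<in>V \<inter> N. h i) \<le> (\<Sum>i\<in>V \<inter> N. L)" using h by (intro sum_mono) (auto simp: PiE_iff)
  also have "\<dots> \<le> L * d" using assms card_mono[of N "V \<inter> N"] by simp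
  finally have "rgold ^ (L * d) \<le> wt (V \<inter> N) h"
    using assms(1) rgold_facts by (subst wt_eq_power) (auto intro: power_decreasing)
  hence "wt (V - N) h * rgold ^ (L * d) \<le> wt V h"
    unfolding split[of h] by (intro mult_left_mono wt_nonneg)
  moreover have "wt V f \<le> wt (V - N) h"
    unfolding split[of f] eq using wt_le_1 wt_nonneg by (intro mult_left_le)
  hence "wt V f * rgold ^ (L * d) \<le> wt (V - N) h * rgold ^ (L * d)"
    using rgold_pos by (intro mult_right_mono) auto
  ultimately have "wt V f * rgold ^ (L * d) \<le> wt V h" by linarith
  thus ?thesis using rgold_pos by (simp add: pos_le_divide_eq)
qed

text \<open>When \<open>d\<close> letters are rewritten, at most \<open>L ^ d\<close> words have the
  same image, and each weighs at most \<open>1 / rgold ^ (L * d)\<close> times that image. The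
  subtracted quotient is thus a lower bound for the proportion of weight that the images
  carry.\<close>

definition modgain :: "nat \<Rightarrow> nat \<Rightarrow> real" where
  "modgain L d = 1 - rgold ^ (L * d) / real L ^ d"

lemma modgain_bounds:
  assumes "L \<ge> 1"
  shows "0 \<le> modgain L d" "modgain L d < 1"
proof -
  have "rgold ^ (L * d) \<le> 1" by (rule rgold_power_le_1)
  moreover have "1 \<le> real L ^ d" using assms by simp
  ultimately show "0 \<le> modgain L d" unfolding modgain_def by (simp add: divide_le_eq)
  show "modgain L d < 1" unfolding modgain_def using assms rgold_pos by simp
qed

text \<open>If every word can be forced to satisfy \<open>B e\<close> by rewriting at most \<open>d\<close> letters, without
  creating any other event \<open>B e'\<close>, then a positive proportion of the words avoiding the other
  events satisfies \<open>B e\<close>. So each further event to be avoided costs a constant factor.\<close>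

lemma local_modification:
  fixes B :: "'e \<Rightarrow> (nat \<Rightarrow> nat) \<Rightarrow> bool"
  assumes "finite Q" "finite V" "L \<ge> 1" and \<Omega>: "\<Omega> \<subseteq> PiE V (\<lambda>_. {1..L})"
    and M: "\<And>e f. e \<in> Q \<Longrightarrow> f \<in> \<Omega> \<Longrightarrow> M e f \<in> \<Omega>"
    and B: "\<And>e f. e \<in> Q \<Longrightarrow> f \<in> \<Omega> \<Longrightarrow> B e (M e f)"
    and N: "\<And>e. e \<in> Q \<Longrightarrow> finite (N e)" "\<And>e. e \<in> Q \<Longrightarrow> card (N e) \<le> d"
    and agree: "\<And>e f i. e \<in> Q \<Longrightarrow> f \<in> \<Omega> \<Longrightarrow> i \<notin> N e \<Longrightarrow> M e f i = f i"
    and indep: "\<And>e e' f. e \<in> Q \<Longrightarrow> e' \<in> Q \<Longrightarrow> e' \<noteq> e \<Longrightarrow> f \<in> \<Omega> \<Longrightarrow> \<not> B e' f \<Longrightarrow> \<not> B e' (M e f)"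
  shows "(\<Sum>f | f \<in> \<Omega> \<and> (\<forall>e\<in>Q. \<not> B e f). wt V f) \<le> modgain L d ^ card Q * (\<Sum>f\<in>\<Omega>. wt V f)"
  using assms(1) M B N agree indep
proof (induction Q rule: finite_induct)
  case empty
  thus ?case by simp
next
  case (insert e Q)
  have fin\<Omega>: "finite \<Omega>" using \<Omega> by (rule finite_subset) (use assms(2) in \<open>auto intro: finite_PiE\<close>)
  define A where "A = {f \<in> \<Omega>. \<forall>e\<in>Q. \<not> B e f}"
  define Bad where "Bad = {f \<in> A. B e f}"
  define Good where "Good = {f \<in> A. \<not> B e f}"
  have fin: "finite A" "finite Bad" "finite Good" using fin\<Omega> by (auto simp: A_def Bad_def Good_def)
  have IH: "(\<Sum>f\<in>A. wt V f) \<le> modgain L d ^ card Q * (\<Sum>f\<in>\<Omega>. wt V f)"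
    unfolding A_def by (rule insert.IH) (use insert.prems in auto)
  have split: "(\<Sum>f\<in>A. wt V f) = (\<Sum>f\<in>Good. wt V f) + (\<Sum>f\<in>Bad. wt V f)"
  proof -
    have "A = Good \<union> Bad" "Good \<inter> Bad = {}" by (auto simp: Good_def Bad_def)
    thus ?thesis using fin by (metis sum.union_disjoint)
  qed
  \<comment> \<open>The map \<open>M e\<close> sends words avoiding the events of \<open>Q\<close>
    to words that still avoid them and satisfy \<open>B e\<close>.\<close>
  have "(\<Sum>f\<in>A. wt V f) \<le> real (L ^ d) * (1 / rgold ^ (L * d)) * (\<Sum>f\<in>Bad. wt V f)"
  proof (rule sum_fibre_le[where F = "M e"])
    show "M e ` A \<subseteq> Bad"
      using insert.prems(1,2,6) insert.hyps(2) by (fastforce simp: A_def Bad_def)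
    fix b assume "b \<in> Bad"
    have "{a \<in> A. M e a = b} \<subseteq> {f \<in> PiE V (\<lambda>_. {1..L}). \<forall>i. i \<notin> N e \<longrightarrow> f i = b i}"
    proof
      fix a assume "a \<in> {a \<in> A. M e a = b}"
      hence a: "a \<in> \<Omega>" "M e a = b" by (auto simp: A_def)
      have "a i = b i" if "i \<notin> N e" for i using insert.prems(5)[of e a i] a that by simp
      thus "a \<in> {f \<in> PiE V (\<lambda>_. {1..L}). \<forall>i. i \<notin> N e \<longrightarrow> f i = b i}" using a \<Omega> by blast
    qed
    moreover have "finite {f \<in> PiE V (\<lambda>_. {1..L}). \<forall>i. i \<notin> N e \<longrightarrow> f i = b i}"
      by (rule finite_PiE_Collect[OF assms(2)])
    ultimately have "card {a \<in> A. M e a = b}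
        \<le> card {f \<in> PiE V (\<lambda>_. {1..L}). \<forall>i. i \<notin> N e \<longrightarrow> f i = b i}"
      by (rule card_mono[rotated])
    also have "\<dots> \<le> L ^ d" using insert.prems assms by (intro card_agree_off_le) auto
    finally show "card {a \<in> A. M e a = b} \<le> L ^ d" .
  next
    fix a assume a: "a \<in> A"
    have "wt V a \<le> wt V (M e a) / rgold ^ (L * d)"
    proof (rule wt_agree_off_le)
      show "a \<in> PiE V (\<lambda>_. {1..L})" using a \<Omega> by (auto simp: A_def)
      show "M e a \<in> PiE V (\<lambda>_. {1..L})" using a \<Omega> insert.prems(1)[of e a] by (auto simp: A_def)
      show "a i = M e a i" if "i \<notin> N e" for i
        using insert.prems(5)[of e a i] a that by (auto simp: A_def)
    qed (use insert.prems assms in auto)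
    thus "wt V a \<le> 1 / rgold ^ (L * d) * wt V (M e a)" by simp
  qed (use fin rgold_pos in \<open>auto intro: wt_nonneg\<close>)
  hence "rgold ^ (L * d) / real L ^ d * (\<Sum>f\<in>A. wt V f) \<le> (\<Sum>f\<in>Bad. wt V f)"
    using rgold_pos assms(3) by (simp add: field_simps)
  hence "(\<Sum>f\<in>Good. wt V f) \<le> modgain L d * (\<Sum>f\<in>A. wt V f)"
    using split unfolding modgain_def by (simp add: algebra_simps)
  also have "\<dots> \<le> modgain L d * (modgain L d ^ card Q * (\<Sum>f\<in>\<Omega>. wt V f))"
    using IH modgain_bounds[OF assms(3)] by (intro mult_left_mono) auto
  finally have "(\<Sum>f\<in>Good. wt V f) \<le> modgain L d ^ card (insert e Q) * (\<Sum>f\<in>\<Omega>. wt V f)"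
    using insert.hyps by (simp add: mult.assoc)
  moreover have "{f \<in> \<Omega>. \<forall>e'\<in>insert e Q. \<not> B e' f} = Good" by (auto simp: Good_def A_def)
  ultimately show ?case by simp
qed

text \<open>A word is recovered from its image by naming \<open>J\<close> positions and their former
  letters. Letters only decrease, so the image weighs at least as much. For constant
  \<open>J\<close> the loss is polynomial in \<open>m\<close>.\<close>

lemma sum_few_changes_le:
  assumes "m \<ge> 1" "L \<ge> 1" "finite A" "finite G" "A \<subseteq> PiE {1..<m} (\<lambda>_. {1..L})"
    and "F ` A \<subseteq> G"
    and "\<And>f i. f \<in> A \<Longrightarrow> i \<in> {1..<m} \<Longrightarrow> F f i \<le> f i"
    and J: "\<And>f. f \<in> A \<Longrightarrow> \<exists>X\<subseteq>{1..<m}. card X \<le> J \<and> (\<forall>i. i \<notin> X \<longrightarrow> F f i = f i)"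
  shows "(\<Sum>f\<in>A. wt {1..<m} f) \<le> (real m * real L) ^ J * (\<Sum>f\<in>G. wt {1..<m} f)"
proof -
  have "(\<Sum>f\<in>A. wt {1..<m} f) \<le> real (m ^ J * L ^ J) * 1 * (\<Sum>f\<in>G. wt {1..<m} f)"
  proof (rule sum_fibre_le[where F = F])
    fix b assume "b \<in> G"
    let ?S = "\<lambda>xs. {f \<in> PiE {1..<m} (\<lambda>_. {1..L}). \<forall>i. i \<notin> set xs \<longrightarrow> f i = b i}"
    let ?X = "{xs. set xs \<subseteq> {0..<m} \<and> length xs = J}"
    have "{a \<in> A. F a = b} \<subseteq> (\<Union>xs\<in>?X. ?S xs)"
    proof
      fix a assume a: "a \<in> {a \<in> A. F a = b}"
      then obtain X where X: "X \<subseteq> {1..<m}" "card X \<le> J" "\<And>i. i \<notin> X \<Longrightarrow> b i = a i"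
        using J by blast
      have "finite X" using X(1) finite_subset by blast
      \<comment> \<open>Position 0 is not an index of a word; it pads every list to the common
        length \<open>J\<close>.\<close>
      define xs where "xs = sorted_list_of_set X @ replicate (J - card X) 0"
      have "xs \<in> ?X" using X \<open>finite X\<close> assms(1) by (auto simp: xs_def)
      moreover have "a \<in> ?S xs" using X \<open>finite X\<close> a assms(5) by (auto simp: xs_def)
      ultimately show "a \<in> (\<Union>xs\<in>?X. ?S xs)" by blast
    qed
    hence "card {a \<in> A. F a = b} \<le> card (\<Union>xs\<in>?X. ?S xs)"
      by (rule card_mono[rotated]) (intro finite_UN_I finite_PiE_Collect; simp add: finite_lists_length_eq)
    also have "\<dots> \<le> (\<Sum>xs\<in>?X. card (?S xs))"
      by (rule card_UN_le) (rule finite_lists_length_eq, simp)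
    also have "\<dots> \<le> (\<Sum>xs\<in>?X. L ^ J)"
      by (intro sum_mono card_agree_off_le) (use assms card_length in auto)
    also have "\<dots> = m ^ J * L ^ J" by (simp add: card_lists_length_eq)
    finally show "card {a \<in> A. F a = b} \<le> m ^ J * L ^ J" .
  qed (use assms in \<open>auto intro!: wt_antimono wt_nonneg\<close>)
  thus ?thesis by (simp add: power_mult_distrib)
qed

text \<open>The Kunz word \<open>f\<close> of a semigroup of multiplicity \<open>m\<close> is normalised so that \<open>pts m f i = f i * m + i\<close>
  is the least element congruent to \<open>i\<close> modulo \<open>m\<close>; the genus is then the sum of the letters.
  In \<open>fwords\<close> the letters at positions above \<open>d\<close> are 1 or 2, which are free of Kunz constraints;
  since \<open>rgold + rgold\<^sup>2 = 1\<close>, such letters form a probability distribution.\<close>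

definition words :: "nat \<Rightarrow> nat \<Rightarrow> (nat \<Rightarrow> nat) set" where
  "words m L = PiE {1..<m} (\<lambda>_. {1..L})"

lemma finite_words: "finite (words m L)"
  unfolding words_def by (intro finite_PiE) auto

definition pts :: "nat \<Rightarrow> (nat \<Rightarrow> nat) \<Rightarrow> nat \<Rightarrow> nat" where
  "pts m f i = f i * m + i"

definition kunz :: "nat \<Rightarrow> (nat \<Rightarrow> nat) \<Rightarrow> bool" where
  "kunz m f \<longleftrightarrow> (\<forall>i\<in>{1..<m}. \<forall>j\<in>{1..<m}. \<forall>q\<in>{1..<m}. (i + j) mod m = q \<longrightarrow> pts m f q \<le> pts m f i + pts m f j)"

definition fwords :: "nat \<Rightarrow> nat \<Rightarrow> nat \<Rightarrow> (nat \<Rightarrow> nat) set" where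
  "fwords m L d = PiE {1..<m} (\<lambda>i. if i \<le> d then {1..L} else {1..2})"

lemma fwords_subset: "L \<ge> 2 \<Longrightarrow> fwords m L d \<subseteq> words m L"
  unfolding fwords_def words_def by (rule PiE_mono) auto

lemma finite_fwords: "finite (fwords m L d)"
  unfolding fwords_def by (intro finite_PiE) auto

text \<open>If the Apery set stays below or at \<open>3 * m + d\<close>, a letter of 3 or more can
  occur only at positions up to \<open>d\<close>. Each of these exceptional positions costs a factor
  \<open>1 / rgold\<close>; the others cost nothing.\<close>

lemma sum_fwords_le: "(\<Sum>f\<in>fwords m L d. wt {1..<m} f) \<le> (1 / rgold) ^ d"
proof -
  let ?A = "\<lambda>i. if i \<le> d then {1..L} else {1..2::nat}"
  have "(\<Sum>f\<in>fwords m L d. wt {1..<m} f) = (\<Prod>i\<in>{1..<m}. \<Sum>k\<in>?A i. rgold ^ k)"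
    unfolding fwords_def wt_def by (rule prod_sum_PiE[symmetric]) auto
  also have "\<dots> \<le> (\<Prod>i\<in>{1..<m}. if i \<le> d then 1 / rgold else 1)"
    using sum_rgold_le[of L] sum_rgold_12 rgold_pos by (intro prod_mono) (auto intro!: sum_nonneg)
  also have "\<dots> = (1 / rgold) ^ card ({1..<m} \<inter> {i. i \<le> d})"
    by (subst prod.If_cases) auto
  also have "\<dots> \<le> (1 / rgold) ^ d"
  proof (rule power_increasing)
    have "card ({1..<m} \<inter> {i. i \<le> d}) \<le> card {1..d}" by (rule card_mono) auto
    thus "card ({1..<m} \<inter> {i. i \<le> d}) \<le> d" by simp
    show "1 \<le> 1 / rgold" using rgold_facts by simp
  qed
  finally show ?thesis .
qed

section \<open>Words with two close gaps\<close>

lemma sum_Union_le: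
  fixes g :: "'a \<Rightarrow> real"
  assumes "finite I" "\<And>i. i \<in> I \<Longrightarrow> finite (A i)" "\<And>x. g x \<ge> 0"
  shows "sum g (\<Union>i\<in>I. A i) \<le> (\<Sum>i\<in>I. sum g (A i))"
  using assms(1,2)
proof (induction I rule: finite_induct)
  case (insert i I)
  have "sum g (A i \<union> (\<Union>j\<in>I. A j)) + sum g (A i \<inter> (\<Union>j\<in>I. A j)) = sum g (A i) + sum g (\<Union>j\<in>I. A j)"
    by (rule sum.union_inter) (use insert in auto)
  moreover have "sum g (A i \<inter> (\<Union>j\<in>I. A j)) \<ge> 0" using assms(3) by (intro sum_nonneg)
  moreover have "sum g (\<Union>j\<in>I. A j) \<le> (\<Sum>j\<in>I. sum g (A j))" using insert by auto
  ultimately show ?case using insert.hyps by simp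
qed simp

lemma sum_Union_le_const:
  fixes g :: "'a \<Rightarrow> real"
  assumes "finite I" "A \<subseteq> (\<Union>i\<in>I. B i)" "\<And>i. i \<in> I \<Longrightarrow> finite (B i)" "\<And>x. g x \<ge> 0"
    and "\<And>i. i \<in> I \<Longrightarrow> sum g (B i) \<le> c" "card I \<le> n" "c \<ge> 0"
  shows "sum g A \<le> real n * c"
proof -
  have "sum g A \<le> sum g (\<Union>i\<in>I. B i)" using assms by (intro sum_mono2) auto
  also have "\<dots> \<le> (\<Sum>i\<in>I. sum g (B i))" by (rule sum_Union_le) (use assms in auto)
  also have "\<dots> \<le> (\<Sum>i\<in>I. c)" using assms by (intro sum_mono) auto
  also have "\<dots> \<le> real n * c" using assms by (simp add: mult_right_mono)
  finally show ?thesis .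
qed

text \<open>Suppose that \<open>v = (K - 1) * m + r\<close> and \<open>v - a\<close> are gaps. If no element
  of the Apery set exceeds \<open>v + m\<close>, then the letters are at most \<open>cap K r\<close>, and any two letters
  whose positions sum to \<open>v\<close> or \<open>v - a\<close> modulo \<open>m\<close>, on the same side of \<open>r\<close>, sum to at least \<open>cap K r\<close>.
  The graph \<open>adj\<close> consists of about \<open>2 * a\<close> paths, so \<open>forest_sum_le_1\<close> bounds the total weight
  by \<open>exp (O(a))\<close>.\<close>

definition cap :: "nat \<Rightarrow> nat \<Rightarrow> nat \<Rightarrow> nat" where
  "cap K r i = (if i \<le> r then K else K - 1)"

definition adj :: "nat \<Rightarrow> nat \<Rightarrow> nat \<Rightarrow> nat \<Rightarrow> nat \<Rightarrow> bool" where
  "adj m r a i j \<longleftrightarrow> i < r \<and> j < r \<and> (i + j = r \<or> i + j + a = r) \<or>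
     r < i \<and> r < j \<and> (i + j = m + r \<or> i + j + a = m + r)"

definition pwords :: "nat \<Rightarrow> nat \<Rightarrow> nat \<Rightarrow> nat \<Rightarrow> (nat \<Rightarrow> nat) set" where
  "pwords m K r a = {f \<in> PiE {1..<m} (\<lambda>i. {1..cap K r i}).
     \<forall>i\<in>{1..<m}. \<forall>j\<in>{1..<m}. i \<noteq> j \<longrightarrow> adj m r a i j \<longrightarrow> cap K r i \<le> f i + f j}"

lemma cap_le: "cap K r i \<le> K"
  by (simp add: cap_def)

lemma pwords_subset: "K \<le> L \<Longrightarrow> pwords m K r a \<subseteq> words m L"
proof -
  assume "K \<le> L"
  hence "PiE {1..<m} (\<lambda>i. {1..cap K r i}) \<subseteq> words m L"
    unfolding words_def by (intro PiE_mono) (auto simp: cap_def)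
  thus ?thesis unfolding pwords_def by (rule subset_trans[OF Collect_restrict])
qed

lemma finite_pwords: "finite (pwords m K r a)"
  by (rule finite_subset[OF pwords_subset[OF order_refl] finite_words])

text \<open>On each side of \<open>r\<close> the neighbours of \<open>i\<close> are its images under
  two reflections. Keeping only the edges that point towards the centre of a side gives a forest for
  \<open>forest_sum_le_1\<close>.\<close>

lemma sum_pwords_le:
  assumes K: "3 \<le> K" "K \<le> L" and r: "1 \<le> r" "r < m" and a: "a \<ge> 1"
  shows "(\<Sum>f\<in>pwords m K r a. wt {1..<m} f) \<le> (1 / rgold) ^ (L * (2 * a + 3))"
proof -
  define \<sigma> where "\<sigma> i = (if i < r then r else m + r)" for i
  define E where "E = {i \<in> {1..<m}. i \<noteq> r \<and> (\<sigma> i < 2 * i \<or> 2 * i + 2 * a < \<sigma> i)}"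
  \<comment> \<open>The first reflection keeps the distance to the centre
    \<open>\<sigma> i / 2\<close> and moves \<open>i\<close> below it; the second brings a point far
    below the centre closer by \<open>a\<close>. The summand 1 in \<open>rk\<close> breaks the tie
    in the first case.\<close>
  define par where "par i = (if \<sigma> i < 2 * i then \<sigma> i - i else \<sigma> i - a - i)" for i
  define rk where "rk i = (if \<sigma> i < 2 * i then 2 * (2 * i - \<sigma> i) + 1 else 2 * (\<sigma> i - 2 * i))" for i
  let ?V = "{1..<m}"
  define Lv where "Lv = ?V - par ` E"
  have side: "par i \<in> ?V \<and> (par i < r \<longleftrightarrow> i < r) \<and> par i \<noteq> r" if "i \<in> E" for i
    using that r by (auto simp: E_def par_def \<sigma>_def split: if_splits)
  have \<sigma>par: "\<sigma> (par i) = \<sigma> i" if "i \<in> E" for i using side[OF that] by (simp add: \<sigma>_def)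
  have rk: "rk (par i) < rk i" if "i \<in> E" for i
    using that a unfolding rk_def \<sigma>par[OF that] by (auto simp: E_def par_def \<sigma>_def split: if_splits)
  have inj: "inj_on par E"
  proof (rule inj_onI)
    fix i j assume ij: "i \<in> E" "j \<in> E" "par i = par j"
    hence s: "\<sigma> i = \<sigma> j" using side[of i] side[of j] by (simp add: \<sigma>_def)
    have b: "i < \<sigma> i" "j < \<sigma> j" using ij by (auto simp: E_def \<sigma>_def)
    show "i = j" using ij s b by (auto simp: E_def par_def split: if_splits)
  qed
  have leaf: "(\<Sum>f\<in>PiE ?V (\<lambda>v. {1..cap K r v}). if \<forall>v\<in>E. cap K r v \<le> f v + f (par v)
            then wt ?V f * (\<Prod>v\<in>Lv. leafwt (cap K r v) (f v)) else 0) \<le> 1"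
    unfolding Lv_def
  proof (rule forest_sum_le_1[where rk = rk])
    show "rk (par v) < rk v" if "v \<in> E" for v using rk[OF that] .
    show "inj_on par E" by (rule inj)
    show "par ` E \<subseteq> ?V" using side by blast
    show "cap K r (par v) = cap K r v" if "v \<in> E" for v
      using side[OF that] that by (auto simp: cap_def E_def)
  qed (use K in \<open>auto simp: cap_def E_def\<close>)
  \<comment> \<open>A vertex has no child only if it is near the end of its side, where the child
    falls outside, or at the centre, which the first reflection fixes.\<close>
  have Lv_sub: "Lv \<subseteq> {r - a..r} \<union> {m - a..<m} \<union> {r div 2, (m + r) div 2}"
  proof
    fix i assume "i \<in> Lv"
    hence i: "i \<in> ?V" "i \<notin> par ` E" by (auto simp: Lv_def)
    show "i \<in> {r - a..r} \<union> {m - a..<m} \<union> {r div 2, (m + r) div 2}"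
    proof (rule ccontr)
      assume not: "i \<notin> {r - a..r} \<union> {m - a..<m} \<union> {r div 2, (m + r) div 2}"
      define c where "c = (if 2 * i < \<sigma> i then \<sigma> i - i else \<sigma> i - a - i)"
      have ir: "i \<noteq> r" using not by auto
      have ne: "2 * i \<noteq> \<sigma> i" using not by (auto simp: \<sigma>_def)
      have b: "i < \<sigma> i" "i + a < \<sigma> i \<or> 2 * i < \<sigma> i" using i not ir by (auto simp: \<sigma>_def)
      have "c \<in> ?V \<and> c \<noteq> r \<and> (c < r \<longleftrightarrow> i < r)"
      proof (cases "i < r")
        case True
        hence "\<sigma> i = r" by (simp add: \<sigma>_def)
        thus ?thesis using True b ne i r unfolding c_def by auto
      next
        case False
        hence "\<sigma> i = m + r" "i < m - a" using not i ir by (auto simp: \<sigma>_def)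
        thus ?thesis using False b ne i ir unfolding c_def by auto
      qed
      hence c: "c \<in> ?V" "c \<noteq> r" "\<sigma> c = \<sigma> i" by (auto simp: \<sigma>_def)
      have "par c = i \<and> (\<sigma> i < 2 * c \<or> 2 * c + 2 * a < \<sigma> i)"
        unfolding par_def c(3) using b ne by (auto simp: c_def)
      hence "c \<in> E" "par c = i" using c by (auto simp: E_def)
      thus False using i by blast
    qed
  qed
  have "card Lv \<le> card ({r - a..r} \<union> {m - a..<m} \<union> {r div 2, (m + r) div 2})"
    using Lv_sub by (intro card_mono) auto
  also have "\<dots> \<le> card {r - a..r} + card {m - a..<m} + card {r div 2, (m + r) div 2}"
    by (meson add_le_cancel_right card_Un_le le_trans)
  also have "\<dots> \<le> (a + 1) + a + 2"
    by (intro add_mono) (auto simp: card_insert_if)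
  finally have cardL: "card Lv \<le> 2 * a + 3" by simp
  \<comment> \<open>Bounding all leaf weights from below removes them from the sum; this is the
    whole factor in the conclusion.\<close>
  have leaf_ge: "rgold ^ (L * (2 * a + 3)) \<le> (\<Prod>v\<in>Lv. leafwt (cap K r v) (f v))" for f :: "nat \<Rightarrow> nat"
  proof -
    have "rgold ^ (L * (2 * a + 3)) \<le> (rgold ^ L) ^ card Lv"
      unfolding power_mult[symmetric] using cardL rgold_facts by (intro power_decreasing) auto
    also have "\<dots> = (\<Prod>v\<in>Lv. rgold ^ L)" by simp
    also have "\<dots> \<le> (\<Prod>v\<in>Lv. leafwt (cap K r v) (f v))"
    proof (rule prod_mono)
      fix v
      have "cap K r v - 1 - f v \<le> L" using cap_le[of K r v] K by linarith
      thus "0 \<le> rgold ^ L \<and> rgold ^ L \<le> leafwt (cap K r v) (f v)"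
        unfolding leafwt_def using rgold_facts by (auto intro: power_decreasing)
    qed
    finally show ?thesis .
  qed
  have adjE: "adj m r a v (par v) \<and> v \<noteq> par v" if "v \<in> E" for v
  proof -
    have "v \<noteq> par v" using rk[OF that] by auto
    thus ?thesis using that by (auto simp: E_def par_def \<sigma>_def adj_def split: if_splits)
  qed
  have "(\<Sum>f\<in>pwords m K r a. wt ?V f * rgold ^ (L * (2 * a + 3)))
     \<le> (\<Sum>f\<in>pwords m K r a. if \<forall>v\<in>E. cap K r v \<le> f v + f (par v)
            then wt ?V f * (\<Prod>v\<in>Lv. leafwt (cap K r v) (f v)) else 0)"
  proof (rule sum_mono)
    fix f assume f: "f \<in> pwords m K r a"
    have "\<forall>v\<in>E. cap K r v \<le> f v + f (par v)"
    proof
      fix v assume v: "v \<in> E"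
      have "v \<in> ?V" "par v \<in> ?V" using side[OF v] v by (auto simp: E_def)
      thus "cap K r v \<le> f v + f (par v)" using adjE[OF v] f by (auto simp: pwords_def)
    qed
    thus "wt ?V f * rgold ^ (L * (2 * a + 3)) \<le> (if \<forall>v\<in>E. cap K r v \<le> f v + f (par v)
            then wt ?V f * (\<Prod>v\<in>Lv. leafwt (cap K r v) (f v)) else 0)"
      using leaf_ge by (simp add: mult_left_mono wt_nonneg)
  qed
  also have "\<dots> \<le> (\<Sum>f\<in>PiE ?V (\<lambda>v. {1..cap K r v}). if \<forall>v\<in>E. cap K r v \<le> f v + f (par v)
            then wt ?V f * (\<Prod>v\<in>Lv. leafwt (cap K r v) (f v)) else 0)"
    by (rule sum_mono2) (auto simp: pwords_def intro!: finite_PiE mult_nonneg_nonneg prod_nonneg wt_nonneg leafwt_nonneg)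
  also note leaf
  finally have "(\<Sum>f\<in>pwords m K r a. wt ?V f) * rgold ^ (L * (2 * a + 3)) \<le> 1"
    by (simp add: sum_distrib_right)
  thus ?thesis using rgold_pos by (simp add: power_one_over field_simps)
qed

text \<open>A third gap congruent to \<open>s\<close> modulo \<open>m\<close>, lying above \<open>2 * m + s\<close>, forbids two letters 1 at positions
  with sum \<open>s\<close>.\<close>

definition avoids :: "nat \<Rightarrow> nat \<Rightarrow> (nat \<Rightarrow> nat) \<Rightarrow> bool" where
  "avoids m s f \<longleftrightarrow> (\<forall>i\<in>{1..<m}. \<forall>j\<in>{1..<m}. i + j = s \<longrightarrow> \<not> (f i = 1 \<and> f j = 1))"

definition pairs :: "nat \<Rightarrow> nat \<Rightarrow> nat set" where
  "pairs m s = {i. 0 < i \<and> 2 * i < s \<and> s < m + i}"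

lemma pairs_facts:
  assumes "i \<in> pairs m s"
  shows "i \<in> {1..<m}" "s - i \<in> {1..<m}" "i + (s - i) = s" "i < s - i"
  using assms by (auto simp: pairs_def)

lemma finite_pairs: "finite (pairs m s)"
  by (rule finite_subset[of _ "{..<s}"]) (auto simp: pairs_def)

text \<open>Pairs are scarcest for \<open>s\<close> at the two ends of its range;
  \<open>2 * D \<le> m\<close> makes the upper end as good as the lower one.\<close>

lemma card_pairs:
  assumes "D \<le> s" "s < m + D" "2 * D \<le> m" "2 * n + 2 \<le> D"
  shows "n \<le> card (pairs m s)"
proof -
  have "pairs m s = {Suc (s - m)..(s - 1) div 2}" by (auto simp: pairs_def)
  thus ?thesis using assms by auto
qed

text \<open>Common frame for \<open>fwords\<close> and \<open>pwords\<close>. Distinct pairs with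
  sum \<open>s\<close> are disjoint, and by the last hypothesis \<open>M i\<close> creates no letter
  1 outside its own pair, so the events do not interfere. The 6 allows for two positions and two
  neighbours of each.\<close>

lemma sum_pairs_avoid_le:
  assumes L: "L \<ge> 2" and D: "D \<le> s" "s < m + D" "2 * D \<le> m" "2 * n + 2 \<le> D"
    and \<Omega>: "\<Omega> \<subseteq> words m L" and W: "(\<Sum>f\<in>\<Omega>. wt {1..<m} f) \<le> W"
    and M: "\<And>i f. i \<in> pairs m s \<Longrightarrow> f \<in> \<Omega> \<Longrightarrow> M i f \<in> \<Omega>"
    and B: "\<And>i f. i \<in> pairs m s \<Longrightarrow> f \<in> \<Omega> \<Longrightarrow> M i f i = 1 \<and> M i f (s - i) = 1"
    and N: "\<And>i. i \<in> pairs m s \<Longrightarrow> finite (N i)" "\<And>i. i \<in> pairs m s \<Longrightarrow> card (N i) \<le> 6"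
    and agree: "\<And>i f k. i \<in> pairs m s \<Longrightarrow> f \<in> \<Omega> \<Longrightarrow> k \<notin> N i \<Longrightarrow> M i f k = f k"
    and one: "\<And>i f k. i \<in> pairs m s \<Longrightarrow> f \<in> \<Omega> \<Longrightarrow> k \<noteq> i \<Longrightarrow> k \<noteq> s - i \<Longrightarrow> M i f k = 1 \<Longrightarrow> f k = 1"
  shows "(\<Sum>f | f \<in> \<Omega> \<and> avoids m s f. wt {1..<m} f) \<le> modgain L 6 ^ n * W"
proof -
  let ?B = "\<lambda>i f. f i = 1 \<and> f (s - i) = (1::nat)"
  have fin: "finite \<Omega>" using finite_subset[OF \<Omega> finite_words] .
  have "(\<Sum>f | f \<in> \<Omega> \<and> avoids m s f. wt {1..<m} f)
      \<le> (\<Sum>f | f \<in> \<Omega> \<and> (\<forall>i\<in>pairs m s. \<not> ?B i f). wt {1..<m} f)"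
  proof (rule sum_mono2)
    show "{f \<in> \<Omega>. avoids m s f} \<subseteq> {f \<in> \<Omega>. \<forall>i\<in>pairs m s. \<not> ?B i f}"
      unfolding avoids_def using pairs_facts[of _ m s] by blast
  qed (use fin in \<open>auto intro: wt_nonneg\<close>)
  also have "\<dots> \<le> modgain L 6 ^ card (pairs m s) * (\<Sum>f\<in>\<Omega>. wt {1..<m} f)"
  proof (rule local_modification[where M = M and N = N])
    show "\<not> ?B e' (M e f)"
      if "e \<in> pairs m s" "e' \<in> pairs m s" "e' \<noteq> e" "f \<in> \<Omega>" "\<not> ?B e' f" for e e' f
    proof -
      have ne: "e' \<noteq> e" "e' \<noteq> s - e" "s - e' \<noteq> e" "s - e' \<noteq> s - e"
        using pairs_facts[OF that(1)] pairs_facts[OF that(2)] that(3) by auto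
      show ?thesis using one[OF that(1,4) ne(1,2)] one[OF that(1,4) ne(3,4)] that(5) by blast
    qed
  qed (use L \<Omega> M B N agree finite_pairs in \<open>auto simp: words_def\<close>)
  also have "\<dots> \<le> modgain L 6 ^ n * W"
  proof (rule mult_mono)
    show "modgain L 6 ^ card (pairs m s) \<le> modgain L 6 ^ n"
      using modgain_bounds[of L 6] L card_pairs[OF D] by (intro power_decreasing) auto
  qed (use W L modgain_bounds[of L 6] in \<open>auto intro!: sum_nonneg wt_nonneg\<close>)
  finally show ?thesis .
qed

lemma sum_fwords_avoid_le:
  assumes L: "L \<ge> 2" and D: "D \<le> s" "s < m + D" "2 * D \<le> m" "2 * n + 2 \<le> D"
  shows "(\<Sum>f | f \<in> fwords m L d \<and> avoids m s f. wt {1..<m} f) \<le> modgain L 6 ^ n * (1 / rgold) ^ d"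
proof (rule sum_pairs_avoid_le[OF L D fwords_subset[OF L] sum_fwords_le,
      where M = "\<lambda>i f. f(i := 1, s - i := 1)" and N = "\<lambda>i. {i, s - i}"])
  fix i f assume i: "i \<in> pairs m s" and f: "f \<in> fwords m L d"
  show "f(i := 1, s - i := 1) \<in> fwords m L d"
    using f pairs_facts[OF i] L unfolding fwords_def
    by (auto simp: PiE_iff extensional_def)
qed (auto dest: pairs_facts simp: card_insert_if)

text \<open>After two letters are set to 1, raising all their neighbours to the cap restores the
  constraints. This needs the two positions not to be adjacent to each other, which is what the four
  conditions on \<open>s\<close> ensure. The caps are at least 2, so no letter 1 arises
  elsewhere.\<close>

lemma sum_pwords_avoid_le:
  assumes K: "3 \<le> K" "K \<le> L" and r: "1 \<le> r" "r < m" and a: "a \<ge> 1"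
    and D: "D \<le> s" "s < m + D" "2 * D \<le> m" "2 * n + 2 \<le> D"
    and s: "s \<noteq> r" "s \<noteq> m + r" "s + a \<noteq> r" "s + a \<noteq> m + r"
  shows "(\<Sum>f | f \<in> pwords m K r a \<and> avoids m s f. wt {1..<m} f)
     \<le> modgain L 6 ^ n * (1 / rgold) ^ (L * (2 * a + 3))"
proof -
  define \<sigma> where "\<sigma> i = (if i < r then r else m + r)" for i
  define M where "M i f k = (if k = i \<or> k = s - i then 1
      else if k \<in> {1..<m} \<and> (adj m r a i k \<or> adj m r a (s - i) k) then cap K r k else f k)"
    for i and f :: "nat \<Rightarrow> nat" and k
  define xs where "xs i = [i, s - i, \<sigma> i - i, \<sigma> i - a - i, \<sigma> (s - i) - (s - i), \<sigma> (s - i) - a - (s - i)]"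
    for i
  have cap2: "cap K r k \<ge> 2" for k using K by (auto simp: cap_def)
  have L: "L \<ge> 2" using K by simp
  have adj_sym: "adj m r a i j = adj m r a j i" for i j by (auto simp: adj_def)
  have adj_cap: "cap K r i = cap K r j" if "adj m r a i j" for i j
    using that by (auto simp: adj_def cap_def)
  show ?thesis
  proof (rule sum_pairs_avoid_le[OF L D pwords_subset[OF K(2)] sum_pwords_le[OF K r a],
        where M = M and N = "\<lambda>i. set (xs i)"])
    fix i f assume i: "i \<in> pairs m s" and f: "f \<in> pwords m K r a"
    note pf = pairs_facts[OF i]
    have nadj: "\<not> adj m r a i (s - i)" using pf s by (auto simp: adj_def)
    have fb: "f k \<in> {1..cap K r k}" if "k \<in> {1..<m}" for k using f that by (auto simp: pwords_def)
    have "M i f \<in> PiE {1..<m} (\<lambda>i. {1..cap K r i})"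
    proof (rule PiE_I)
      show "M i f k \<in> {1..cap K r k}" if "k \<in> {1..<m}" for k
        using fb[OF that] cap2[of k] by (auto simp: M_def)
      show "M i f k = undefined" if "k \<notin> {1..<m}" for k
      proof -
        have "k \<noteq> i" "k \<noteq> s - i" using that pf by auto
        moreover have "f k = undefined" using f that by (auto simp: pwords_def dest: PiE_arb)
        ultimately show ?thesis using that unfolding M_def by auto
      qed
    qed
    moreover have "cap K r x \<le> M i f x + M i f y"
      if xy: "x \<in> {1..<m}" "y \<in> {1..<m}" "x \<noteq> y" "adj m r a x y" for x y
    proof -
      have c: "cap K r x = cap K r y" using adj_cap xy by blast
      have "f x + f y \<ge> cap K r x" using f xy by (auto simp: pwords_def)
      moreover have ge: "f k \<le> M i f k" if "k \<in> {1..<m}" "k \<noteq> i" "k \<noteq> s - i" for k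
        using fb[OF that(1)] that by (auto simp: M_def)
      moreover have "M i f y = cap K r y" if "x = i \<or> x = s - i"
      proof -
        have "y \<noteq> i" "y \<noteq> s - i" using that nadj xy adj_sym by metis+
        thus ?thesis using that xy by (auto simp: M_def)
      qed
      moreover have "M i f x = cap K r x" if "y = i \<or> y = s - i"
      proof -
        have "x \<noteq> i" "x \<noteq> s - i" using that nadj xy adj_sym by metis+
        moreover have "adj m r a y x" using xy adj_sym by blast
        ultimately show ?thesis using that xy by (auto simp: M_def)
      qed
      moreover have "f x \<le> M i f x" if "\<not> (x = i \<or> x = s - i)" using ge[of x] xy that by blast
      moreover have "f y \<le> M i f y" if "\<not> (y = i \<or> y = s - i)" using ge[of y] xy that by blast
      ultimately show ?thesis using c by linarith
    qed
    ultimately show "M i f \<in> pwords m K r a" by (auto simp: pwords_def)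
  next
    fix i f k assume i: "i \<in> pairs m s" and k: "k \<notin> set (xs i)"
    have nb: "k = \<sigma> j - j \<or> k = \<sigma> j - a - j" if "adj m r a j k" for j
      using that by (auto simp: adj_def \<sigma>_def)
    have "\<not> adj m r a i k" "\<not> adj m r a (s - i) k" "k \<noteq> i" "k \<noteq> s - i"
      using k nb[of i] nb[of "s - i"] by (auto simp: xs_def)
    thus "M i f k = f k" by (simp add: M_def)
  next
    fix i f k assume "k \<noteq> i" "k \<noteq> s - i" "M i f k = 1"
    thus "f k = 1" using cap2[of k] by (auto simp: M_def split: if_splits)
  next
    fix i show "card (set (xs i)) \<le> 6" using card_length[of "xs i"] by (simp add: xs_def)
  qed (auto simp: M_def)
qed

section \<open>Words with a gap well above twice the multiplicity\<close>

definition exp_small :: "(nat \<Rightarrow> real) \<Rightarrow> bool" where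
  "exp_small f \<longleftrightarrow> (\<exists>c>0. \<forall>\<^sub>F m in sequentially. f m \<le> exp (- c * real m))"

lemma exp_smallI:
  assumes c: "c > 0" and f: "\<forall>\<^sub>F m in sequentially. f m \<le> C * real m ^ p * exp (- c * real m)"
  shows "exp_small f"
proof -
  have "((\<lambda>m. C * real m ^ p * exp (- (c / 2) * real m)) \<longlongrightarrow> 0) sequentially"
    using c by real_asymp
  hence "\<forall>\<^sub>F m in sequentially. C * real m ^ p * exp (- (c / 2) * real m) < 1"
    by (rule order_tendstoD) simp
  with f have "\<forall>\<^sub>F m in sequentially. f m \<le> exp (- (c / 2) * real m)"
  proof eventually_elim
    case (elim m)
    have "exp (- c * real m) = exp (- (c / 2) * real m) * exp (- (c / 2) * real m)"
      by (simp flip: exp_add)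
    hence "C * real m ^ p * exp (- c * real m)
        = C * real m ^ p * exp (- (c / 2) * real m) * exp (- (c / 2) * real m)" by simp
    also have "\<dots> \<le> 1 * exp (- (c / 2) * real m)"
      using elim(2) by (intro mult_right_mono) auto
    finally show ?case using elim(1) by simp
  qed
  thus ?thesis unfolding exp_small_def using c by (intro exI[of _ "c / 2"]) auto
qed

lemma exp_small_add:
  assumes "exp_small f" "exp_small g"
  shows "exp_small (\<lambda>m. f m + g m)"
proof -
  from assms obtain c d where cd: "c > 0" "d > 0"
    "\<forall>\<^sub>F m in sequentially. f m \<le> exp (- c * real m)" "\<forall>\<^sub>F m in sequentially. g m \<le> exp (- d * real m)"
    unfolding exp_small_def by blast
  show ?thesis
  proof (rule exp_smallI[where p = 0 and C = 2])
    show "min c d > 0" using cd by simp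
    show "\<forall>\<^sub>F m in sequentially. f m + g m \<le> 2 * real m ^ 0 * exp (- min c d * real m)"
      using cd(3,4)
    proof eventually_elim
      case (elim m)
      have "exp (- c * real m) \<le> exp (- min c d * real m)" "exp (- d * real m) \<le> exp (- min c d * real m)"
        by (simp_all add: mult_right_mono)
      thus ?case unfolding power_0 mult_1_right using elim by linarith
    qed
  qed
qed

lemma exp_small_mono:
  assumes "exp_small g" "\<forall>\<^sub>F m in sequentially. f m \<le> g m"
  shows "exp_small f"
proof -
  from assms(1) obtain c where c: "c > 0" "\<forall>\<^sub>F m in sequentially. g m \<le> exp (- c * real m)"
    unfolding exp_small_def by blast
  have "\<forall>\<^sub>F m in sequentially. f m \<le> exp (- c * real m)"
    using assms(2) c(2) by eventually_elim simp
  thus ?thesis unfolding exp_small_def using c by blast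
qed

lemma modgain_power_le:
  assumes "L \<ge> 1"
  shows "modgain L d ^ n \<le> exp (- (1 - modgain L d) * real n)"
proof -
  have "modgain L d \<le> exp (- (1 - modgain L d))"
    using exp_ge_add_one_self[of "- (1 - modgain L d)"] by simp
  hence "modgain L d ^ n \<le> exp (- (1 - modgain L d)) ^ n"
    using modgain_bounds[OF assms] by (intro power_mono) auto
  also have "\<dots> = exp (- (1 - modgain L d) * real n)"
    by (simp add: exp_of_nat_mult[symmetric] mult.commute)
  finally show ?thesis .
qed

lemma inverse_rgold_power_le: "(1 / rgold) ^ n \<le> exp (real n)"
proof -
  have "1 / rgold = 1 + rgold"
    using rgold_pos rgold_mult_self by (simp add: field_simps)
  also have "\<dots> \<le> exp rgold" by (rule exp_ge_add_one_self)
  also have "\<dots> \<le> exp 1" using rgold_less_1 by simp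
  finally have "(1 / rgold) ^ n \<le> exp 1 ^ n" using rgold_pos by (intro power_mono) auto
  thus ?thesis by (simp add: exp_of_nat_mult[symmetric])
qed

lemma kunz_mod:
  assumes "kunz m f" "i \<in> {1..<m}" "j \<in> {1..<m}" "q \<in> {1..<m}" "(i + j) mod m = q"
  shows "f q * m + q \<le> (f i + f j) * m + (i + j)"
  using assms unfolding kunz_def pts_def by (force simp: algebra_simps)

text \<open>Two letters 1 at positions with sum \<open>s\<close> would give an element at
  \<open>2 * m + s\<close>, too low for the Apery element of \<open>q\<close>. A small
  \<open>q\<close> has too few decompositions, so \<open>q + m\<close> replaces it; the extra
  \<open>D\<close> in the hypothesis pays for that.\<close>

lemma high_letter_avoids:
  assumes k: "kunz m f" and q: "q \<in> {1..<m}" and hi: "3 * m + D \<le> pts m f q" and D: "D \<le> m"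
  shows "\<exists>s. (s = q \<or> s = q + m) \<and> D \<le> s \<and> s < m + D \<and> avoids m s f"
proof (cases "D \<le> q")
  case True
  have "avoids m q f"
    unfolding avoids_def
  proof (intro ballI impI notI)
    fix i j assume ij: "i \<in> {1..<m}" "j \<in> {1..<m}" "i + j = q" "f i = 1 \<and> f j = 1"
    have "f q * m + q \<le> (f i + f j) * m + (i + j)" by (rule kunz_mod[OF k]) (use ij q in auto)
    thus False using ij hi q by (simp add: pts_def)
  qed
  thus ?thesis using True q by auto
next
  case False
  have "avoids m (q + m) f"
    unfolding avoids_def
  proof (intro ballI impI notI)
    fix i j assume ij: "i \<in> {1..<m}" "j \<in> {1..<m}" "i + j = q + m" "f i = 1 \<and> f j = 1"
    have "f q * m + q \<le> (f i + f j) * m + (i + j)" by (rule kunz_mod[OF k]) (use ij q in auto)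
    moreover have "(f i + f j) * m = 2 * m" using ij by simp
    ultimately show False using hi False ij unfolding pts_def by linarith
  qed
  thus ?thesis using False q D by auto
qed

definition highs :: "nat \<Rightarrow> nat \<Rightarrow> (nat \<Rightarrow> nat) \<Rightarrow> nat set" where
  "highs m d f = {i \<in> {1..<m}. 3 * m + d < pts m f i}"

lemma finite_highs: "finite (highs m d f)"
  unfolding highs_def by simp

text \<open>Replacing the letters at the high positions by 2 leads into \<open>fwords\<close> and
  creates no letter 1, so \<open>avoids\<close> survives. The two thresholds differ because
  \<open>d\<close> is a cost and \<open>D\<close> a gain.\<close>

lemma sum_few_highs_le:
  assumes L: "L \<ge> 2" and D: "2 * D \<le> m" "2 * n + 2 \<le> D"
  shows "(\<Sum>f | f \<in> words m L \<and> kunz m f \<and> (\<exists>q\<in>{1..<m}. 3 * m + D \<le> pts m f q) \<and> card (highs m d f) \<le> J.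
            wt {1..<m} f)
     \<le> real m * ((real m * real L) ^ J * (modgain L 6 ^ n * (1 / rgold) ^ d))"
proof (rule sum_Union_le_const[where I = "{D..<m + D}"
      and B = "\<lambda>s. {f \<in> words m L. avoids m s f \<and> card (highs m d f) \<le> J}"])
  have m: "m \<ge> 1" using D by simp
  let ?A = "\<lambda>s. {f \<in> words m L. avoids m s f \<and> card (highs m d f) \<le> J}"
  show "{f \<in> words m L. kunz m f \<and> (\<exists>q\<in>{1..<m}. 3 * m + D \<le> pts m f q) \<and> card (highs m d f) \<le> J}
      \<subseteq> (\<Union>s\<in>{D..<m + D}. ?A s)"
  proof
    fix f
    assume "f \<in> {f \<in> words m L. kunz m f \<and> (\<exists>q\<in>{1..<m}. 3 * m + D \<le> pts m f q) \<and> card (highs m d f) \<le> J}"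
    then obtain q where f: "f \<in> words m L" "kunz m f" "card (highs m d f) \<le> J"
      and q: "q \<in> {1..<m}" "3 * m + D \<le> pts m f q" by blast
    from high_letter_avoids[OF f(2) q] D(1)
    obtain s where "D \<le> s" "s < m + D" "avoids m s f" by auto
    thus "f \<in> (\<Union>s\<in>{D..<m + D}. ?A s)" using f by auto
  qed
  show "finite (?A s)" for s by (rule finite_subset[OF _ finite_words]) auto
  fix s assume s: "s \<in> {D..<m + D}"
  let ?G = "{f \<in> fwords m L d. avoids m s f}"
  have "(\<Sum>f\<in>?A s. wt {1..<m} f) \<le> (real m * real L) ^ J * (\<Sum>f\<in>?G. wt {1..<m} f)"
  proof (rule sum_few_changes_le[where F = "\<lambda>f i. if i \<in> highs m d f then 2 else f i"])
    show "(\<lambda>f i. if i \<in> highs m d f then 2 else f i) ` ?A s \<subseteq> ?G"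
    proof (intro image_subsetI CollectI conjI)
      fix f assume f: "f \<in> ?A s"
      have "f i \<in> {1..L} \<and> (i \<notin> highs m d f \<longrightarrow> d < i \<longrightarrow> f i \<le> 2)" if i: "i \<in> {1..<m}" for i
      proof -
        have "f i \<in> {1..L}" using f i by (auto simp: words_def)
        moreover have "f i \<le> 2" if "i \<notin> highs m d f" "d < i"
        proof (rule ccontr)
          assume "\<not> f i \<le> 2"
          hence "3 * m \<le> f i * m" by (intro mult_right_mono) auto
          moreover have "pts m f i \<le> 3 * m + d" using that i by (simp add: highs_def)
          ultimately show False using that(2) unfolding pts_def by linarith
        qed
        ultimately show ?thesis by blast
      qed
      moreover have "f i = undefined" if "i \<notin> {1..<m}" for i
        using f that by (auto simp: words_def dest: PiE_arb)
      ultimately show "(\<lambda>i. if i \<in> highs m d f then 2 else f i) \<in> fwords m L d"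
        unfolding fwords_def using L by (intro PiE_I) (auto simp: highs_def)
      show "avoids m s (\<lambda>i. if i \<in> highs m d f then 2 else f i)"
        using f by (auto simp: avoids_def)
    qed
    show "(if i \<in> highs m d f then 2 else f i) \<le> f i" if "i \<in> {1..<m}" for f i
    proof (cases "i \<in> highs m d f")
      case True
      have "\<not> f i \<le> 1"
      proof
        assume "f i \<le> 1"
        hence "f i * m \<le> 1 * m" by (rule mult_le_mono1)
        moreover have "3 * m + d < f i * m + i" using True by (simp add: highs_def pts_def)
        ultimately show False using that unfolding atLeastLessThan_iff by linarith
      qed
      thus ?thesis using True by simp
    qed simp
    show "\<exists>X\<subseteq>{1..<m}. card X \<le> J \<and> (\<forall>i. i \<notin> X \<longrightarrow> (if i \<in> highs m d f then 2 else f i) = f i)"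
      if "f \<in> ?A s" for f
      using that by (intro exI[of _ "highs m d f"]) (auto simp: highs_def)
    show "finite (?A s)" by (rule finite_subset[OF _ finite_words]) auto
    show "finite ?G" by (rule finite_subset[OF _ finite_fwords]) auto
  qed (use m L in \<open>auto simp: words_def\<close>)
  also have "\<dots> \<le> (real m * real L) ^ J * (modgain L 6 ^ n * (1 / rgold) ^ d)"
    using s D L by (intro mult_left_mono sum_fwords_avoid_le) auto
  finally show "(\<Sum>f\<in>?A s. wt {1..<m} f) \<le> (real m * real L) ^ J * (modgain L 6 ^ n * (1 / rgold) ^ d)" .
qed (use modgain_bounds[of L 6] L rgold_pos in \<open>auto intro: wt_nonneg\<close>)

text \<open>Points more than \<open>a0\<close> apart have different quotients by \<open>a0\<close>,
  and \<open>pts\<close> determines the residue.\<close>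

lemma card_separated:
  assumes X: "X \<subseteq> {1..<m}" and a: "a0 \<ge> 1" and ub: "\<And>i. i \<in> X \<Longrightarrow> pts m f i \<le> b"
    and sep: "\<And>u v. u \<in> X \<Longrightarrow> v \<in> X \<Longrightarrow> pts m f u < pts m f v \<Longrightarrow> pts m f u + a0 < pts m f v"
  shows "card X \<le> b div a0 + 1"
proof -
  let ?h = "\<lambda>i. pts m f i div a0"
  have less: "?h u < ?h v" if "u \<in> X" "v \<in> X" "pts m f u < pts m f v" for u v
  proof -
    have "(pts m f u + a0) div a0 \<le> ?h v" using sep[OF that] by (intro div_le_mono) simp
    thus ?thesis using a by simp
  qed
  have "inj_on ?h X"
  proof (rule inj_onI)
    fix u v assume uv: "u \<in> X" "v \<in> X" "?h u = ?h v"
    hence "pts m f u = pts m f v" using less[of u v] less[of v u] by force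
    moreover have "pts m f u mod m = u" "pts m f v mod m = v" using uv(1,2) X by (auto simp: pts_def)
    ultimately show "u = v" by metis
  qed
  moreover have "?h ` X \<subseteq> {..b div a0}" using ub by (auto intro: div_le_mono)
  ultimately have "card X \<le> card {..b div a0}" by (intro card_inj_on_le) auto
  thus ?thesis by simp
qed

text \<open>Among many high residues, two have Apery elements at distance at most \<open>a0\<close>. Taking the highest such pair
  leaves few residues above it; truncating their letters gives a word of \<open>pwords\<close>, and any third high
  residue provides \<open>s\<close>.\<close>

lemma sum_many_highs_le:
  assumes L: "L \<ge> 3" and a0: "a0 \<ge> 1" and D: "2 * d \<le> m" "2 * n + 2 \<le> d"
    and J: "(L + 1) * m div a0 + 2 \<le> J"
  shows "(\<Sum>f | f \<in> words m L \<and> kunz m f \<and> J < card (highs m d f). wt {1..<m} f)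
     \<le> real (m * L * a0 * m) * ((real m * real L) ^ J * (modgain L 6 ^ n * (1 / rgold) ^ (L * (2 * a0 + 3))))"
proof -
  let ?trunc = "\<lambda>K r f i. if i \<in> {1..<m} then min (f i) (cap K r i) else f i"
  \<comment> \<open>The data \<open>(r, K, a, s)\<close> take only polynomially many values in
    \<open>m\<close>, so a union bound over them is affordable.\<close>
  define B where "B = (\<lambda>(r, K, a, s). {f \<in> words m L.
    ?trunc K r f \<in> pwords m K r a \<and> avoids m s (?trunc K r f) \<and> card {i \<in> {1..<m}. cap K r i < f i} \<le> J})"
  define I where "I = {(r, K, a, s) | r K a s. r \<in> {1..<m} \<and> K \<in> {3..L} \<and> a \<in> {1..a0} \<and> s \<in> {d..<m + d}
    \<and> s \<noteq> r \<and> s \<noteq> m + r \<and> s + a \<noteq> r \<and> s + a \<noteq> m + r}"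
  have m: "m \<ge> 1" using D by simp
  have sub: "I \<subseteq> {1..<m} \<times> {3..L} \<times> {1..a0} \<times> {d..<m + d}" by (auto simp: I_def)
  have finI: "finite I" by (rule finite_subset[OF sub]) auto
  have "card I \<le> card ({1..<m} \<times> {3..L} \<times> {1..a0} \<times> {d..<m + d})"
    by (rule card_mono[OF _ sub]) auto
  also have "\<dots> = (m - 1) * ((L - 2) * (a0 * m))"
    by (simp add: card_cartesian_product)
  also have "\<dots> \<le> m * (L * (a0 * m))" by (intro mult_le_mono) auto
  also have "\<dots> = m * L * a0 * m" by simp
  finally have cardI: "card I \<le> m * L * a0 * m" .
  show ?thesis
  proof (rule sum_Union_le_const[OF finI _ _ wt_nonneg _ cardI, where B = B])
    show "finite (B i)" for i
      unfolding B_def by (cases i) (auto intro: finite_subset[OF _ finite_words])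
  next
    fix i assume "i \<in> I"
    then obtain r K a s where i: "i = (r, K, a, s)" "r \<in> {1..<m}" "K \<in> {3..L}" "a \<in> {1..a0}" "s \<in> {d..<m + d}"
      "s \<noteq> r" "s \<noteq> m + r" "s + a \<noteq> r" "s + a \<noteq> m + r" by (auto simp: I_def)
    let ?G = "{f \<in> pwords m K r a. avoids m s f}"
    have "(\<Sum>f\<in>B i. wt {1..<m} f) \<le> (real m * real L) ^ J * (\<Sum>f\<in>?G. wt {1..<m} f)"
    proof (rule sum_few_changes_le[where F = "?trunc K r"])
      show "\<exists>X\<subseteq>{1..<m}. card X \<le> J \<and> (\<forall>i. i \<notin> X \<longrightarrow> ?trunc K r f i = f i)" if "f \<in> B i" for f
        using that unfolding i B_def
        by (intro exI[of _ "{i \<in> {1..<m}. cap K r i < f i}"]) auto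
      show "finite (B i)" unfolding B_def i by (auto intro: finite_subset[OF _ finite_words])
      show "finite ?G" by (rule finite_subset[OF _ finite_pwords]) auto
    qed (use m L in \<open>auto simp: B_def i words_def\<close>)
    also have "\<dots> \<le> (real m * real L) ^ J * (modgain L 6 ^ n * (1 / rgold) ^ (L * (2 * a + 3)))"
      using i D by (intro mult_left_mono sum_pwords_avoid_le) auto
    also have "\<dots> \<le> (real m * real L) ^ J * (modgain L 6 ^ n * (1 / rgold) ^ (L * (2 * a0 + 3)))"
      using modgain_bounds[of L 6] L rgold_facts i
      by (intro mult_left_mono power_increasing mult_le_mono add_mono) auto
    finally show "(\<Sum>f\<in>B i. wt {1..<m} f)
      \<le> (real m * real L) ^ J * (modgain L 6 ^ n * (1 / rgold) ^ (L * (2 * a0 + 3)))" .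
  next
    show "{f \<in> words m L. kunz m f \<and> J < card (highs m d f)} \<subseteq> (\<Union>i\<in>I. B i)"
    proof
      fix f assume "f \<in> {f \<in> words m L. kunz m f \<and> J < card (highs m d f)}"
      hence f: "f \<in> words m L" and k: "kunz m f" and big: "J < card (highs m d f)" by auto
      let ?V = "{1..<m}"
      let ?p = "pts m f"
      have fL: "f i \<in> {1..L}" if "i \<in> ?V" for i using f that by (auto simp: words_def)
      have pb: "?p i \<le> (L + 1) * m" if "i \<in> ?V" for i
      proof -
        have "f i * m \<le> L * m" using fL[OF that] by (intro mult_right_mono) auto
        moreover have "(L + 1) * m = L * m + m" by simp
        ultimately show ?thesis using that unfolding pts_def atLeastLessThan_iff by linarith
      qed
      have sepcard: "card X < J"
        if "X \<subseteq> ?V" "\<And>u v. u \<in> X \<Longrightarrow> v \<in> X \<Longrightarrow> ?p u < ?p v \<Longrightarrow> ?p u + a0 < ?p v" for X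
      proof -
        have "card X \<le> (L + 1) * m div a0 + 1"
          by (rule card_separated[where m = m and f = f]) (use that pb a0 in auto)
        thus ?thesis using J by linarith
      qed
      \<comment> \<open>The upper members of close pairs. By \<open>sepcard\<close> there are too
        many high residues for all of them to be separated.\<close>
      define C where "C = {v \<in> highs m d f. \<exists>u\<in>highs m d f. ?p u < ?p v \<and> ?p v \<le> ?p u + a0}"
      have finC: "finite C" by (simp add: C_def finite_highs)
      have "C \<noteq> {}"
      proof
        assume "C = {}"
        have "card (highs m d f) < J"
        proof (rule sepcard)
          show "highs m d f \<subseteq> ?V" by (auto simp: highs_def)
          fix u v assume "u \<in> highs m d f" "v \<in> highs m d f" "?p u < ?p v"
          thus "?p u + a0 < ?p v" using \<open>C = {}\<close> unfolding C_def by force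
        qed
        thus False using big by simp
      qed
      hence "Max (?p ` C) \<in> ?p ` C" using finC by simp
      then obtain r where r: "r \<in> C" "?p r = Max (?p ` C)" by auto
      have rmax: "?p v \<le> ?p r" if "v \<in> C" for v unfolding r(2) using finC that by simp
      from r(1) obtain u where u: "u \<in> highs m d f" "?p u < ?p r" "?p r \<le> ?p u + a0" by (auto simp: C_def)
      have rV: "r \<in> ?V" and uV: "u \<in> ?V" using r u by (auto simp: C_def highs_def)
      define K where "K = f r"
      define a where "a = ?p r - ?p u"
      have a: "a \<in> {1..a0}" using u by (auto simp: a_def)
      have pu: "f u * m + u + a = K * m + r" using u by (simp add: a_def pts_def K_def)
      have K3: "3 \<le> K"
      proof (rule ccontr)
        assume "\<not> 3 \<le> K"
        hence "K * m \<le> 2 * m" by (intro mult_right_mono) auto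
        moreover have "3 * m + d < K * m + r" using r by (auto simp: C_def highs_def pts_def K_def)
        ultimately show False using rV unfolding atLeastLessThan_iff by linarith
      qed
      have KL: "K \<le> L" using fL[OF rV] by (simp add: K_def)
      have above: "?p r < ?p i" if i: "i \<in> ?V" "cap K r i < f i" for i
      proof (cases "i \<le> r")
        case True
        hence "(K + 1) * m \<le> f i * m" using i by (intro mult_right_mono) (auto simp: cap_def)
        moreover have "(K + 1) * m = f r * m + m" by (simp add: K_def)
        ultimately show ?thesis using rV i(1) unfolding pts_def atLeastLessThan_iff by linarith
      next
        case False
        hence "f r * m \<le> f i * m" using i K3 by (intro mult_right_mono) (auto simp: cap_def K_def)
        thus ?thesis using False unfolding pts_def by linarith
      qed
      \<comment> \<open>Letters above the cap belong to Apery elements above that of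
        \<open>r\<close>. Two of these at distance at most \<open>a0\<close> would contradict the
        choice of \<open>r\<close>, so they are separated and hence few.\<close>
      have few: "card {i \<in> ?V. cap K r i < f i} \<le> J"
      proof (rule less_imp_le, rule sepcard)
        fix x y assume xy: "x \<in> {i \<in> ?V. cap K r i < f i}" "y \<in> {i \<in> ?V. cap K r i < f i}" "?p x < ?p y"
        have hi: "x \<in> highs m d f" "y \<in> highs m d f"
          using above[of x] above[of y] xy r by (auto simp: highs_def C_def)
        show "?p x + a0 < ?p y"
        proof (rule ccontr)
          assume "\<not> ?p x + a0 < ?p y"
          hence "y \<in> C" using hi xy by (auto simp: C_def not_less)
          thus False using rmax[of y] above[of y] xy by simp
        qed
      qed auto
      \<comment> \<open>The Kunz inequality at \<open>r\<close> serves the sums \<open>r\<close> and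
        \<open>m + r\<close>; the one at \<open>u\<close> serves the sums shifted by
        \<open>a\<close>, since \<open>u\<close> is congruent to \<open>r - a\<close>. For positions
        above \<open>r\<close> the carry of \<open>m\<close> costs one unit, whence the smaller cap
        there.\<close>
      have capu: "cap K r i \<le> f i + f j" if ij: "i \<in> ?V" "j \<in> ?V" "adj m r a i j" for i j
      proof -
        consider "i < r" "i + j = r" | "i < r" "i + j + a = r" | "r < i" "i + j = m + r" | "r < i" "i + j + a = m + r"
          using ij(3) by (auto simp: adj_def)
        thus ?thesis
        proof cases
          case 1
          have "f r * m + r \<le> (f i + f j) * m + (i + j)"
            by (rule kunz_mod[OF k]) (use ij rV 1 in auto)
          hence "K \<le> f i + f j" using 1 m by (simp add: K_def)
          thus ?thesis using 1 by (simp add: cap_def)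
        next
          case 2
          have eq: "f u * m + u = K * m + (i + j)" using pu 2 by simp
          have "(i + j) mod m = (K * m + (i + j)) mod m" by simp
          also have "\<dots> = u" unfolding eq[symmetric] using uV by simp
          finally have "f u * m + u \<le> (f i + f j) * m + (i + j)"
            by (intro kunz_mod[OF k]) (use ij uV in auto)
          hence "K \<le> f i + f j" using eq m by simp
          thus ?thesis using 2 by (simp add: cap_def)
        next
          case 3
          have "f r * m + r \<le> (f i + f j) * m + (i + j)"
            by (rule kunz_mod[OF k]) (use ij rV 3 in auto)
          moreover have "(f i + f j + 1) * m = (f i + f j) * m + m" by simp
          ultimately have "K * m \<le> (f i + f j + 1) * m" using 3 unfolding K_def by linarith
          hence "K \<le> f i + f j + 1" using m unfolding mult_le_cancel2 by simp
          thus ?thesis using 3 by (simp add: cap_def)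
        next
          case 4
          have eq: "f u * m + u + m = K * m + (i + j)" using pu 4 by simp
          have "(i + j) mod m = (K * m + (i + j)) mod m" by simp
          also have "\<dots> = u" unfolding eq[symmetric] using uV by simp
          finally have "f u * m + u \<le> (f i + f j) * m + (i + j)"
            by (intro kunz_mod[OF k]) (use ij uV in auto)
          moreover have "(f i + f j + 1) * m = (f i + f j) * m + m" by simp
          ultimately have "K * m \<le> (f i + f j + 1) * m" using eq by linarith
          hence "K \<le> f i + f j + 1" using m unfolding mult_le_cancel2 by simp
          thus ?thesis using 4 by (simp add: cap_def)
        qed
      qed
      have cap_adj: "cap K r i = cap K r j" if "adj m r a i j" for i j
        using that by (auto simp: adj_def cap_def)
      have cap2: "cap K r i \<ge> 2" for i using K3 by (auto simp: cap_def)
      have "?trunc K r f \<in> pwords m K r a"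
        unfolding pwords_def
      proof (intro CollectI conjI ballI impI)
        show "?trunc K r f \<in> PiE ?V (\<lambda>i. {1..cap K r i})"
        proof (rule PiE_I)
          show "?trunc K r f i \<in> {1..cap K r i}" if "i \<in> ?V" for i
            using fL[OF that] cap2[of i] that by auto
          show "?trunc K r f i = undefined" if "i \<notin> ?V" for i
            using f that by (auto simp: words_def dest: PiE_arb)
        qed
        fix i j assume ij: "i \<in> ?V" "j \<in> ?V" "adj m r a i j"
        have "cap K r i \<le> min (f i) (cap K r i) + min (f j) (cap K r j)"
          using capu[OF ij] cap_adj[OF ij(3)] by (auto simp: min_def)
        thus "cap K r i \<le> ?trunc K r f i + ?trunc K r f j" using ij by simp
      qed
      moreover obtain t where t: "t \<in> highs m d f" "t \<noteq> r" "t \<noteq> u"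
      proof -
        have "card {r, u} < card (highs m d f)" using big J by (auto simp: card_insert_if)
        hence "\<not> highs m d f \<subseteq> {r, u}" by (meson card_mono finite.emptyI finite.insertI leD)
        thus ?thesis using that by blast
      qed
      have tV: "t \<in> ?V" using t by (simp add: highs_def)
      have "\<exists>s. (s = t \<or> s = t + m) \<and> d \<le> s \<and> s < m + d \<and> avoids m s f"
        by (rule high_letter_avoids[OF k tV]) (use t D in \<open>auto simp: highs_def\<close>)
      then obtain s where s: "s = t \<or> s = t + m" "d \<le> s" "s < m + d" "avoids m s f" by blast
      have "avoids m s (?trunc K r f)"
        unfolding avoids_def
      proof (intro ballI impI notI)
        fix i j assume ij: "i \<in> ?V" "j \<in> ?V" "i + j = s" "?trunc K r f i = 1 \<and> ?trunc K r f j = 1"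
        hence "f i = 1" "f j = 1" using cap2[of i] cap2[of j] by (auto simp: min_def split: if_splits)
        thus False using s(4) ij by (auto simp: avoids_def)
      qed
      moreover have "s \<noteq> r" "s \<noteq> m + r" using s(1) t tV rV by auto
      \<comment> \<open>Such an \<open>s\<close> would make \<open>t\<close> congruent to
        \<open>u\<close>, but \<open>t\<close> was chosen as a third high residue.\<close>
      moreover have "s + a \<noteq> r \<and> s + a \<noteq> m + r"
      proof (rule ccontr)
        assume "\<not> (s + a \<noteq> r \<and> s + a \<noteq> m + r)"
        hence "t + a = r \<or> t + a = m + r \<or> t + a + m = r" using s(1) by auto
        hence eq: "f u * m + u + m = K * m + t + m \<or> f u * m + u + m = K * m + t \<or> f u * m + u = K * m + t + m"
          using pu by auto
        have "(f u * m + u) mod m = u" "(f u * m + u + m) mod m = u" "(K * m + t) mod m = t" "(K * m + t + m) mod m = t"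
          using uV tV by simp_all
        hence "u = t" using eq by metis
        thus False using t by simp
      qed
      ultimately have "f \<in> B (r, K, a, s)" "(r, K, a, s) \<in> I"
        using f few rV K3 KL a s by (auto simp: B_def I_def)
      thus "f \<in> (\<Union>i\<in>I. B i)" by blast
    qed
  qed (use modgain_bounds[of L 6] L rgold_pos in auto)
qed

section \<open>Exponential decay\<close>

lemma eventually_real_ge: "\<forall>\<^sub>F m in sequentially. c \<le> real m"
  using filterlim_real_sequentially unfolding filterlim_at_top by blast

text \<open>About \<open>\<beta> * m / 2\<close> pairs yield an exponent near
  \<open>- \<kappa> * \<beta> * m / 2\<close>. A cost of an eighth of
  \<open>\<kappa> * \<beta> * m\<close> leaves at least a quarter; the 3 absorbs the
  rounding.\<close>

lemma gain_exponent:
  fixes \<beta> \<kappa> m :: real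
  assumes "\<beta> * m - 5 \<le> 2 * real n" "\<kappa> \<ge> 0" "\<kappa> \<le> 1" "e \<le> \<kappa> * \<beta> / 8 * m + C"
  shows "exp (- \<kappa> * real n) * exp e \<le> exp (C + 3) * exp (- (\<kappa> * \<beta> / 4) * m)"
proof -
  define y where "y = \<kappa> * \<beta> * m"
  define z where "z = \<kappa> * real n"
  have "\<kappa> * (\<beta> * m - 5) \<le> \<kappa> * (2 * real n)" using assms by (intro mult_left_mono) auto
  hence "y - 5 * \<kappa> \<le> 2 * z" by (simp add: y_def z_def algebra_simps)
  moreover have "0 \<le> z" using assms by (simp add: z_def)
  moreover have "e \<le> y / 8 + C" using assms(4) by (simp add: y_def)
  ultimately have "- z + e \<le> C + 3 - y / 4" using assms(2,3) by linarith
  hence "- \<kappa> * real n + e \<le> C + 3 + - (\<kappa> * \<beta> / 4) * m" by (simp add: y_def z_def)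
  thus ?thesis by (simp flip: exp_add)
qed

text \<open>With few high residues the cost is \<open>\<delta> * m\<close> exceptional positions
  against a gain from \<open>b * m\<close>; with many, it is a number of path ends proportional to
  \<open>\<delta>0 * m\<close> against a gain from \<open>\<delta> * m\<close>.\<close>

lemma exp_small_high:
  fixes \<beta> :: real
  assumes L: "L \<ge> 3" and \<beta>: "\<beta> > 0"
  shows "exp_small (\<lambda>m. \<Sum>f | f \<in> words m L \<and> kunz m f \<and> (\<exists>q\<in>{1..<m}. (3 + \<beta>) * real m \<le> real (pts m f q)).
            wt {1..<m} f)"
proof -
  define \<kappa> where "\<kappa> = 1 - modgain L 6"
  have \<kappa>: "\<kappa> > 0" "\<kappa> \<le> 1" using modgain_bounds[of L 6] L by (auto simp: \<kappa>_def)
  \<comment> \<open>The cap at 1/2 secures \<open>2 * D \<le> m\<close>; lowering the height only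
    enlarges the event.\<close>
  define b where "b = min \<beta> (1/2)"
  have b: "b > 0" "b \<le> 1/2" "b \<le> \<beta>" using \<beta> by (auto simp: b_def)
  define \<delta> where "\<delta> = \<kappa> * b / 8"
  have "\<kappa> * b \<le> 1 * (1/2)" using \<kappa> b by (intro mult_mono) auto
  hence \<delta>: "\<delta> > 0" "\<delta> \<le> 1/16" using \<kappa> b by (auto simp: \<delta>_def)
  \<comment> \<open>Chosen so that the path ends, with exponent about
    \<open>2 * L * \<delta>0 * m\<close>, cost the eighth that \<open>gain_exponent\<close>
    allows.\<close>
  define \<delta>0 where "\<delta>0 = \<kappa> * \<delta> / (16 * real L)"
  have "\<kappa> * \<delta> \<le> 1 * (1/16)" using \<kappa> \<delta> by (intro mult_mono) auto
  hence \<delta>0: "\<delta>0 > 0" "\<delta>0 \<le> 1/2" using \<kappa> \<delta> L by (auto simp: \<delta>0_def field_simps)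
  \<comment> \<open>Gaps of length \<open>\<delta>0 * m\<close> in a range of length
    \<open>(L + 1) * m\<close> bound the number of separated residues independently of
    \<open>m\<close>, so the factor \<open>(m * L) ^ J\<close> is polynomial.\<close>
  define J where "J = nat \<lceil>(real L + 1) / \<delta>0\<rceil> + 2"
  let ?D = "\<lambda>m. nat \<lfloor>b * real m\<rfloor>"
  let ?d = "\<lambda>m. nat \<lfloor>\<delta> * real m\<rfloor>"
  let ?a = "\<lambda>m. nat \<lfloor>\<delta>0 * real m\<rfloor> + 1"
  let ?F = "\<lambda>m. {f \<in> words m L. kunz m f \<and> (\<exists>q\<in>{1..<m}. (3 + \<beta>) * real m \<le> real (pts m f q))}"
  let ?A = "\<lambda>m. {f \<in> words m L. kunz m f \<and> (\<exists>q\<in>{1..<m}. 3 * m + ?D m \<le> pts m f q) \<and> card (highs m (?d m) f) \<le> J}"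
  let ?B = "\<lambda>m. {f \<in> words m L. kunz m f \<and> J < card (highs m (?d m) f)}"
  have fin: "finite (?A m)" "finite (?B m)" for m by (auto intro: finite_subset[OF _ finite_words])
  have A: "exp_small (\<lambda>m. \<Sum>f\<in>?A m. wt {1..<m} f)"
  proof (rule exp_smallI[where p = "Suc J" and C = "real L ^ J * exp 3"])
    show "\<kappa> * b / 4 > 0" using \<kappa> b by simp
    show "\<forall>\<^sub>F m in sequentially. (\<Sum>f\<in>?A m. wt {1..<m} f)
        \<le> real L ^ J * exp 3 * real m ^ Suc J * exp (- (\<kappa> * b / 4) * real m)"
      using eventually_real_ge[of "3 / b"]
    proof eventually_elim
      case (elim m)
      hence m: "3 \<le> b * real m" using b by (simp add: field_simps)
      define n where "n = (?D m - 2) div 2"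
      have D: "b * real m - 1 \<le> real (?D m)" "real (?D m) \<le> b * real m" using m by linarith+
      have "b * real m \<le> 1/2 * real m" using b by (intro mult_right_mono) auto
      hence D2: "2 * ?D m \<le> m" "2 * n + 2 \<le> ?D m" using D m unfolding n_def by linarith+
      have n: "b * real m - 5 \<le> 2 * real n" using D m unfolding n_def by linarith
      have "real (?d m) \<le> \<delta> * real m" using \<delta> by simp
      hence d: "real (?d m) \<le> \<kappa> * b / 8 * real m + 0" by (simp only: \<delta>_def add_0_right)
      have "modgain L 6 ^ n * (1 / rgold) ^ ?d m \<le> exp (- \<kappa> * real n) * exp (real (?d m))"
        using modgain_power_le[of L 6 n] inverse_rgold_power_le[of "?d m"] L rgold_pos
        unfolding \<kappa>_def by (intro mult_mono) auto
      also have "\<dots> \<le> exp (0 + 3) * exp (- (\<kappa> * b / 4) * real m)"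
        by (rule gain_exponent[OF n _ _ d]) (use \<kappa> in auto)
      finally have gain: "modgain L 6 ^ n * (1 / rgold) ^ ?d m \<le> exp (0 + 3) * exp (- (\<kappa> * b / 4) * real m)" .
      have "(\<Sum>f\<in>?A m. wt {1..<m} f)
          \<le> real m * ((real m * real L) ^ J * (modgain L 6 ^ n * (1 / rgold) ^ ?d m))"
        by (rule sum_few_highs_le) (use D2 L in auto)
      also have "\<dots> \<le> real m * ((real m * real L) ^ J * (exp (0 + 3) * exp (- (\<kappa> * b / 4) * real m)))"
        by (intro mult_left_mono gain) auto
      finally show ?case by (simp add: power_mult_distrib mult_ac)
    qed
  qed
  have B: "exp_small (\<lambda>m. \<Sum>f\<in>?B m. wt {1..<m} f)"
  proof (rule exp_smallI[where p = "J + 3" and C = "real L ^ Suc J * exp (5 * real L + 3)"])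
    show "\<kappa> * \<delta> / 4 > 0" using \<kappa> \<delta> by simp
    show "\<forall>\<^sub>F m in sequentially. (\<Sum>f\<in>?B m. wt {1..<m} f)
        \<le> real L ^ Suc J * exp (5 * real L + 3) * real m ^ (J + 3) * exp (- (\<kappa> * \<delta> / 4) * real m)"
      using eventually_real_ge[of "3 / \<delta>"] eventually_real_ge[of 2]
    proof eventually_elim
      case (elim m)
      hence m: "3 \<le> \<delta> * real m" using \<delta> by (simp add: field_simps)
      define n where "n = (?d m - 2) div 2"
      have D: "\<delta> * real m - 1 \<le> real (?d m)" "real (?d m) \<le> \<delta> * real m" using m by linarith+
      have "\<delta> * real m \<le> 1/2 * real m" using \<delta> by (intro mult_right_mono) auto
      hence D2: "2 * ?d m \<le> m" "2 * n + 2 \<le> ?d m" using D m unfolding n_def by linarith+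
      have n: "\<delta> * real m - 5 \<le> 2 * real n" using D m unfolding n_def by linarith
      have "0 \<le> \<delta>0 * real m" using \<delta>0 by simp
      hence a: "\<delta>0 * real m \<le> real (?a m)" "real (?a m) \<le> \<delta>0 * real m + 1" by linarith+
      have "\<delta>0 * real m \<le> 1/2 * real m" using \<delta>0 by (intro mult_right_mono) auto
      hence am: "real (?a m) \<le> real m" using a elim by linarith
      have "real (L * (2 * ?a m + 3)) \<le> real L * (2 * (\<delta>0 * real m + 1) + 3)"
        using a by (simp only: of_nat_mult of_nat_add) (intro mult_left_mono; simp)
      also have "\<dots> = \<kappa> * \<delta> / 8 * real m + 5 * real L"
        using L by (simp add: \<delta>0_def field_simps)
      finally have e: "real (L * (2 * ?a m + 3)) \<le> \<kappa> * \<delta> / 8 * real m + 5 * real L" .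
      have "real ((L + 1) * m div ?a m) \<le> real ((L + 1) * m) / real (?a m)"
        by (rule of_nat_div_le_of_nat)
      also have "\<dots> \<le> real ((L + 1) * m) / (\<delta>0 * real m)"
        by (rule frac_le[OF _ order_refl _ a(1)]) (use \<delta>0 elim in auto)
      also have "\<dots> = (real L + 1) / \<delta>0" using elim \<delta>0 by (simp add: field_simps)
      finally have J: "(L + 1) * m div ?a m + 2 \<le> J" unfolding J_def by linarith
      have "modgain L 6 ^ n * (1 / rgold) ^ (L * (2 * ?a m + 3))
          \<le> exp (- \<kappa> * real n) * exp (real (L * (2 * ?a m + 3)))"
        using modgain_power_le[of L 6 n] inverse_rgold_power_le[of "L * (2 * ?a m + 3)"] L rgold_pos
        unfolding \<kappa>_def by (intro mult_mono) auto
      also have "\<dots> \<le> exp (5 * real L + 3) * exp (- (\<kappa> * \<delta> / 4) * real m)"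
        by (rule gain_exponent[OF n _ _ e]) (use \<kappa> in auto)
      finally have gain: "modgain L 6 ^ n * (1 / rgold) ^ (L * (2 * ?a m + 3))
          \<le> exp (5 * real L + 3) * exp (- (\<kappa> * \<delta> / 4) * real m)" .
      have am3: "real (m * L * ?a m * m) \<le> real L * real m ^ 3"
      proof -
        have "real (m * L * ?a m * m) = real m * real L * real m * real (?a m)"
          by (simp only: of_nat_mult mult_ac)
        also have "\<dots> \<le> real m * real L * real m * real m"
          using am by (intro mult_left_mono) auto
        finally show ?thesis by (simp add: power3_eq_cube mult_ac)
      qed
      have "(\<Sum>f\<in>?B m. wt {1..<m} f) \<le> real (m * L * ?a m * m) *
          ((real m * real L) ^ J * (modgain L 6 ^ n * (1 / rgold) ^ (L * (2 * ?a m + 3))))"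
        by (rule sum_many_highs_le[OF L _ D2 J]) simp
      also have "\<dots> \<le> real L * real m ^ 3 *
          ((real m * real L) ^ J * (exp (5 * real L + 3) * exp (- (\<kappa> * \<delta> / 4) * real m)))"
        using modgain_bounds[of L 6] L rgold_pos
        by (intro mult_mono[OF am3] mult_left_mono gain) auto
      finally show ?case
        by (simp add: power_mult_distrib power_add mult_ac)
    qed
  qed
  show ?thesis
  proof (rule exp_small_mono[OF exp_small_add[OF A B]], rule always_eventually, rule allI)
    fix m
    have "?F m \<subseteq> ?A m \<union> ?B m"
    proof
      fix f assume f: "f \<in> ?F m"
      then obtain q where q: "q \<in> {1..<m}" "(3 + \<beta>) * real m \<le> real (pts m f q)" by blast
      have "real (?D m) \<le> b * real m" using b by simp
      also have "\<dots> \<le> \<beta> * real m" using b by (intro mult_right_mono) auto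
      finally have "real (3 * m + ?D m) \<le> real (pts m f q)" using q(2) by (simp add: algebra_simps)
      hence "3 * m + ?D m \<le> pts m f q" by linarith
      thus "f \<in> ?A m \<union> ?B m" using f q(1) by auto
    qed
    hence "(\<Sum>f\<in>?F m. wt {1..<m} f) \<le> (\<Sum>f\<in>?A m \<union> ?B m. wt {1..<m} f)"
      using fin by (intro sum_mono2) (auto intro: wt_nonneg)
    also have "\<dots> = (\<Sum>f\<in>?A m. wt {1..<m} f) + (\<Sum>f\<in>?B m. wt {1..<m} f)"
      using fin by (intro sum.union_disjoint) auto
    finally show "(\<Sum>f\<in>?F m. wt {1..<m} f) \<le> (\<Sum>f\<in>?A m. wt {1..<m} f) + (\<Sum>f\<in>?B m. wt {1..<m} f)" .
  qed
qed

section \<open>Concentration of the number of letters 1\<close>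

definition ones :: "nat \<Rightarrow> (nat \<Rightarrow> nat) \<Rightarrow> nat" where
  "ones m f = card {i \<in> {1..<m}. f i = 1}"

text \<open>Chernoff bounds for the number of letters 1, which has mean \<open>rgold * m\<close>.\<close>

definition tilt :: "real \<Rightarrow> real" where
  "tilt \<theta> = rgold * exp \<theta> + rgold\<^sup>2"

lemma tilt_pos: "tilt \<theta> > 0"
  unfolding tilt_def using rgold_pos by (intro add_pos_pos) auto

text \<open>\<open>A\<close> bounds the cost of an exceptional position relative to a free one. One
  further factor \<open>A\<close> pays for writing \<open>tilt \<theta> ^ m\<close> although there
  are only \<open>m - 1\<close> letters.\<close>

lemma sum_fwords_tilt_le:
  assumes A: "A \<ge> 1" "A \<ge> exp \<bar>\<theta>\<bar> / (rgold * tilt \<theta>)"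
  shows "(\<Sum>f\<in>fwords m L d. wt {1..<m} f * exp (\<theta> * real (ones m f))) \<le> A ^ Suc d * tilt \<theta> ^ m"
proof -
  let ?A = "\<lambda>i. if i \<le> d then {1..L} else {1..2::nat}"
  let ?g = "\<lambda>k. rgold ^ k * (if k = 1 then exp \<theta> else 1)"
  have A': "exp \<bar>\<theta>\<bar> / rgold \<le> A * tilt \<theta>"
    using A(2) rgold_pos tilt_pos[of \<theta>] by (simp add: field_simps)
  have "1 \<le> exp \<bar>\<theta>\<bar> / rgold"
  proof -
    have "1 \<le> exp \<bar>\<theta>\<bar>" by simp
    hence "rgold \<le> exp \<bar>\<theta>\<bar>" using rgold_less_1 by linarith
    thus ?thesis using rgold_pos by (simp add: field_simps)
  qed
  with A' have A1: "1 \<le> A * tilt \<theta>" by linarith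
  have w: "wt {1..<m} f * exp (\<theta> * real (ones m f)) = (\<Prod>i\<in>{1..<m}. ?g (f i))" for f
  proof -
    have "exp (\<theta> * real (ones m f)) = exp \<theta> ^ card {i \<in> {1..<m}. f i = 1}"
      by (simp add: ones_def exp_of_nat2_mult)
    also have "\<dots> = (\<Prod>i\<in>{1..<m}. if f i = 1 then exp \<theta> else 1)"
      by (simp add: prod.If_cases Int_def)
    finally show ?thesis unfolding wt_def by (simp add: prod.distrib)
  qed
  have small: "(\<Sum>k\<in>{1..L}. ?g k) \<le> A * tilt \<theta>"
  proof -
    have "?g k \<le> rgold ^ k * exp \<bar>\<theta>\<bar>" for k
      using rgold_pos by (intro mult_left_mono) auto
    hence "(\<Sum>k\<in>{1..L}. ?g k) \<le> (\<Sum>k\<in>{1..L}. rgold ^ k * exp \<bar>\<theta>\<bar>)" by (intro sum_mono)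
    also have "\<dots> = (\<Sum>k\<in>{1..L}. rgold ^ k) * exp \<bar>\<theta>\<bar>" by (simp add: sum_distrib_right)
    also have "\<dots> \<le> 1 / rgold * exp \<bar>\<theta>\<bar>" by (intro mult_right_mono sum_rgold_le) auto
    also have "\<dots> \<le> A * tilt \<theta>" using A' by simp
    finally show ?thesis .
  qed
  have "{1..2::nat} = {1,2}" by auto
  hence big: "(\<Sum>k\<in>{1..2}. ?g k) = tilt \<theta>" by (simp add: tilt_def)
  have "(\<Sum>f\<in>fwords m L d. wt {1..<m} f * exp (\<theta> * real (ones m f)))
     = (\<Prod>i\<in>{1..<m}. \<Sum>k\<in>?A i. ?g k)"
    unfolding w fwords_def by (rule prod_sum_PiE[symmetric]) auto
  also have "\<dots> \<le> (\<Prod>i\<in>{1..<m}. tilt \<theta> * (if i \<le> d then A else 1))"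
  proof (rule prod_mono)
    fix i
    have "0 \<le> (\<Sum>k\<in>?A i. ?g k)" using rgold_pos by (intro sum_nonneg) auto
    moreover have "(\<Sum>k\<in>?A i. ?g k) \<le> tilt \<theta> * (if i \<le> d then A else 1)"
      using small big by (cases "i \<le> d") (simp_all add: mult.commute)
    ultimately show "0 \<le> (\<Sum>k\<in>?A i. ?g k) \<and> (\<Sum>k\<in>?A i. ?g k) \<le> tilt \<theta> * (if i \<le> d then A else 1)" ..
  qed
  also have "\<dots> = tilt \<theta> ^ (m - 1) * A ^ card ({1..<m} \<inter> {i. i \<le> d})"
    by (simp add: prod.distrib prod.If_cases)
  also have "\<dots> \<le> (A * tilt \<theta> ^ m) * A ^ d"
  proof (rule mult_mono)
    have "card ({1..<m} \<inter> {i. i \<le> d}) \<le> card {1..d}" by (rule card_mono) auto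
    thus "A ^ card ({1..<m} \<inter> {i. i \<le> d}) \<le> A ^ d" using A by (intro power_increasing) auto
    show "tilt \<theta> ^ (m - 1) \<le> A * tilt \<theta> ^ m"
    proof (cases m)
      case (Suc k)
      have "1 * tilt \<theta> ^ k \<le> (A * tilt \<theta>) * tilt \<theta> ^ k"
        using A1 tilt_pos[of \<theta>] by (intro mult_right_mono) auto
      thus ?thesis by (simp add: Suc mult.assoc)
    qed (use A in simp)
  qed (use A tilt_pos[of \<theta>] in auto)
  finally show ?thesis by (simp add: mult_ac)
qed

text \<open>Markov's inequality for the exponential of \<open>\<theta> * ones\<close>, for either
  sign of \<open>\<theta>\<close>. The bound on \<open>\<delta>\<close> lets the exceptional
  positions use up at most half of the decay rate \<open>c\<close>.\<close>

lemma exp_small_tilt: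
  assumes "tilt \<theta> * exp (- (\<theta> * t)) < 1"
  shows "\<exists>\<delta>1>0. \<forall>\<delta>. 0 < \<delta> \<longrightarrow> \<delta> \<le> \<delta>1 \<longrightarrow>
    exp_small (\<lambda>m. \<Sum>f | f \<in> fwords m L (nat \<lfloor>\<delta> * real m\<rfloor>) \<and> \<theta> * t * real m \<le> \<theta> * real (ones m f).
       wt {1..<m} f)"
proof -
  define A where "A = max 1 (exp \<bar>\<theta>\<bar> / (rgold * tilt \<theta>))"
  define c where "c = - ln (tilt \<theta> * exp (- (\<theta> * t)))"
  have pos: "tilt \<theta> * exp (- (\<theta> * t)) > 0" using tilt_pos by simp
  have c: "c > 0" using assms pos by (simp add: c_def)
  have lnA: "ln A \<ge> 0" by (simp add: A_def)
  define \<delta>1 where "\<delta>1 = c / (2 * (1 + ln A))"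
  show ?thesis
  proof (intro exI[of _ \<delta>1] conjI allI impI)
    show "\<delta>1 > 0" using c lnA by (simp add: \<delta>1_def)
    fix \<delta> assume \<delta>: "0 < \<delta>" "\<delta> \<le> \<delta>1"
    have "\<delta> * (1 + ln A) \<le> c / 2" using \<delta> lnA by (simp add: \<delta>1_def field_simps)
    hence \<delta>A: "\<delta> * ln A \<le> c / 2" using \<delta> by (simp add: algebra_simps)
    let ?d = "\<lambda>m. nat \<lfloor>\<delta> * real m\<rfloor>"
    let ?F = "\<lambda>m. {f \<in> fwords m L (?d m). \<theta> * t * real m \<le> \<theta> * real (ones m f)}"
    show "exp_small (\<lambda>m. \<Sum>f\<in>?F m. wt {1..<m} f)"
    proof (rule exp_smallI[where p = 0 and C = A], rule half_gt_zero[OF c], rule always_eventually, rule allI)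
      fix m
      have "(\<Sum>f\<in>?F m. wt {1..<m} f)
         \<le> (\<Sum>f\<in>?F m. wt {1..<m} f * exp (\<theta> * real (ones m f)) * exp (- (\<theta> * t * real m)))"
      proof (rule sum_mono)
        fix f assume "f \<in> ?F m"
        hence "1 \<le> exp (\<theta> * real (ones m f) - \<theta> * t * real m)" by simp
        hence "wt {1..<m} f * 1 \<le> wt {1..<m} f * exp (\<theta> * real (ones m f) - \<theta> * t * real m)"
          by (intro mult_left_mono wt_nonneg)
        thus "wt {1..<m} f \<le> wt {1..<m} f * exp (\<theta> * real (ones m f)) * exp (- (\<theta> * t * real m))"
          by (simp add: exp_diff exp_minus field_simps)
      qed
      also have "\<dots> \<le> (\<Sum>f\<in>fwords m L (?d m). wt {1..<m} f * exp (\<theta> * real (ones m f)) * exp (- (\<theta> * t * real m)))"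
        by (rule sum_mono2[OF finite_fwords]) (auto intro!: mult_nonneg_nonneg wt_nonneg)
      also have "\<dots> = (\<Sum>f\<in>fwords m L (?d m). wt {1..<m} f * exp (\<theta> * real (ones m f))) * exp (- (\<theta> * t * real m))"
        by (simp add: sum_distrib_right)
      also have "\<dots> \<le> A ^ Suc (?d m) * tilt \<theta> ^ m * exp (- (\<theta> * t * real m))"
        by (intro mult_right_mono sum_fwords_tilt_le) (auto simp: A_def)
      also have "\<dots> = A * A ^ ?d m * (tilt \<theta> * exp (- (\<theta> * t))) ^ m"
        by (simp add: power_mult_distrib exp_of_nat_mult[symmetric] mult_ac)
      also have "(tilt \<theta> * exp (- (\<theta> * t))) ^ m = exp (- c * real m)"
      proof -
        have "tilt \<theta> * exp (- (\<theta> * t)) = exp (- c)" using pos by (simp add: c_def)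
        thus ?thesis by (simp add: exp_of_nat_mult[symmetric] mult.commute)
      qed
      also have "A * A ^ ?d m * exp (- c * real m) \<le> A * exp (c / 2 * real m) * exp (- c * real m)"
      proof (intro mult_right_mono mult_left_mono)
        have "A ^ ?d m = exp (ln A * real (?d m))" by (simp add: exp_of_nat2_mult A_def)
        also have "ln A * real (?d m) \<le> ln A * (\<delta> * real m)"
          using lnA \<delta> by (intro mult_left_mono) auto
        also have "\<dots> \<le> c / 2 * real m" using mult_right_mono[OF \<delta>A, of "real m"] by (simp add: mult_ac)
        finally show "A ^ ?d m \<le> exp (c / 2 * real m)" by simp
      qed (auto simp: A_def)
      also have "\<dots> = A * real m ^ 0 * exp (- (c / 2) * real m)"
        by (simp add: mult.assoc flip: exp_add)
      finally show "(\<Sum>f\<in>?F m. wt {1..<m} f) \<le> A * real m ^ 0 * exp (- (c / 2) * real m)" .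
    qed
  qed
qed

text \<open>The function of \<open>\<theta>\<close> in \<open>exp_small_tilt\<close> equals 1 at 0
  and has slope \<open>- \<eta>\<close> there, because a free letter is 1 with probability
  \<open>rgold\<close>. A small positive \<open>\<theta>\<close> therefore makes it less than
  1.\<close>

lemma exp_small_ones_upper:
  assumes "\<eta> > 0"
  shows "\<exists>\<delta>1>0. \<forall>\<delta>. 0 < \<delta> \<longrightarrow> \<delta> \<le> \<delta>1 \<longrightarrow>
    exp_small (\<lambda>m. \<Sum>f | f \<in> fwords m L (nat \<lfloor>\<delta> * real m\<rfloor>) \<and> (rgold + \<eta>) * real m \<le> real (ones m f).
       wt {1..<m} f)"
proof -
  let ?g = "\<lambda>\<theta>. tilt \<theta> * exp (- (\<theta> * (rgold + \<eta>)))"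
  have "(?g has_real_derivative - \<eta>) (at 0)"
    unfolding tilt_def
    by (auto intro!: derivative_eq_intros simp: algebra_simps rgold_sq rgold_mult_self)
  from DERIV_neg_dec_right[OF this] assms obtain e where e: "e > 0" "\<And>h. 0 < h \<Longrightarrow> h < e \<Longrightarrow> ?g h < ?g 0"
    by auto
  define \<theta> where "\<theta> = e / 2"
  have \<theta>: "\<theta> > 0" "?g \<theta> < 1" using e(2)[of \<theta>] e(1) rgold_sq by (auto simp: \<theta>_def tilt_def)
  have "\<theta> * (rgold + \<eta>) * real m \<le> \<theta> * real (ones m f) \<longleftrightarrow> (rgold + \<eta>) * real m \<le> real (ones m f)" for m f
    using \<theta>(1) by (simp add: mult.assoc)
  thus ?thesis using exp_small_tilt[OF \<theta>(2), of L] by simp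
qed

lemma exp_small_ones_lower:
  assumes "\<eta> > 0"
  shows "\<exists>\<delta>1>0. \<forall>\<delta>. 0 < \<delta> \<longrightarrow> \<delta> \<le> \<delta>1 \<longrightarrow>
    exp_small (\<lambda>m. \<Sum>f | f \<in> fwords m L (nat \<lfloor>\<delta> * real m\<rfloor>) \<and> real (ones m f) \<le> (rgold - \<eta>) * real m.
       wt {1..<m} f)"
proof -
  let ?g = "\<lambda>\<theta>. tilt (- \<theta>) * exp (- (- \<theta> * (rgold - \<eta>)))"
  have "(?g has_real_derivative - \<eta>) (at 0)"
    unfolding tilt_def
    by (auto intro!: derivative_eq_intros simp: algebra_simps rgold_sq rgold_mult_self)
  from DERIV_neg_dec_right[OF this] assms obtain e where e: "e > 0" "\<And>h. 0 < h \<Longrightarrow> h < e \<Longrightarrow> ?g h < ?g 0"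
    by auto
  define \<theta> where "\<theta> = e / 2"
  have \<theta>: "\<theta> > 0" "?g \<theta> < 1" using e(2)[of \<theta>] e(1) rgold_sq by (auto simp: \<theta>_def tilt_def)
  have "- \<theta> * (rgold - \<eta>) * real m \<le> - \<theta> * real (ones m f) \<longleftrightarrow> real (ones m f) \<le> (rgold - \<eta>) * real m" for m f
    using \<theta>(1) by (simp add: mult.assoc)
  thus ?thesis using exp_small_tilt[OF \<theta>(2), of L] by simp
qed

section \<open>Numerical semigroups and their Kunz words\<close>

lemma sum_fwords_some_avoid_le:
  assumes L: "L \<ge> 2" and h: "2 * h \<le> m" "2 * n + 2 \<le> h"
  shows "(\<Sum>f | f \<in> fwords m L d \<and> (\<exists>s\<in>{h..<m}. avoids m s f). wt {1..<m} f)
    \<le> real m * (modgain L 6 ^ n * (1 / rgold) ^ d)"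
proof (rule sum_Union_le_const[where I = "{h..<m}" and B = "\<lambda>s. {f \<in> fwords m L d. avoids m s f}"])
  fix s assume "s \<in> {h..<m}"
  thus "(\<Sum>f | f \<in> fwords m L d \<and> avoids m s f. wt {1..<m} f) \<le> modgain L 6 ^ n * (1 / rgold) ^ d"
    using h by (intro sum_fwords_avoid_le[OF L]) auto
qed (use modgain_bounds[of L 6] L rgold_pos in
    \<open>auto intro: wt_nonneg finite_subset[OF _ finite_fwords]\<close>)

text \<open>What a pseudo-Frobenius number \<open>i\<close> below \<open>m\<close> forces: if
  \<open>m + j\<close> is in the semigroup, so is \<open>m + i + j\<close>.\<close>

definition shifts :: "nat \<Rightarrow> nat \<Rightarrow> (nat \<Rightarrow> nat) \<Rightarrow> bool" where
  "shifts m i f \<longleftrightarrow> (\<forall>j\<ge>1. i + j < m \<longrightarrow> f j = 1 \<longrightarrow> f (i + j) = 1)"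

lemma sum_fwords_shifts_le:
  assumes L: "L \<ge> 2" and i: "h \<le> i" "i + h \<le> m" and n: "n + 1 \<le> h"
  shows "(\<Sum>f | f \<in> fwords m L d \<and> shifts m i f. wt {1..<m} f) \<le> modgain L 6 ^ n * (1 / rgold) ^ d"
proof -
  \<comment> \<open>For \<open>j\<close> in this final stretch, \<open>i + j\<close> exceeds
    \<open>m - h\<close> while \<open>j\<close> itself is below it, so the pairs of positions are
    disjoint and the events do not interfere.\<close>
  define Q where "Q = {m - i - h + 1..<m - i}"
  have Q: "1 \<le> j" "j < m - i" "i + j < m" "m - h < i + j" if "j \<in> Q" for j
    using that i by (auto simp: Q_def)
  have "(\<Sum>f | f \<in> fwords m L d \<and> shifts m i f. wt {1..<m} f)
    \<le> (\<Sum>f | f \<in> fwords m L d \<and> (\<forall>j\<in>Q. \<not> (f j = 1 \<and> f (i + j) \<noteq> 1)). wt {1..<m} f)"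
  proof (rule sum_mono2)
    show "{f \<in> fwords m L d. shifts m i f} \<subseteq> {f \<in> fwords m L d. \<forall>j\<in>Q. \<not> (f j = 1 \<and> f (i + j) \<noteq> 1)}"
      using Q by (auto simp: shifts_def)
  qed (auto intro: wt_nonneg finite_subset[OF _ finite_fwords])
  also have "\<dots> \<le> modgain L 6 ^ card Q * (\<Sum>f\<in>fwords m L d. wt {1..<m} f)"
  proof (rule local_modification[where M = "\<lambda>j f. f(j := 1, i + j := 2)" and N = "\<lambda>j. {j, i + j}"])
    show "fwords m L d \<subseteq> PiE {1..<m} (\<lambda>_. {1..L})" using fwords_subset[OF L] by (simp add: words_def)
    fix j f assume j: "j \<in> Q" and f: "f \<in> fwords m L d"
    have "1 \<le> j" "j < m" "i + j < m" using Q[OF j] by auto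
    thus "f(j := 1, i + j := 2) \<in> fwords m L d"
      using f L unfolding fwords_def by (auto simp: PiE_iff extensional_def)
    show "(f(j := 1, i + j := 2)) j = 1 \<and> (f(j := 1, i + j := 2)) (i + j) \<noteq> 1"
      using i n by auto
  next
    fix j j' and f :: "nat \<Rightarrow> nat"
    assume j: "j \<in> Q" "j' \<in> Q" "j' \<noteq> j" and nb: "\<not> (f j' = 1 \<and> f (i + j') \<noteq> 1)"
    have "j' \<noteq> i + j" "i + j' \<noteq> j" "i + j' \<noteq> i + j" using Q[OF j(1)] Q[OF j(2)] j(3) i by auto
    thus "\<not> ((f(j := 1, i + j := 2)) j' = 1 \<and> (f(j := 1, i + j := 2)) (i + j') \<noteq> 1)"
      using nb j by simp
  qed (use L in \<open>auto simp: Q_def card_insert_if\<close>)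
  also have "\<dots> \<le> modgain L 6 ^ n * (1 / rgold) ^ d"
  proof (rule mult_mono)
    have "n \<le> card Q" using i n by (simp add: Q_def)
    thus "modgain L 6 ^ card Q \<le> modgain L 6 ^ n"
      using modgain_bounds[of L 6] L by (intro power_decreasing) auto
  qed (use sum_fwords_le modgain_bounds[of L 6] L in \<open>auto intro!: sum_nonneg wt_nonneg\<close>)
  finally show ?thesis .
qed

lemma sum_fwords_some_shifts_le:
  assumes L: "L \<ge> 2" and n: "n + 1 \<le> h"
  shows "(\<Sum>f | f \<in> fwords m L d \<and> (\<exists>i. h \<le> i \<and> i + h \<le> m \<and> shifts m i f). wt {1..<m} f)
    \<le> real m * (modgain L 6 ^ n * (1 / rgold) ^ d)"
proof (rule sum_Union_le_const[where I = "{i. h \<le> i \<and> i + h \<le> m}"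
      and B = "\<lambda>s. {f \<in> fwords m L d. shifts m s f}"])
  have sub: "{i. h \<le> i \<and> i + h \<le> m} \<subseteq> {1..m}" using n by auto
  show "finite {i. h \<le> i \<and> i + h \<le> m}" by (rule finite_subset[OF sub]) simp
  show "card {i. h \<le> i \<and> i + h \<le> m} \<le> m" using card_mono[OF _ sub] by simp
  fix i assume "i \<in> {i. h \<le> i \<and> i + h \<le> m}"
  thus "(\<Sum>f | f \<in> fwords m L d \<and> shifts m i f. wt {1..<m} f) \<le> modgain L 6 ^ n * (1 / rgold) ^ d"
    using n by (intro sum_fwords_shifts_le[OF L]) auto
qed (use modgain_bounds[of L 6] L rgold_pos in
    \<open>auto intro: wt_nonneg finite_subset[OF _ finite_fwords]\<close>)

definition unlikely :: "real \<Rightarrow> nat \<Rightarrow> (nat \<Rightarrow> nat) \<Rightarrow> bool" where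
  "unlikely \<eta> m f \<longleftrightarrow> real (ones m f) \<le> (rgold - \<eta>) * real m \<or> (rgold + \<eta>) * real m \<le> real (ones m f)
     \<or> (\<exists>s\<in>{nat \<lfloor>\<eta> * real m\<rfloor>..<m}. avoids m s f)
     \<or> (\<exists>i. nat \<lfloor>\<eta> * real m\<rfloor> \<le> i \<and> i + nat \<lfloor>\<eta> * real m\<rfloor> \<le> m \<and> shifts m i f)"

lemma exp_small_unlikely:
  assumes L: "L \<ge> 2" and \<eta>: "0 < \<eta>" "\<eta> \<le> 1/2"
  shows "\<exists>\<delta>>0. \<delta> \<le> \<eta> \<and>
    exp_small (\<lambda>m. \<Sum>f | f \<in> fwords m L (nat \<lfloor>\<delta> * real m\<rfloor>) \<and> unlikely \<eta> m f. wt {1..<m} f)"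
proof -
  define \<kappa> where "\<kappa> = 1 - modgain L 6"
  have \<kappa>: "\<kappa> > 0" "\<kappa> \<le> 1" using modgain_bounds[of L 6] L by (auto simp: \<kappa>_def)
  obtain \<delta>1 where \<delta>1: "\<delta>1 > 0" "\<And>\<delta>. 0 < \<delta> \<Longrightarrow> \<delta> \<le> \<delta>1 \<Longrightarrow>
     exp_small (\<lambda>m. \<Sum>f | f \<in> fwords m L (nat \<lfloor>\<delta> * real m\<rfloor>) \<and> (rgold + \<eta>) * real m \<le> real (ones m f).
       wt {1..<m} f)" using exp_small_ones_upper[OF \<eta>(1), of L] by blast
  obtain \<delta>2 where \<delta>2: "\<delta>2 > 0" "\<And>\<delta>. 0 < \<delta> \<Longrightarrow> \<delta> \<le> \<delta>2 \<Longrightarrow>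
     exp_small (\<lambda>m. \<Sum>f | f \<in> fwords m L (nat \<lfloor>\<delta> * real m\<rfloor>) \<and> real (ones m f) \<le> (rgold - \<eta>) * real m.
       wt {1..<m} f)" using exp_small_ones_lower[OF \<eta>(1), of L] by blast
  \<comment> \<open>The last bound keeps the cost of the exceptional positions within the eighth
    allowed by \<open>gain_exponent\<close>.\<close>
  define \<delta> where "\<delta> = min (min \<delta>1 \<delta>2) (\<kappa> * \<eta> / 8)"
  have \<delta>: "\<delta> > 0" "\<delta> \<le> \<delta>1" "\<delta> \<le> \<delta>2" "\<delta> \<le> \<kappa> * \<eta> / 8"
    using \<delta>1 \<delta>2 \<kappa> \<eta> by (auto simp: \<delta>_def)
  have "\<kappa> * \<eta> \<le> 1 * \<eta>" using \<kappa> \<eta> by (intro mult_right_mono) auto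
  hence \<delta>\<eta>: "\<delta> \<le> \<eta>" using \<delta> \<eta> by linarith
  let ?d = "\<lambda>m. nat \<lfloor>\<delta> * real m\<rfloor>"
  let ?h = "\<lambda>m. nat \<lfloor>\<eta> * real m\<rfloor>"
  let ?U = "\<lambda>m. {f \<in> fwords m L (?d m). (rgold + \<eta>) * real m \<le> real (ones m f)}"
  let ?V = "\<lambda>m. {f \<in> fwords m L (?d m). real (ones m f) \<le> (rgold - \<eta>) * real m}"
  let ?A = "\<lambda>m. {f \<in> fwords m L (?d m). \<exists>s\<in>{?h m..<m}. avoids m s f}"
  let ?S = "\<lambda>m. {f \<in> fwords m L (?d m). \<exists>i. ?h m \<le> i \<and> i + ?h m \<le> m \<and> shifts m i f}"
  have fin: "finite (?U m)" "finite (?V m)" "finite (?A m)" "finite (?S m)" for m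
    by (auto intro: finite_subset[OF _ finite_fwords])
  have "\<forall>\<^sub>F m in sequentially. real m * (modgain L 6 ^ ((?h m - 2) div 2) * (1 / rgold) ^ ?d m)
        \<le> exp 3 * real m ^ 1 * exp (- (\<kappa> * \<eta> / 4) * real m) \<and> 2 * ?h m \<le> m
        \<and> 2 * ((?h m - 2) div 2) + 2 \<le> ?h m"
    using eventually_real_ge[of "3 / \<eta>"]
  proof eventually_elim
    case (elim m)
    hence m: "3 \<le> \<eta> * real m" using \<eta> by (simp add: field_simps)
    define n where "n = (?h m - 2) div 2"
    have D: "\<eta> * real m - 1 \<le> real (?h m)" "real (?h m) \<le> \<eta> * real m" using m by linarith+
    have "\<eta> * real m \<le> 1/2 * real m" using \<eta> by (intro mult_right_mono) auto
    hence D2: "2 * ?h m \<le> m" "2 * n + 2 \<le> ?h m" using D m unfolding n_def by linarith+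
    have n: "\<eta> * real m - 5 \<le> 2 * real n" using D m unfolding n_def by linarith
    have "real (?d m) \<le> \<delta> * real m" using \<delta> by simp
    also have "\<dots> \<le> \<kappa> * \<eta> / 8 * real m" using \<delta> by (intro mult_right_mono) auto
    finally have d: "real (?d m) \<le> \<kappa> * \<eta> / 8 * real m + 0" by simp
    have "modgain L 6 ^ n * (1 / rgold) ^ ?d m \<le> exp (- \<kappa> * real n) * exp (real (?d m))"
      using modgain_power_le[of L 6 n] inverse_rgold_power_le[of "?d m"] L rgold_pos
      unfolding \<kappa>_def by (intro mult_mono) auto
    also have "\<dots> \<le> exp (0 + 3) * exp (- (\<kappa> * \<eta> / 4) * real m)"
      by (rule gain_exponent[OF n _ _ d]) (use \<kappa> in auto)
    finally have "real m * (modgain L 6 ^ n * (1 / rgold) ^ ?d m)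
        \<le> real m * (exp (0 + 3) * exp (- (\<kappa> * \<eta> / 4) * real m))" by (intro mult_left_mono) auto
    thus ?case using D2 unfolding n_def by (simp add: mult_ac)
  qed
  note ev = this
  have pos: "\<kappa> * \<eta> / 4 > 0" using \<kappa> \<eta> by simp
  have A: "exp_small (\<lambda>m. \<Sum>f\<in>?A m. wt {1..<m} f)"
  proof (rule exp_smallI[OF pos])
    show "\<forall>\<^sub>F m in sequentially. (\<Sum>f\<in>?A m. wt {1..<m} f) \<le> exp 3 * real m ^ 1 * exp (- (\<kappa> * \<eta> / 4) * real m)"
      using ev
    proof eventually_elim
      case (elim m)
      thus ?case using sum_fwords_some_avoid_le[OF L, of "?h m" m "(?h m - 2) div 2" "?d m"] by linarith
    qed
  qed
  have S: "exp_small (\<lambda>m. \<Sum>f\<in>?S m. wt {1..<m} f)"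
  proof (rule exp_smallI[OF pos])
    show "\<forall>\<^sub>F m in sequentially. (\<Sum>f\<in>?S m. wt {1..<m} f) \<le> exp 3 * real m ^ 1 * exp (- (\<kappa> * \<eta> / 4) * real m)"
      using ev
    proof eventually_elim
      case (elim m)
      have "(?h m - 2) div 2 + 1 \<le> ?h m" using elim by linarith
      from sum_fwords_some_shifts_le[OF L this, of m "?d m"] elim show ?case by linarith
    qed
  qed
  let ?sum = "\<lambda>X m. \<Sum>f\<in>X m. wt {1..<m} f"
  have "exp_small (\<lambda>m. (?sum ?U m + ?sum ?V m) + (?sum ?A m + ?sum ?S m))"
    using A S \<delta>1(2)[of \<delta>] \<delta>2(2)[of \<delta>] \<delta> by (intro exp_small_add) auto
  moreover have "(\<Sum>f | f \<in> fwords m L (?d m) \<and> unlikely \<eta> m f. wt {1..<m} f)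
      \<le> (?sum ?U m + ?sum ?V m) + (?sum ?A m + ?sum ?S m)" for m
  proof -
    have un: "sum (wt {1..<m}) (X \<union> Y) \<le> sum (wt {1..<m}) X + sum (wt {1..<m}) Y"
      if "finite X" "finite Y" for X Y
      using sum.union_inter[OF that, of "wt {1..<m}"] sum_nonneg[of "X \<inter> Y" "wt {1..<m}"] wt_nonneg
      by (metis add_increasing2 le_add_same_cancel1 order_refl)
    have "(\<Sum>f | f \<in> fwords m L (?d m) \<and> unlikely \<eta> m f. wt {1..<m} f)
       \<le> sum (wt {1..<m}) ((?U m \<union> ?V m) \<union> (?A m \<union> ?S m))"
      using fin by (intro sum_mono2) (auto simp: unlikely_def intro: wt_nonneg)
    also have "\<dots> \<le> sum (wt {1..<m}) (?U m \<union> ?V m) + sum (wt {1..<m}) (?A m \<union> ?S m)"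
      using fin by (intro un) auto
    also have "\<dots> \<le> (?sum ?U m + ?sum ?V m) + (?sum ?A m + ?sum ?S m)"
      using fin by (intro add_mono un) auto
    finally show ?thesis .
  qed
  ultimately have "exp_small (\<lambda>m. \<Sum>f | f \<in> fwords m L (?d m) \<and> unlikely \<eta> m f. wt {1..<m} f)"
    by (elim exp_small_mono) (auto intro!: always_eventually)
  thus ?thesis using \<delta> \<delta>\<eta> by blast
qed

section \<open>Translation between semigroups and words: multiplicity, genus, embedding dimension
  and type\<close>

definition min_pos :: "nat set \<Rightarrow> nat" where
  "min_pos S = (LEAST n. n \<in> S \<and> 0 < n)"

definition kunz_coord :: "nat set \<Rightarrow> nat \<Rightarrow> nat" where
  "kunz_coord S i = (LEAST q. q * min_pos S + i \<in> S)"

text \<open>The restriction makes the word extensional, as membership in \<open>PiE\<close>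
  requires.\<close>

definition word :: "nat set \<Rightarrow> nat \<Rightarrow> nat" where
  "word S = restrict (kunz_coord S) {1..<min_pos S}"

context
  fixes S :: "nat set"
  assumes S: "numerical_semigroup S"
begin

lemma zero_in: "0 \<in> S" and add_in: "a \<in> S \<Longrightarrow> b \<in> S \<Longrightarrow> a + b \<in> S" and finite_gaps: "finite (gaps S)"
  using S by (auto simp: numerical_semigroup_def gaps_def)

lemma min_pos_in: "min_pos S \<in> S" and min_pos_gt_0: "min_pos S > 0"
proof -
  have "finite (insert 0 (gaps S))" using finite_gaps by simp
  then obtain n where "n \<notin> insert 0 (gaps S)" using ex_new_if_finite infinite_UNIV_nat by blast
  hence "n \<in> S \<and> 0 < n" by (auto simp: gaps_def)
  from LeastI[of "\<lambda>n. n \<in> S \<and> 0 < n", OF this] show "min_pos S \<in> S" "min_pos S > 0"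
    by (auto simp: min_pos_def)
qed

lemma min_pos_le: "n \<in> S \<Longrightarrow> 0 < n \<Longrightarrow> min_pos S \<le> n"
  unfolding min_pos_def by (rule Least_le) simp

lemma add_multiple_in: "s \<in> S \<Longrightarrow> s + q * min_pos S \<in> S"
  by (induction q) (auto simp: min_pos_in add.assoc[symmetric] add.commute[of "min_pos S"] intro: add_in)

lemma multiple_in: "q * min_pos S \<in> S"
  using add_multiple_in[OF zero_in, of q] by simp

lemma kunz_coord_in: "kunz_coord S i * min_pos S + i \<in> S"
proof -
  have "inj (\<lambda>q. q * min_pos S + i)" using min_pos_gt_0 by (auto simp: inj_on_def)
  hence "infinite (range (\<lambda>q. q * min_pos S + i))" using range_inj_infinite by blast
  hence "\<not> range (\<lambda>q. q * min_pos S + i) \<subseteq> gaps S" using finite_gaps finite_subset by blast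
  then obtain q where "q * min_pos S + i \<in> S" by (auto simp: gaps_def)
  thus ?thesis unfolding kunz_coord_def by (rule LeastI)
qed

lemma mem_iff: "n \<in> S \<longleftrightarrow> kunz_coord S (n mod min_pos S) \<le> n div min_pos S"
proof
  assume "n \<in> S"
  hence "n div min_pos S * min_pos S + n mod min_pos S \<in> S" by simp
  thus "kunz_coord S (n mod min_pos S) \<le> n div min_pos S" unfolding kunz_coord_def by (rule Least_le)
next
  assume le: "kunz_coord S (n mod min_pos S) \<le> n div min_pos S"
  have "kunz_coord S (n mod min_pos S) * min_pos S + n mod min_pos S + (n div min_pos S - kunz_coord S (n mod min_pos S)) * min_pos S \<in> S"
    by (intro add_multiple_in kunz_coord_in)
  moreover have "kunz_coord S (n mod min_pos S) * min_pos S + (n div min_pos S - kunz_coord S (n mod min_pos S)) * min_pos S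
      = n div min_pos S * min_pos S"
    using le by (simp flip: add_mult_distrib)
  ultimately show "n \<in> S" by (metis add.assoc add.commute div_mult_mod_eq)
qed

lemma mem_iff': "i < min_pos S \<Longrightarrow> q * min_pos S + i \<in> S \<longleftrightarrow> kunz_coord S i \<le> q"
  using mem_iff[of "q * min_pos S + i"] by simp

lemma kunz_coord_zero: "kunz_coord S 0 = 0"
  using mem_iff[of 0] zero_in by simp

lemma kunz_coord_pos: "i \<in> {1..<min_pos S} \<Longrightarrow> kunz_coord S i \<ge> 1"
  using mem_iff'[of i 0] min_pos_le[of i] by (cases "kunz_coord S i") auto

lemma word_eq: "i \<in> {1..<min_pos S} \<Longrightarrow> word S i = kunz_coord S i"
  by (simp add: word_def)

lemma pts_word: "i \<in> {1..<min_pos S} \<Longrightarrow> pts (min_pos S) (word S) i = kunz_coord S i * min_pos S + i"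
  by (simp add: pts_def word_eq)

lemma kunz_word: "kunz (min_pos S) (word S)"
  unfolding kunz_def
proof (intro ballI impI)
  fix i j q assume ijq: "i \<in> {1..<min_pos S}" "j \<in> {1..<min_pos S}" "q \<in> {1..<min_pos S}" "(i + j) mod min_pos S = q"
  define n where "n = kunz_coord S i * min_pos S + i + (kunz_coord S j * min_pos S + j)"
  have "n \<in> S" unfolding n_def by (intro add_in kunz_coord_in)
  moreover have "n mod min_pos S = q"
  proof -
    have "n = (i + j) + (kunz_coord S i + kunz_coord S j) * min_pos S" by (simp add: n_def algebra_simps)
    thus ?thesis using ijq(4) by simp
  qed
  ultimately have "kunz_coord S q \<le> n div min_pos S" using mem_iff by blast
  hence "kunz_coord S q * min_pos S + q \<le> n div min_pos S * min_pos S + n mod min_pos S"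
    using \<open>n mod min_pos S = q\<close> by (intro add_mono mult_right_mono) auto
  thus "pts (min_pos S) (word S) q \<le> pts (min_pos S) (word S) i + pts (min_pos S) (word S) j"
    using ijq by (simp add: pts_word n_def)
qed

lemma genus_eq: "genus S = (\<Sum>i\<in>{1..<min_pos S}. word S i)"
proof -
  let ?m = "min_pos S"
  let ?f = "\<lambda>(i, q). q * ?m + i"
  let ?X = "Sigma {1..<?m} (\<lambda>i. {..<kunz_coord S i})"
  have inj: "inj_on ?f ?X"
  proof (rule inj_onI, clarify)
    fix i q i' q' assume a: "i \<in> {1..<?m}" "i' \<in> {1..<?m}" "q * ?m + i = q' * ?m + i'"
    have "(q * ?m + i) mod ?m = (q' * ?m + i') mod ?m" using a by simp
    hence "i = i'" using a(1,2) by simp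
    thus "i = i' \<and> q = q'" using a min_pos_gt_0 by simp
  qed
  have gaps: "gaps S = ?f ` ?X"
  proof (intro equalityI subsetI)
    fix n assume "n \<in> gaps S"
    hence n: "n div ?m < kunz_coord S (n mod ?m)" using mem_iff[of n] by (auto simp: gaps_def)
    hence "n mod ?m \<noteq> 0" using kunz_coord_zero by (metis not_less0)
    hence "(n mod ?m, n div ?m) \<in> ?X" using n min_pos_gt_0 by auto
    thus "n \<in> ?f ` ?X" by (rule rev_image_eqI) simp
  next
    fix n assume "n \<in> ?f ` ?X"
    then obtain i q where iq: "i \<in> {1..<?m}" "q < kunz_coord S i" "n = q * ?m + i" by auto
    thus "n \<in> gaps S" using mem_iff'[of i q] by (auto simp: gaps_def)
  qed
  have "genus S = card ?X" unfolding genus_def gaps by (rule card_image[OF inj])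
  also have "\<dots> = (\<Sum>i\<in>{1..<?m}. kunz_coord S i)" by simp
  finally show ?thesis by (simp add: word_eq)
qed

text \<open>The map \<open>s -> G - s\<close> sends semigroup elements up to \<open>G\<close> to
  gaps, so at least half of the \<open>G + 1\<close> numbers up to \<open>G\<close> are
  gaps.\<close>

lemma gap_le: "G \<in> gaps S \<Longrightarrow> G + 1 \<le> 2 * genus S"
proof -
  assume G: "G \<in> gaps S"
  have "card ({..G} \<inter> S) \<le> genus S"
    unfolding genus_def
  proof (rule card_inj_on_le)
    show "inj_on (\<lambda>s. G - s) ({..G} \<inter> S)" by (auto simp: inj_on_def)
    show "(\<lambda>s. G - s) ` ({..G} \<inter> S) \<subseteq> gaps S"
    proof clarify
      fix s assume s: "s \<le> G" "s \<in> S"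
      show "G - s \<in> gaps S" using add_in[of "G - s" s] s G by (auto simp: gaps_def)
    qed
  qed (rule finite_gaps)
  moreover have "card ({..G} \<inter> gaps S) \<le> genus S"
    unfolding genus_def by (intro card_mono finite_gaps) auto
  moreover have "card {..G} = card ({..G} \<inter> S) + card ({..G} \<inter> gaps S)"
  proof -
    have "{..G} = ({..G} \<inter> S) \<union> ({..G} \<inter> gaps S)" "({..G} \<inter> S) \<inter> ({..G} \<inter> gaps S) = {}"
      by (auto simp: gaps_def)
    thus ?thesis by (metis card_Un_disjoint finite_Int finite_atMost)
  qed
  ultimately show ?thesis by simp
qed

text \<open>A larger letter would make \<open>16 * m + i\<close> a gap, while gaps are below
  \<open>2 * g < 16 * m\<close>.\<close>

lemma word_le_16:
  assumes "genus S < 8 * min_pos S" "i \<in> {1..<min_pos S}"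
  shows "word S i \<le> 16"
proof (rule ccontr)
  assume "\<not> word S i \<le> 16"
  hence "16 * min_pos S + i \<notin> S" using mem_iff'[of i 16] assms by (auto simp: word_eq)
  hence "16 * min_pos S + i + 1 \<le> 2 * genus S" by (intro gap_le) (simp add: gaps_def)
  thus False using assms by simp
qed

lemma word_in_words: "genus S < 8 * min_pos S \<Longrightarrow> word S \<in> words (min_pos S) 16"
  unfolding words_def using word_le_16 kunz_coord_pos by (auto simp: word_eq PiE_iff word_def)

lemma min_pos_le_genus: "min_pos S \<le> genus S + 1"
proof -
  have "{1..<min_pos S} \<subseteq> gaps S" using min_pos_le by (force simp: gaps_def)
  hence "card {1..<min_pos S} \<le> genus S" unfolding genus_def by (intro card_mono finite_gaps)
  thus ?thesis by simp
qed

text \<open>If \<open>x - m\<close> is in the semigroup, then \<open>x\<close> splits off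
  \<open>m\<close> unless \<open>x = m\<close>; otherwise \<open>x\<close> is the least element of
  its class modulo \<open>m\<close>.\<close>

lemma min_gens_cases:
  assumes x: "x \<in> min_gens S"
  shows "x = min_pos S \<or> (\<exists>i\<in>{1..<min_pos S}. x = pts (min_pos S) (word S) i)"
proof -
  let ?m = "min_pos S"
  have xS: "x \<in> S" "x > 0" and irr: "\<And>a b. a \<in> S \<Longrightarrow> b \<in> S \<Longrightarrow> a > 0 \<Longrightarrow> b > 0 \<Longrightarrow> x \<noteq> a + b"
    using x by (auto simp: min_gens_def)
  show ?thesis
  proof (cases "x - ?m \<in> S")
    case True
    have le: "?m \<le> x" using min_pos_le xS by simp
    have "x - ?m = 0"
    proof (rule ccontr)
      assume "x - ?m \<noteq> 0"
      hence "x \<noteq> ?m + (x - ?m)" using irr[OF min_pos_in True min_pos_gt_0] by blast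
      thus False using le by simp
    qed
    thus ?thesis using le by simp
  next
    case False
    define i where "i = x mod ?m"
    have le: "kunz_coord S i \<le> x div ?m" using mem_iff xS by (simp add: i_def)
    have "i \<noteq> 0"
    proof
      assume "i = 0"
      hence "x = x div ?m * ?m" using div_mult_mod_eq[of x ?m] by (simp add: i_def)
      hence "x - ?m = (x div ?m - 1) * ?m" by (metis diff_mult_distrib mult_1)
      thus False using False multiple_in by simp
    qed
    hence iV: "i \<in> {1..<?m}" using min_pos_gt_0 by (simp add: i_def)
    have "x div ?m \<le> kunz_coord S i"
    proof (rule ccontr)
      assume "\<not> x div ?m \<le> kunz_coord S i"
      hence "(x div ?m - 1) * ?m + i \<in> S" using iV by (subst mem_iff') auto
      moreover have "(x div ?m - 1) * ?m + i = x - ?m"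
      proof -
        have "x div ?m \<ge> 1" using \<open>\<not> x div ?m \<le> kunz_coord S i\<close> by simp
        hence "x div ?m * ?m \<ge> ?m" by simp
        thus ?thesis unfolding i_def diff_mult_distrib using div_mult_mod_eq[of x ?m] by simp
      qed
      ultimately show False using False by simp
    qed
    hence "x = kunz_coord S i * ?m + i" using le by (simp add: i_def)
    thus ?thesis using iV pts_word by auto
  qed
qed

text \<open>An element below \<open>2 * m\<close> is not a sum of two nonzero elements.\<close>

lemma embedding_dimension_lower: "ones (min_pos S) (word S) \<le> embedding_dimension S"
proof -
  let ?m = "min_pos S"
  have "finite (min_gens S)"
    by (rule finite_subset[of _ "insert ?m (pts ?m (word S) ` {1..<?m})"]) (use min_gens_cases in auto)
  moreover have "(\<lambda>i. ?m + i) ` {i \<in> {1..<?m}. word S i = 1} \<subseteq> min_gens S"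
  proof clarify
    fix i assume i: "i \<in> {1..<?m}" "word S i = 1"
    have "?m + i \<in> S" using kunz_coord_in[of i] i by (simp add: word_eq)
    hence "?m + i \<in> S - {0}" using i by simp
    moreover have "?m + i \<notin> {a + b | a b. a \<in> S - {0} \<and> b \<in> S - {0}}"
    proof
      assume "?m + i \<in> {a + b | a b. a \<in> S - {0} \<and> b \<in> S - {0}}"
      then obtain a b where "a \<in> S - {0}" "b \<in> S - {0}" "?m + i = a + b" by blast
      thus False using min_pos_le[of a] min_pos_le[of b] i by auto
    qed
    ultimately show "?m + i \<in> min_gens S" by (simp add: min_gens_def)
  qed
  ultimately have "card ((\<lambda>i. ?m + i) ` {i \<in> {1..<?m}. word S i = 1}) \<le> embedding_dimension S"
    unfolding embedding_dimension_def by (rule card_mono)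
  thus ?thesis by (simp add: ones_def card_image)
qed

lemma letter_le_2:
  assumes "\<And>j. j \<in> {1..<min_pos S} \<Longrightarrow> pts (min_pos S) (word S) j \<le> 3 * min_pos S + d"
    and "i \<in> {1..<min_pos S}" "d < i"
  shows "word S i \<le> 2"
proof (rule ccontr)
  assume "\<not> word S i \<le> 2"
  hence "3 * min_pos S \<le> word S i * min_pos S" by (intro mult_right_mono) auto
  moreover have "word S i * min_pos S + i \<le> 3 * min_pos S + d" using assms(1)[OF assms(2)] by (simp add: pts_def)
  ultimately show False using assms(3) by linarith
qed

text \<open>Outside the exceptional positions the letters are 1 or 2, and at a letter 2 the element
  \<open>2 * m + i\<close> splits as \<open>(m + j) + (m + k)\<close>. The final 1 counts the
  generator \<open>m\<close>.\<close>

lemma embedding_dimension_upper: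
  assumes low: "\<And>j. j \<in> {1..<min_pos S} \<Longrightarrow> pts (min_pos S) (word S) j \<le> 3 * min_pos S + d"
    and av: "\<And>s. h \<le> s \<Longrightarrow> s < min_pos S \<Longrightarrow> \<not> avoids (min_pos S) s (word S)"
  shows "embedding_dimension S \<le> ones (min_pos S) (word S) + d + h + 1"
proof -
  let ?m = "min_pos S"
  let ?O = "{i \<in> {1..<?m}. word S i = 1}"
  have "min_gens S \<subseteq> insert ?m (pts ?m (word S) ` (?O \<union> {1..d} \<union> {1..<h}))"
  proof
    fix x assume x: "x \<in> min_gens S"
    show "x \<in> insert ?m (pts ?m (word S) ` (?O \<union> {1..d} \<union> {1..<h}))"
    proof (cases "x = ?m")
      case False
      then obtain i where i: "i \<in> {1..<?m}" "x = pts ?m (word S) i" using min_gens_cases[OF x] by blast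
      have "i \<in> ?O \<union> {1..d} \<union> {1..<h}"
      proof (rule ccontr)
        assume ni: "i \<notin> ?O \<union> {1..d} \<union> {1..<h}"
        hence "word S i \<le> 2" using letter_le_2[OF low, of i] i by auto
        moreover have "word S i \<ge> 1" using i kunz_coord_pos word_eq by simp
        ultimately have w2: "word S i = 2" using ni i by auto
        obtain j k where jk: "j \<in> {1..<?m}" "k \<in> {1..<?m}" "j + k = i" "word S j = 1" "word S k = 1"
          using av[of i] ni i by (auto simp: avoids_def)
        have "?m + j \<in> S - {0}" "?m + k \<in> S - {0}"
          using kunz_coord_in[of j] kunz_coord_in[of k] jk by (simp_all add: word_eq)
        moreover have "x = (?m + j) + (?m + k)" using i w2 jk by (simp add: pts_def)
        ultimately have "x \<in> {a + b | a b. a \<in> S - {0} \<and> b \<in> S - {0}}" by blast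
        thus False using x unfolding min_gens_def by blast
      qed
      thus ?thesis using i by blast
    qed simp
  qed
  hence "embedding_dimension S \<le> card (insert ?m (pts ?m (word S) ` (?O \<union> {1..d} \<union> {1..<h})))"
    unfolding embedding_dimension_def by (intro card_mono) auto
  also have "\<dots> \<le> card (pts ?m (word S) ` (?O \<union> {1..d} \<union> {1..<h})) + 1"
    by (simp add: card_insert_if)
  also have "\<dots> \<le> card (?O \<union> {1..d} \<union> {1..<h}) + 1"
    by (intro add_right_mono card_image_le) auto
  also have "card (?O \<union> {1..d} \<union> {1..<h}) \<le> card ?O + card {1..d} + card {1..<h}"
    by (meson add_le_cancel_right card_Un_le le_trans)
  finally show ?thesis by (simp add: ones_def)
qed

text \<open>Adding \<open>m\<close> to a pseudo-Frobenius number must reach the semigroup, so it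
  lies exactly one step below the Apery set.\<close>

lemma pseudo_frobenius_subset:
  "pseudo_frobenius S \<subseteq> (\<lambda>i. pts (min_pos S) (word S) i - min_pos S) ` {1..<min_pos S}"
proof
  fix P assume P: "P \<in> pseudo_frobenius S"
  let ?m = "min_pos S"
  define i where "i = P mod ?m"
  have Pg: "P \<notin> S" and Pm: "P + ?m \<in> S"
    using P min_pos_in min_pos_gt_0 by (auto simp: pseudo_frobenius_def gaps_def)
  have a: "P div ?m < kunz_coord S i" "kunz_coord S i \<le> P div ?m + 1"
    using Pg Pm mem_iff[of P] mem_iff[of "P + ?m"] min_pos_gt_0 by (auto simp: i_def)
  have "i \<noteq> 0" using a(1) kunz_coord_zero by (metis not_less0)
  hence iV: "i \<in> {1..<?m}" using min_pos_gt_0 by (simp add: i_def)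
  have "kunz_coord S i = P div ?m + 1" using a by simp
  hence "pts ?m (word S) i - ?m = P div ?m * ?m + P mod ?m" using iV by (simp add: pts_word i_def)
  hence "P = pts ?m (word S) i - ?m" by simp
  thus "P \<in> (\<lambda>i. pts ?m (word S) i - ?m) ` {1..<?m}" using iV by blast
qed

text \<open>At a letter 1 the only candidate is the gap \<open>i\<close> itself, and it would force
  \<open>shifts\<close>. The ends of the range, of length \<open>h\<close> each, are given
  away.\<close>

lemma type_upper:
  assumes sh: "\<And>i. h \<le> i \<Longrightarrow> i + h \<le> min_pos S \<Longrightarrow> \<not> shifts (min_pos S) i (word S)"
  shows "semigroup_type S + ones (min_pos S) (word S) \<le> min_pos S + 2 * h"
proof -
  let ?m = "min_pos S"
  let ?O = "{i \<in> {1..<?m}. word S i = 1}"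
  have "pseudo_frobenius S \<subseteq> (\<lambda>i. pts ?m (word S) i - ?m) ` (({1..<?m} - ?O) \<union> {..<h} \<union> {?m - h..<?m})"
  proof
    fix P assume P: "P \<in> pseudo_frobenius S"
    then obtain i where i: "i \<in> {1..<?m}" "P = pts ?m (word S) i - ?m" using pseudo_frobenius_subset by blast
    have "i \<in> ({1..<?m} - ?O) \<union> {..<h} \<union> {?m - h..<?m}"
    proof (rule ccontr)
      assume ni: "i \<notin> ({1..<?m} - ?O) \<union> {..<h} \<union> {?m - h..<?m}"
      hence w1: "word S i = 1" and hi: "h \<le> i" "i + h \<le> ?m" using i by auto
      have Pi: "P = i" using i w1 by (simp add: pts_def)
      have "word S (i + j) = 1" if j: "j \<ge> 1" "i + j < ?m" "word S j = 1" for j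
      proof -
        have "?m + j \<in> S" using kunz_coord_in[of j] j by (simp add: word_eq)
        hence "i + (?m + j) \<in> S" using P Pi min_pos_gt_0 by (auto simp: pseudo_frobenius_def)
        hence "kunz_coord S (i + j) \<le> 1" using mem_iff'[of "i + j" 1] j by (simp add: algebra_simps)
        moreover have "kunz_coord S (i + j) \<ge> 1" using kunz_coord_pos[of "i + j"] j by simp
        ultimately show ?thesis using j by (simp add: word_eq)
      qed
      hence "shifts ?m i (word S)" by (auto simp: shifts_def)
      thus False using sh hi by blast
    qed
    thus "P \<in> (\<lambda>i. pts ?m (word S) i - ?m) ` (({1..<?m} - ?O) \<union> {..<h} \<union> {?m - h..<?m})"
      using i by blast
  qed
  hence "semigroup_type S \<le> card ((\<lambda>i. pts ?m (word S) i - ?m) ` (({1..<?m} - ?O) \<union> {..<h} \<union> {?m - h..<?m}))"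
    unfolding semigroup_type_def by (intro card_mono) auto
  also have "\<dots> \<le> card (({1..<?m} - ?O) \<union> {..<h} \<union> {?m - h..<?m})" by (intro card_image_le) auto
  also have "\<dots> \<le> card ({1..<?m} - ?O) + card {..<h} + card {?m - h..<?m}"
    by (meson add_le_cancel_right card_Un_le le_trans)
  also have "card ({1..<?m} - ?O) = card {1..<?m} - card ?O" by (intro card_Diff_subset) auto
  finally have "semigroup_type S \<le> (?m - 1 - ones ?m (word S)) + h + (?m - (?m - h))" by (simp add: ones_def)
  moreover have "card ?O \<le> card {1..<?m}" by (intro card_mono) auto
  ultimately show ?thesis by (simp add: ones_def)
qed

text \<open>No gap exceeds \<open>2 * m + d\<close>. At a letter 2 with \<open>i > d\<close>, adding
  a nonzero element to the gap \<open>m + i\<close> reaches at least \<open>2 * m + i\<close>,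
  beyond all gaps.\<close>

lemma type_lower:
  assumes low: "\<And>j. j \<in> {1..<min_pos S} \<Longrightarrow> pts (min_pos S) (word S) j \<le> 3 * min_pos S + d"
  shows "min_pos S \<le> semigroup_type S + ones (min_pos S) (word S) + d + 1"
proof -
  let ?m = "min_pos S"
  let ?O = "{i \<in> {1..<?m}. word S i = 1}"
  let ?T = "{1..<?m} - ?O - {1..d}"
  have "(\<lambda>i. ?m + i) ` ?T \<subseteq> pseudo_frobenius S"
  proof (rule image_subsetI)
    fix i assume "i \<in> ?T"
    hence i: "i \<in> {1..<?m}" "i \<notin> {1..d}" "\<not> word S i = 1" by auto
    have "word S i \<ge> 1" using i kunz_coord_pos word_eq by simp
    hence a2: "kunz_coord S i = 2" using letter_le_2[OF low, of i] i word_eq[of i] by auto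
    have "?m + i + s \<in> S" if s: "s \<in> S - {0}" for s
    proof (rule ccontr)
      define G where "G = ?m + i + s"
      define j where "j = G mod ?m"
      assume "?m + i + s \<notin> S"
      hence lt: "G div ?m < kunz_coord S j" using mem_iff[of G] by (simp add: G_def j_def)
      hence "j \<noteq> 0" using kunz_coord_zero by (metis not_less0)
      hence jV: "j \<in> {1..<?m}" using min_pos_gt_0 by (simp add: j_def)
      have "(G div ?m + 1) * ?m \<le> kunz_coord S j * ?m" using lt by (intro mult_right_mono) auto
      moreover have "(G div ?m + 1) * ?m = G div ?m * ?m + ?m" by simp
      ultimately have "G + ?m \<le> kunz_coord S j * ?m + j"
        using div_mult_mod_eq[of G ?m] unfolding j_def by linarith
      also have "\<dots> \<le> 3 * ?m + d" using low[OF jV] pts_word[OF jV] by simp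
      finally show False using min_pos_le[of s] s i unfolding G_def by auto
    qed
    moreover have "?m + i \<notin> S" using mem_iff'[of i 1] a2 i by simp
    ultimately show "?m + i \<in> pseudo_frobenius S" by (auto simp: pseudo_frobenius_def gaps_def)
  qed
  moreover have "finite (pseudo_frobenius S)" using finite_gaps by (simp add: pseudo_frobenius_def)
  ultimately have "card ((\<lambda>i. ?m + i) ` ?T) \<le> semigroup_type S"
    unfolding semigroup_type_def by (intro card_mono)
  hence "card ?T \<le> semigroup_type S" by (simp add: card_image)
  moreover have "card ({1..<?m} - ?O) - card {1..d} \<le> card ?T"
    by (rule diff_card_le_card_Diff) simp
  moreover have "card ({1..<?m} - ?O) = card {1..<?m} - card ?O" by (intro card_Diff_subset) auto
  ultimately show ?thesis by (simp add: ones_def)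
qed

text \<open>Counting every letter 1 once more makes each letter 1 or 2 contribute exactly 2. Only
  positions up to \<open>d\<close> can contribute 3, and \<open>d < m\<close> excludes larger
  letters. The 2 on both sides reflects that there are \<open>m - 1\<close> positions.\<close>

lemma genus_bounds:
  assumes low: "\<And>j. j \<in> {1..<min_pos S} \<Longrightarrow> pts (min_pos S) (word S) j \<le> 3 * min_pos S + d"
    and d: "d < min_pos S"
  shows "2 * min_pos S \<le> genus S + ones (min_pos S) (word S) + 2"
    "genus S + ones (min_pos S) (word S) + 2 \<le> 2 * min_pos S + d"
proof -
  let ?m = "min_pos S"
  let ?one = "\<lambda>i. if word S i = 1 then 1 else 0::nat"
  have tot: "genus S + ones ?m (word S) = (\<Sum>i\<in>{1..<?m}. word S i + ?one i)"
    unfolding genus_eq ones_def by (simp add: sum.distrib sum.If_cases Int_def)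
  have "(\<Sum>i\<in>{1..<?m}. 2) \<le> (\<Sum>i\<in>{1..<?m}. word S i + ?one i)"
  proof (rule sum_mono)
    fix i assume i: "i \<in> {1..<?m}"
    have "word S i \<ge> 1" using i kunz_coord_pos word_eq by simp
    thus "2 \<le> word S i + ?one i" by auto
  qed
  thus "2 * ?m \<le> genus S + ones ?m (word S) + 2" unfolding tot by simp
  have "(\<Sum>i\<in>{1..<?m}. word S i + ?one i) \<le> (\<Sum>i\<in>{1..<?m}. 2 + (if i \<le> d then 1 else 0))"
  proof (rule sum_mono)
    fix i assume i: "i \<in> {1..<?m}"
    have "word S i \<le> 3"
    proof (rule ccontr)
      assume "\<not> word S i \<le> 3"
      hence "4 * ?m \<le> word S i * ?m" by (intro mult_right_mono) auto
      moreover have "word S i * ?m + i \<le> 3 * ?m + d" using low[OF i] by (simp add: pts_def)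
      ultimately show False using d by linarith
    qed
    thus "word S i + ?one i \<le> 2 + (if i \<le> d then 1 else 0)"
      using letter_le_2[OF low i] by (auto simp: not_le)
  qed
  also have "\<dots> = 2 * (?m - 1) + card ({1..<?m} \<inter> {i. i \<le> d})"
    by (simp only: sum.distrib sum.If_cases finite_atLeastLessThan) simp
  also have "card ({1..<?m} \<inter> {i. i \<le> d}) \<le> card {1..d}" by (intro card_mono) auto
  finally show "genus S + ones ?m (word S) + 2 \<le> 2 * ?m + d" unfolding tot using min_pos_gt_0 by simp
qed

end

lemma word_inj:
  assumes S: "numerical_semigroup S" and S': "numerical_semigroup S'"
    and eq: "min_pos S = min_pos S'" "word S = word S'"
  shows "S = S'"
proof -
  have ap: "kunz_coord S i = kunz_coord S' i" if "i < min_pos S" for i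
  proof (cases "i = 0")
    case True
    thus ?thesis using kunz_coord_zero[OF S] kunz_coord_zero[OF S'] by simp
  next
    case False
    hence i: "i \<in> {1..<min_pos S}" "i \<in> {1..<min_pos S'}" using that eq by auto
    show ?thesis using word_eq[OF S i(1)] word_eq[OF S' i(2)] eq(2) by simp
  qed
  have "n \<in> S \<longleftrightarrow> n \<in> S'" for n
    using mem_iff[OF S, of n] mem_iff[OF S', of n] ap[of "n mod min_pos S"] min_pos_gt_0[OF S] eq(1) by simp
  thus ?thesis by blast
qed

section \<open>Counting\<close>

lemma semigroups_of_genusD:
  "S \<in> semigroups_of_genus g \<Longrightarrow> numerical_semigroup S" "S \<in> semigroups_of_genus g \<Longrightarrow> genus S = g"
  by (auto simp: semigroups_of_genus_def)

lemma finite_semigroups_of_genus: "finite (semigroups_of_genus g)"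
proof (rule finite_subset)
  show "semigroups_of_genus g \<subseteq> (\<lambda>H. UNIV - H) ` Pow {..2 * g}"
  proof
    fix S assume S: "S \<in> semigroups_of_genus g"
    have "gaps S \<subseteq> {..2 * g}"
      using gap_le[OF semigroups_of_genusD(1)[OF S]] semigroups_of_genusD(2)[OF S] by fastforce
    moreover have "S = UNIV - gaps S" by (auto simp: gaps_def)
    ultimately show "S \<in> (\<lambda>H. UNIV - H) ` Pow {..2 * g}" by blast
  qed
qed simp

text \<open>The semigroups whose Kunz word has letters 1 and 2 only, that is, with no gap above
  twice the multiplicity.\<close>

lemma fib_le_card_semigroups: "fib (Suc g) \<le> card (semigroups_of_genus g)"
proof -
  \<comment> \<open>Here \<open>k\<close> is the number of letters 2, the multiplicity is
    \<open>g - k + 1\<close>, and \<open>B\<close> is the set of gaps above it. The binomial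
    coefficients counting \<open>B\<close> sum along a diagonal of Pascal's triangle to a Fibonacci
    number.\<close>
  let ?I = "SIGMA k:{0..g}. {B. B \<subseteq> {g - k + 2..<2 * (g - k + 1)} \<and> card B = k}"
  let ?H = "\<lambda>(k, B). {1..<g - k + 1} \<union> B"
  let ?F = "\<lambda>x. UNIV - ?H x"
  have "card ?I = (\<Sum>k = 0..g. (g - k) choose k)"
  proof (subst card_SigmaI)
    show "(\<Sum>k\<in>{0..g}. card {B. B \<subseteq> {g - k + 2..<2 * (g - k + 1)} \<and> card B = k})
        = (\<Sum>k = 0..g. (g - k) choose k)"
    proof (rule sum.cong)
      fix k
      have "2 * (g - k + 1) - (g - k + 2) = g - k" by simp
      thus "card {B. B \<subseteq> {g - k + 2..<2 * (g - k + 1)} \<and> card B = k} = (g - k) choose k"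
        by (simp only: n_subsets finite_atLeastLessThan card_atLeastLessThan)
    qed simp
  qed auto
  hence "fib (Suc g) = card ?I" by (simp add: ne_diagonal_fib)
  also have "\<dots> \<le> card (semigroups_of_genus g)"
  proof (rule card_inj_on_le[OF _ _ finite_semigroups_of_genus])
    show "inj_on ?F ?I"
    proof (rule inj_onI)
      fix x y assume xy: "x \<in> ?I" "y \<in> ?I" "?F x = ?F y"
      obtain k B l C where x: "x = (k, B)" and y: "y = (l, C)" by (cases x, cases y)
      have H: "{1..<g - k + 1} \<union> B = {1..<g - l + 1} \<union> C" using xy(3) unfolding x y by auto
      have B: "B \<subseteq> {g - k + 2..<2 * (g - k + 1)}" "k \<le> g" and C: "C \<subseteq> {g - l + 2..<2 * (g - l + 1)}" "l \<le> g"
        using xy(1,2) unfolding x y by auto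
      \<comment> \<open>The multiplicity is the least positive non-gap, so the gap set determines
        \<open>k\<close>.\<close>
      have "g - k + 1 \<notin> {1..<g - l + 1} \<union> C" unfolding H[symmetric] using B by auto
      hence 1: "l \<ge> k" using B(2) C(2) by auto
      have "g - l + 1 \<notin> {1..<g - k + 1} \<union> B" unfolding H using C by auto
      hence "k = l" using 1 B(2) C(2) by auto
      moreover have "B = C"
      proof -
        have "B \<inter> {1..<g - k + 1} = {}" "C \<inter> {1..<g - k + 1} = {}" using B C \<open>k = l\<close> by auto
        thus ?thesis using H \<open>k = l\<close> by blast
      qed
      ultimately show "x = y" by (simp add: x y)
    qed
    show "?F ` ?I \<subseteq> semigroups_of_genus g"
    proof (rule image_subsetI)
      fix x assume x: "x \<in> ?I"
      then obtain k B where kB: "x = (k, B)" "k \<le> g" "B \<subseteq> {g - k + 2..<2 * (g - k + 1)}" "card B = k"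
        by auto
      have finB: "finite B" using kB(3) finite_subset by blast
      have gp: "gaps (?F x) = {1..<g - k + 1} \<union> B" by (auto simp: gaps_def kB(1))
      have "genus (?F x) = card {1..<g - k + 1} + card B"
        unfolding genus_def gp using finB kB(3) by (intro card_Un_disjoint) auto
      hence "genus (?F x) = g" using kB by simp
      moreover have "numerical_semigroup (?F x)"
        unfolding numerical_semigroup_def
      proof (intro conjI ballI)
        show "0 \<in> ?F x" using kB by auto
        show "finite (UNIV - ?F x)" using finB gp by (simp add: gaps_def)
        fix a b assume ab: "a \<in> ?F x" "b \<in> ?F x"
        show "a + b \<in> ?F x"
        proof (cases "a = 0 \<or> b = 0")
          case False
          hence "a \<ge> g - k + 1" "b \<ge> g - k + 1" using ab kB by auto
          hence le: "(g - k + 1) + (g - k + 1) \<le> a + b" by (intro add_mono)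
          have "a + b \<notin> B"
          proof
            assume "a + b \<in> B"
            hence "a + b < 2 * (g - k + 1)" using kB(3) atLeastLessThan_iff by blast
            thus False using le unfolding mult_2 by simp
          qed
          thus ?thesis using le by (simp add: kB(1))
        qed (use ab in auto)
      qed
      ultimately show "?F x \<in> semigroups_of_genus g" by (simp add: semigroups_of_genus_def)
    qed
  qed
  finally show ?thesis .
qed

lemma fib_rgold_ge: "rgold \<le> real (fib (Suc n)) * rgold ^ n"
proof (induction n rule: fib.induct)
  case 1
  thus ?case using rgold_less_1 by simp
next
  case 2
  thus ?case by simp
next
  case (3 n)
  have "rgold = rgold * rgold + rgold * rgold * rgold"
    by (simp add: rgold_mult_self algebra_simps)
  also have "\<dots> \<le> rgold * (real (fib (Suc (Suc n))) * rgold ^ Suc n)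
      + rgold * rgold * (real (fib (Suc n)) * rgold ^ n)"
    using 3 rgold_pos by (intro add_mono mult_left_mono) auto
  also have "\<dots> = real (fib (Suc (Suc (Suc n)))) * rgold ^ Suc (Suc n)"
    by (simp add: algebra_simps)
  finally show ?case .
qed

lemma prob_genus_tendsto_1:
  assumes "(\<lambda>g. rgold ^ g * real (card {S \<in> semigroups_of_genus g. \<not> P g S})) \<longlonglongrightarrow> 0"
  shows "(\<lambda>g. prob_genus g (P g)) \<longlonglongrightarrow> 1"
proof -
  let ?n = "\<lambda>g. card (semigroups_of_genus g)"
  let ?b = "\<lambda>g. card {S \<in> semigroups_of_genus g. \<not> P g S}"
  have n: "rgold \<le> real (?n g) * rgold ^ g" for g
  proof -
    have "rgold \<le> real (fib (Suc g)) * rgold ^ g" by (rule fib_rgold_ge)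
    also have "\<dots> \<le> real (?n g) * rgold ^ g"
      using fib_le_card_semigroups rgold_pos by (intro mult_right_mono) auto
    finally show ?thesis .
  qed
  have pos: "?n g > 0" for g
    using fib_le_card_semigroups[of g] fib_neq_0_nat[of "Suc g"] by linarith
  have eq: "prob_genus g (P g) = 1 - real (?b g) / real (?n g)" for g
  proof -
    have "?n g = card {S \<in> semigroups_of_genus g. P g S} + ?b g"
      using finite_semigroups_of_genus
      by (subst card_Un_disjoint[symmetric]) (auto intro: arg_cong[where f = card])
    hence "real (card {S \<in> semigroups_of_genus g. P g S}) = real (?n g) - real (?b g)" by simp
    thus ?thesis unfolding prob_genus_def using pos[of g] by (simp only: diff_divide_distrib) simp
  qed
  have le: "real (?b g) / real (?n g) \<le> rgold ^ g * real (?b g) / rgold" for g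
  proof -
    have "real (?b g) * rgold \<le> real (?b g) * (real (?n g) * rgold ^ g)"
      by (intro mult_left_mono n) simp
    thus ?thesis using pos[of g] rgold_pos by (simp add: field_simps)
  qed
  have "(\<lambda>g. real (?b g) / real (?n g)) \<longlonglongrightarrow> 0"
  proof (rule tendsto_sandwich[OF _ _ tendsto_const])
    show "(\<lambda>g. rgold ^ g * real (?b g) / rgold) \<longlonglongrightarrow> 0"
      using tendsto_divide[OF assms tendsto_const[of rgold]] rgold_pos by simp
  qed (use le in auto)
  hence "(\<lambda>g. 1 - real (?b g) / real (?n g)) \<longlonglongrightarrow> 1 - 0" by (intro tendsto_intros)
  thus ?thesis unfolding eq by simp
qed

section \<open>From weights of words to numbers of semigroups\<close>

lemma card_by_multiplicity_le:
  assumes "finite I" "\<And>S. S \<in> X \<Longrightarrow> min_pos S \<in> I"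
    and X: "X \<subseteq> semigroups_of_genus g"
    and W: "\<And>m. m \<in> I \<Longrightarrow> finite (W m)" "\<And>S. S \<in> X \<Longrightarrow> word S \<in> W (min_pos S)"
  shows "card X \<le> (\<Sum>m\<in>I. card {f \<in> W m. (\<Sum>i\<in>{1..<m}. f i) = g})"
proof -
  let ?X = "\<lambda>m. {S \<in> X. min_pos S = m}"
  have finX: "finite X" using X finite_semigroups_of_genus finite_subset by blast
  have "X = (\<Union>m\<in>I. ?X m)" using assms(2) by blast
  hence "card X \<le> (\<Sum>m\<in>I. card (?X m))" using card_UN_le[OF assms(1), of ?X] by simp
  also have "\<dots> \<le> (\<Sum>m\<in>I. card {f \<in> W m. (\<Sum>i\<in>{1..<m}. f i) = g})"
  proof (rule sum_mono)
    fix m assume m: "m \<in> I"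
    show "card (?X m) \<le> card {f \<in> W m. (\<Sum>i\<in>{1..<m}. f i) = g}"
    proof (rule card_inj_on_le[where f = word])
      show "inj_on word (?X m)"
        using X semigroups_of_genusD(1) by (intro inj_onI word_inj) auto
      show "word ` ?X m \<subseteq> {f \<in> W m. (\<Sum>i\<in>{1..<m}. f i) = g}"
      proof (rule image_subsetI)
        fix S assume S: "S \<in> ?X m"
        hence "S \<in> semigroups_of_genus g" using X by blast
        from genus_eq[OF semigroups_of_genusD(1)[OF this]] semigroups_of_genusD(2)[OF this]
        show "word S \<in> {f \<in> W m. (\<Sum>i\<in>{1..<m}. f i) = g}" using S W(2)[of S] by auto
      qed
    qed (use W m in auto)
  qed
  finally show ?thesis .
qed

text \<open>A word with sum \<open>g\<close> weighs exactly \<open>rgold ^ g\<close>, so the scaled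
  count is bounded by total weights. Since \<open>m > g / 8\<close>, decay in \<open>m\<close> is
  decay in \<open>g\<close>, and at most \<open>g + 2\<close> multiplicities occur.\<close>

lemma rgold_card_tendsto_0:
  assumes "exp_small (\<lambda>m. \<Sum>f | f \<in> words m 16 \<and> kunz m f \<and> Q m f. wt {1..<m} f)"
  shows "(\<lambda>g. rgold ^ g * real (card {S \<in> semigroups_of_genus g. g < 8 * min_pos S \<and> Q (min_pos S) (word S)}))
     \<longlonglongrightarrow> 0"
proof -
  let ?W = "\<lambda>m. {f \<in> words m 16. kunz m f \<and> Q m f}"
  let ?X = "\<lambda>g. {S \<in> semigroups_of_genus g. g < 8 * min_pos S \<and> Q (min_pos S) (word S)}"
  let ?I = "\<lambda>g. {m. g < 8 * m \<and> m \<le> g + 1}"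
  from assms obtain c M where c: "c > 0"
    and M: "\<And>m. m \<ge> M \<Longrightarrow> (\<Sum>f\<in>?W m. wt {1..<m} f) \<le> exp (- c * real m)"
    unfolding exp_small_def eventually_sequentially by blast
  have finW: "finite (?W m)" for m by (rule finite_subset[OF _ finite_words]) auto
  have bound: "rgold ^ g * real (card (?X g)) \<le> (real g + 2) * exp (- c * (real g / 8))" if g: "g \<ge> 8 * M" for g
  proof -
    have finI: "finite (?I g)" and cI: "card (?I g) \<le> g + 2"
      using card_mono[of "{..g + 1}" "?I g"] by (auto intro: finite_subset[of _ "{..g + 1}"])
    have "card (?X g) \<le> (\<Sum>m\<in>?I g. card {f \<in> ?W m. (\<Sum>i\<in>{1..<m}. f i) = g})"
    proof (rule card_by_multiplicity_le[OF finI _ _ finW])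
      fix S assume S: "S \<in> ?X g"
      hence ns: "numerical_semigroup S" "genus S = g" using semigroups_of_genusD by auto
      show "min_pos S \<in> ?I g" using min_pos_le_genus[OF ns(1)] ns S by auto
      show "word S \<in> ?W (min_pos S)" using word_in_words[OF ns(1)] kunz_word[OF ns(1)] ns S by auto
    qed auto
    hence "rgold ^ g * real (card (?X g))
        \<le> rgold ^ g * real (\<Sum>m\<in>?I g. card {f \<in> ?W m. (\<Sum>i\<in>{1..<m}. f i) = g})"
      using rgold_pos by (intro mult_left_mono of_nat_mono) auto
    also have "\<dots> = (\<Sum>m\<in>?I g. rgold ^ g * real (card {f \<in> ?W m. (\<Sum>i\<in>{1..<m}. f i) = g}))"
      by (simp only: of_nat_sum sum_distrib_left)
    also have "\<dots> \<le> (\<Sum>m\<in>?I g. exp (- c * (real g / 8)))"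
    proof (rule sum_mono)
      fix m assume m: "m \<in> ?I g"
      have "rgold ^ g * real (card {f \<in> ?W m. (\<Sum>i\<in>{1..<m}. f i) = g})
          = (\<Sum>f | f \<in> ?W m \<and> (\<Sum>i\<in>{1..<m}. f i) = g. rgold ^ g)" by simp
      also have "\<dots> = (\<Sum>f | f \<in> ?W m \<and> (\<Sum>i\<in>{1..<m}. f i) = g. wt {1..<m} f)"
        by (rule sum.cong) (auto simp: wt_eq_power)
      also have "\<dots> \<le> (\<Sum>f\<in>?W m. wt {1..<m} f)"
        using finW by (intro sum_mono2) (auto intro: wt_nonneg)
      also have "\<dots> \<le> exp (- c * real m)" using m g by (intro M) auto
      also have "\<dots> \<le> exp (- c * (real g / 8))" using m c by simp
      finally show "rgold ^ g * real (card {f \<in> ?W m. (\<Sum>i\<in>{1..<m}. f i) = g}) \<le> exp (- c * (real g / 8))" .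
    qed
    also have "\<dots> = real (card (?I g)) * exp (- c * (real g / 8))" by simp
    also have "\<dots> \<le> (real g + 2) * exp (- c * (real g / 8))" using cI by (intro mult_right_mono) auto
    finally show ?thesis .
  qed
  show ?thesis
  proof (rule tendsto_sandwich[OF _ _ tendsto_const])
    show "\<forall>\<^sub>F g in sequentially. rgold ^ g * real (card (?X g)) \<le> (real g + 2) * exp (- c * (real g / 8))"
      using bound eventually_sequentially by blast
    show "(\<lambda>g. (real g + 2) * exp (- c * (real g / 8))) \<longlonglongrightarrow> 0" using c by real_asymp
  qed (use rgold_pos in auto)
qed

text \<open>The number of compositions of \<open>g\<close> into \<open>m - 1\<close> parts is at most
  \<open>y\<^sup>-\<^sup>g (y / (1 - y))\<^sup>m\<^sup>-\<^sup>1\<close>; we take \<open>y = 7/10\<close>.\<close>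

lemma card_compositions_le:
  "real (card {f \<in> words m g. (\<Sum>i\<in>{1..<m}. f i) = g}) \<le> (10 / 7) ^ g * (7 / 3) ^ (m - 1)"
proof -
  let ?W = "{f \<in> words m g. (\<Sum>i\<in>{1..<m}. f i) = g}"
  have geo: "(\<Sum>k\<in>{1..g}. (7 / 10) ^ k) \<le> (7 / 3 :: real)"
  proof -
    have "(\<Sum>k\<in>{1..g}. (7 / 10) ^ k) = 7 / 3 * (1 - (7 / 10) ^ g :: real)"
    proof (induction g)
      case (Suc g)
      have "(7 / 10 :: real) ^ Suc g = 7 / 10 * (7 / 10) ^ g" by (rule power_Suc)
      moreover have "(\<Sum>k\<in>{1..Suc g}. (7 / 10 :: real) ^ k) = (\<Sum>k\<in>{1..g}. (7 / 10) ^ k) + (7 / 10) ^ Suc g"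
        by (simp del: power_Suc)
      ultimately have "(\<Sum>k\<in>{1..Suc g}. (7 / 10 :: real) ^ k) = 7 / 3 * (1 - (7 / 10) ^ g) + 7 / 10 * (7 / 10) ^ g"
        using Suc.IH by simp
      also have "\<dots> = 7 / 3 * (1 - 7 / 10 * (7 / 10) ^ g)" by (simp add: algebra_simps)
      finally show ?case by (simp only: power_Suc)
    qed simp
    also have "\<dots> \<le> 7 / 3" by simp
    finally show ?thesis .
  qed
  have "real (card ?W) * (7 / 10) ^ g = (\<Sum>f\<in>?W. (7 / 10) ^ g)" by simp
  also have "\<dots> = (\<Sum>f\<in>?W. \<Prod>i\<in>{1..<m}. (7 / 10) ^ f i)"
    by (rule sum.cong) (auto simp: power_sum)
  also have "\<dots> \<le> (\<Sum>f\<in>words m g. \<Prod>i\<in>{1..<m}. (7 / 10) ^ f i)"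
    by (rule sum_mono2[OF finite_words]) (auto intro: prod_nonneg)
  also have "\<dots> = (\<Prod>i\<in>{1..<m}. \<Sum>k\<in>{1..g}. (7 / 10) ^ k)"
    unfolding words_def by (rule prod_sum_PiE[symmetric]) auto
  also have "\<dots> \<le> (\<Prod>i\<in>{1..<m}. 7 / 3)" using geo by (intro prod_mono) (auto intro: sum_nonneg)
  also have "\<dots> = (7 / 3) ^ (m - 1)" by simp
  finally have "real (card ?W) * (7 / 10) ^ g * (10 / 7) ^ g \<le> (7 / 3) ^ (m - 1) * (10 / 7) ^ g"
    by (rule mult_right_mono) simp
  moreover have "(7 / 10) ^ g * (10 / 7) ^ g = (1 :: real)"
    by (simp flip: power_mult_distrib)
  ultimately have "real (card ?W) * 1 \<le> (7 / 3) ^ (m - 1) * (10 / 7) ^ g"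
    by (simp only: mult.assoc)
  thus ?thesis by (simp only: mult_1_right mult.commute)
qed

text \<open>\<open>139 / 125\<close> is slightly more than the eighth root of \<open>7 / 3\<close>,
  and \<open>5 / 8\<close> is more than \<open>rgold\<close>; the product with \<open>10 / 7\<close>
  is still below 1.\<close>

lemma rgold_card_small_mult_tendsto_0:
  "(\<lambda>g. rgold ^ g * real (card {S \<in> semigroups_of_genus g. 8 * min_pos S \<le> g})) \<longlonglongrightarrow> 0"
proof -
  let ?X = "\<lambda>g. {S \<in> semigroups_of_genus g. 8 * min_pos S \<le> g}"
  have bound: "rgold ^ g * real (card (?X g)) \<le> (real g + 1) * (3475 / 3500) ^ g" for g
  proof -
    have "card (?X g) \<le> (\<Sum>m\<in>{..g div 8}. card {f \<in> words m g. (\<Sum>i\<in>{1..<m}. f i) = g})"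
    proof (rule card_by_multiplicity_le)
      fix S assume S: "S \<in> ?X g"
      hence ns: "numerical_semigroup S" "genus S = g" using semigroups_of_genusD by auto
      show "min_pos S \<in> {..g div 8}" using S by auto
      have "word S i \<in> {1..g}" if "i \<in> {1..<min_pos S}" for i
        using kunz_coord_pos[OF ns(1) that] word_eq[OF ns(1) that] genus_eq[OF ns(1)] ns(2)
          member_le_sum[OF that, of "word S"] by auto
      thus "word S \<in> words (min_pos S) g" by (auto simp: words_def word_def PiE_iff)
    qed (auto intro: finite_words)
    hence "real (card (?X g)) \<le> real (\<Sum>m\<in>{..g div 8}. card {f \<in> words m g. (\<Sum>i\<in>{1..<m}. f i) = g})"
      by (rule of_nat_mono)
    also have "\<dots> \<le> (\<Sum>m\<in>{..g div 8}. (10 / 7) ^ g * (139 / 125) ^ g)"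
      unfolding of_nat_sum
    proof (rule sum_mono)
      fix m assume m: "m \<in> {..g div 8}"
      have "real (card {f \<in> words m g. (\<Sum>i\<in>{1..<m}. f i) = g}) \<le> (10 / 7) ^ g * (7 / 3) ^ (m - 1)"
        by (rule card_compositions_le)
      also have "(7 / 3 :: real) ^ (m - 1) \<le> ((139 / 125) ^ 8) ^ (m - 1)"
        by (rule power_mono) (auto simp: power_divide)
      also have "\<dots> = (139 / 125) ^ (8 * (m - 1))" by (simp add: power_mult)
      also have "\<dots> \<le> (139 / 125) ^ g" using m by (intro power_increasing) auto
      finally show "real (card {f \<in> words m g. (\<Sum>i\<in>{1..<m}. f i) = g}) \<le> (10 / 7) ^ g * (139 / 125) ^ g"
        by (simp add: mult_left_mono)
    qed
    also have "\<dots> = real (g div 8 + 1) * ((10 / 7) ^ g * (139 / 125) ^ g)" by simp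
    also have "\<dots> \<le> (real g + 1) * ((10 / 7) ^ g * (139 / 125) ^ g)"
      by (intro mult_right_mono) auto
    finally have "rgold ^ g * real (card (?X g)) \<le> (5 / 8) ^ g * ((real g + 1) * ((10 / 7) ^ g * (139 / 125) ^ g))"
      using rgold_less rgold_pos by (intro mult_mono power_mono) auto
    also have "\<dots> = (real g + 1) * (5 / 8 * (10 / 7) * (139 / 125)) ^ g"
      by (simp only: power_mult_distrib mult_ac)
    finally show ?thesis by simp
  qed
  show ?thesis
  proof (rule tendsto_sandwich[OF _ _ tendsto_const])
    show "(\<lambda>g. (real g + 1) * (3475 / 3500) ^ g) \<longlonglongrightarrow> 0" by real_asymp
  qed (use rgold_pos bound in auto)
qed

section \<open>The constants of the theorem and the final estimate\<close>

lemma sqrt5_eq: "sqrt 5 = 2 * rgold + 1"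
  by (simp add: rgold_def field_simps)

text \<open>Converts \<open>rgold * m\<close> into \<open>g / sqrt 5\<close> when \<open>g\<close>
  is about \<open>(2 - rgold) * m\<close>.\<close>

lemma rgold_ratio: "(2 - rgold) / sqrt 5 = rgold"
proof -
  have "rgold * (2 * rgold + 1) = 2 * (rgold * rgold) + rgold" by (simp add: algebra_simps)
  thus ?thesis using rgold_pos unfolding sqrt5_eq by (simp add: rgold_mult_self divide_eq_eq)
qed

lemma rgold_ratio': "(2 - rgold) * (1 - (5 + sqrt 5) / 10) = 1 - rgold"
proof -
  have "(2 - rgold) * (1 - (5 + (2 * rgold + 1)) / 10) = (4 - 4 * rgold + rgold * rgold) / 5"
    by (simp add: field_simps)
  thus ?thesis unfolding sqrt5_eq by (simp add: rgold_mult_self)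
qed

text \<open>With \<open>y = \<eta> * m\<close>, each of \<open>d\<close>, \<open>h\<close> and the
  deviation of \<open>ones\<close> is at most \<open>y\<close>. So \<open>e\<close> and
  \<open>t\<close> are within \<open>3 * y + 1\<close> of their multiples of \<open>m\<close>, and
  replacing \<open>m\<close> by \<open>g\<close> costs another \<open>2 * y + 2\<close>.\<close>

lemma likely_bounds:
  fixes \<eta> \<delta> :: real
  assumes S: "numerical_semigroup S" and \<eta>: "0 < \<delta>" "\<delta> \<le> \<eta>" "\<eta> \<le> 1/2"
    and low: "\<And>j. j \<in> {1..<min_pos S} \<Longrightarrow> pts (min_pos S) (word S) j \<le> 3 * min_pos S + nat \<lfloor>\<delta> * real (min_pos S)\<rfloor>"
    and likely: "\<not> unlikely \<eta> (min_pos S) (word S)"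
  shows "\<bar>real (embedding_dimension S) - real (genus S) / sqrt 5\<bar> \<le> 5 * \<eta> * (real (genus S) + 1) + 3"
    "\<bar>real (semigroup_type S) - (1 - (5 + sqrt 5) / 10) * real (genus S)\<bar> \<le> 5 * \<eta> * (real (genus S) + 1) + 3"
proof -
  define m where "m = min_pos S"
  define ob where "ob = ones m (word S)"
  define d where "d = nat \<lfloor>\<delta> * real m\<rfloor>"
  define h where "h = nat \<lfloor>\<eta> * real m\<rfloor>"
  define y where "y = \<eta> * real m"
  define g where "g = genus S"
  have m: "real m > 0" using min_pos_gt_0[OF S] by (simp add: m_def)
  have "\<delta> * real m \<le> y" unfolding y_def using \<eta> by (intro mult_right_mono) auto
  moreover have "0 \<le> \<delta> * real m" using \<eta> by simp
  ultimately have d: "real d \<le> y" and h: "real h \<le> y" unfolding d_def h_def y_def by linarith+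
  have "y \<le> 1/2 * real m" unfolding y_def using \<eta> by (intro mult_right_mono) auto
  hence dm: "d < m" using d m by linarith
  note low' = low[folded m_def, folded d_def]
  have lik: "\<not> real ob \<le> (rgold - \<eta>) * real m" "\<not> (rgold + \<eta>) * real m \<le> real ob"
      "\<not> (\<exists>s\<in>{h..<m}. avoids m s (word S))" "\<not> (\<exists>i. h \<le> i \<and> i + h \<le> m \<and> shifts m i (word S))"
    using likely unfolding unlikely_def m_def[symmetric] ob_def[symmetric] h_def[symmetric] by blast+
  have l: "\<not> avoids m s (word S)" if "h \<le> s" "s < m" for s using lik(3) that by auto
  have l': "\<not> shifts m i (word S)" if "h \<le> i" "i + h \<le> m" for i using lik(4) that by blast
  have ob: "\<bar>real ob - rgold * real m\<bar> \<le> y" using lik(1,2) by (simp add: y_def algebra_simps abs_le_iff)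
  have "embedding_dimension S \<le> ob + d + h + 1"
    unfolding ob_def m_def by (rule embedding_dimension_upper[OF S low'[unfolded m_def] l[unfolded m_def]])
  moreover have "ob \<le> embedding_dimension S"
    unfolding ob_def m_def by (rule embedding_dimension_lower[OF S])
  ultimately have e: "real ob \<le> real (embedding_dimension S)"
    "real (embedding_dimension S) \<le> real ob + real d + real h + 1" by linarith+
  have "semigroup_type S + ob \<le> m + 2 * h"
    unfolding ob_def m_def by (rule type_upper[OF S l'[unfolded m_def]])
  moreover have "m \<le> semigroup_type S + ob + d + 1"
    unfolding ob_def m_def by (rule type_lower[OF S low'[unfolded m_def]])
  ultimately have t: "real (semigroup_type S) + real ob \<le> real m + 2 * real h"
    "real m \<le> real (semigroup_type S) + real ob + real d + 1" by linarith+
  have gb: "2 * real m \<le> real g + real ob + 2" "real g + real ob + 2 \<le> 2 * real m + real d"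
    using genus_bounds[OF S, folded m_def, OF low' dm] by (simp_all add: ob_def g_def)
  have G: "\<bar>(2 - rgold) * real m - real g\<bar> \<le> 2 * y + 2"
    using gb ob d by (simp add: algebra_simps)
  have scale: "\<bar>c * ((2 - rgold) * real m - real g)\<bar> \<le> 2 * y + 2" if "0 \<le> c" "c \<le> 1" for c
  proof -
    have "\<bar>c * ((2 - rgold) * real m - real g)\<bar> = c * \<bar>(2 - rgold) * real m - real g\<bar>"
      using that by (simp add: abs_mult)
    also have "\<dots> \<le> 1 * \<bar>(2 - rgold) * real m - real g\<bar>" using that by (intro mult_right_mono) auto
    finally show ?thesis using G by simp
  qed
  have "real m \<le> real g + 1" using min_pos_le_genus[OF S] by (simp add: m_def g_def)
  hence yb: "y \<le> \<eta> * (real g + 1)" unfolding y_def using \<eta> by (intro mult_left_mono) auto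
  have s5: "0 \<le> 1 / sqrt 5" "1 / sqrt 5 \<le> 1" using rgold_pos unfolding sqrt5_eq by auto
  have "1 / sqrt 5 * ((2 - rgold) * real m - real g) = (2 - rgold) / sqrt 5 * real m - real g / sqrt 5"
    by (simp add: algebra_simps diff_divide_distrib add_divide_distrib)
  hence "\<bar>rgold * real m - real g / sqrt 5\<bar> \<le> 2 * y + 2"
    using scale[OF s5] unfolding rgold_ratio by simp
  hence "\<bar>real (embedding_dimension S) - real g / sqrt 5\<bar> \<le> 5 * y + 3"
    using e ob d h by linarith
  thus "\<bar>real (embedding_dimension S) - real (genus S) / sqrt 5\<bar> \<le> 5 * \<eta> * (real (genus S) + 1) + 3"
    using yb unfolding g_def by linarith
  define c where "c = 1 - (5 + sqrt 5) / 10"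
  have c: "0 \<le> c" "c \<le> 1" using rgold_facts unfolding c_def sqrt5_eq by auto
  have "c * ((2 - rgold) * real m - real g) = (2 - rgold) * c * real m - c * real g"
    by (simp add: algebra_simps)
  hence "\<bar>(1 - rgold) * real m - c * real g\<bar> \<le> 2 * y + 2"
    using scale[OF c] rgold_ratio' unfolding c_def by simp
  hence "\<bar>real (semigroup_type S) - c * real g\<bar> \<le> 5 * y + 3"
    using t ob d h by (simp add: algebra_simps)
  thus "\<bar>real (semigroup_type S) - (1 - (5 + sqrt 5) / 10) * real (genus S)\<bar> \<le> 5 * \<eta> * (real (genus S) + 1) + 3"
    using yb unfolding g_def c_def by linarith
qed

text \<open>The value of \<open>\<delta>\<close> is dictated by \<open>exp_small_unlikely\<close>;
  \<open>exp_small_high\<close> accepts any positive one. A semigroup of large multiplicity without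
  a high letter has its word in \<open>fwords\<close>, so only unlikely words remain.\<close>

lemma rgold_card_unlikely_tendsto_0:
  assumes \<eta>: "0 < \<eta>" "\<eta> \<le> 1/2"
  shows "(\<lambda>g. rgold ^ g * real (card {S \<in> semigroups_of_genus g.
     \<not> (\<bar>real (embedding_dimension S) - real g / sqrt 5\<bar> \<le> 5 * \<eta> * (real g + 1) + 3 \<and>
        \<bar>real (semigroup_type S) - (1 - (5 + sqrt 5) / 10) * real g\<bar> \<le> 5 * \<eta> * (real g + 1) + 3)}))
     \<longlonglongrightarrow> 0" (is "(\<lambda>g. rgold ^ g * real (card (?Bad g))) \<longlonglongrightarrow> 0")
proof -
  obtain \<delta> where \<delta>: "\<delta> > 0" "\<delta> \<le> \<eta>" and
    small: "exp_small (\<lambda>m. \<Sum>f | f \<in> fwords m 16 (nat \<lfloor>\<delta> * real m\<rfloor>) \<and> unlikely \<eta> m f. wt {1..<m} f)"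
    using exp_small_unlikely[of 16 \<eta>] \<eta> by auto
  let ?d = "\<lambda>m. nat \<lfloor>\<delta> * real m\<rfloor>"
  define Q1 where "Q1 m f \<longleftrightarrow> (\<exists>q\<in>{1..<m}. (3 + \<delta>) * real m \<le> real (pts m f q))" for m f
  define Q2 where "Q2 m f \<longleftrightarrow> f \<in> fwords m 16 (?d m) \<and> unlikely \<eta> m f" for m f
  have s1: "exp_small (\<lambda>m. \<Sum>f | f \<in> words m 16 \<and> kunz m f \<and> Q1 m f. wt {1..<m} f)"
    unfolding Q1_def by (rule exp_small_high) (use \<delta> in auto)
  have s2: "exp_small (\<lambda>m. \<Sum>f | f \<in> words m 16 \<and> kunz m f \<and> Q2 m f. wt {1..<m} f)"
    by (rule exp_small_mono[OF small], rule always_eventually, rule allI, rule sum_mono2)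
      (auto simp: Q2_def intro: wt_nonneg finite_subset[OF _ finite_fwords])
  let ?Small = "\<lambda>g. {S \<in> semigroups_of_genus g. 8 * min_pos S \<le> g}"
  let ?X = "\<lambda>Q g. {S \<in> semigroups_of_genus g. g < 8 * min_pos S \<and> Q (min_pos S) (word S)}"
  have sub: "?Bad g \<subseteq> ?Small g \<union> (?X Q1 g \<union> ?X Q2 g)" for g
  proof
    fix S assume bad: "S \<in> ?Bad g"
    hence Sg: "S \<in> semigroups_of_genus g" by blast
    note S = semigroups_of_genusD(1)[OF Sg] and gS = semigroups_of_genusD(2)[OF Sg]
    let ?m = "min_pos S"
    show "S \<in> ?Small g \<union> (?X Q1 g \<union> ?X Q2 g)"
    proof (rule ccontr)
      assume not: "S \<notin> ?Small g \<union> (?X Q1 g \<union> ?X Q2 g)"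
      hence gm: "g < 8 * ?m" and n1: "\<not> Q1 ?m (word S)" and n2: "\<not> Q2 ?m (word S)"
        using Sg by auto
      have low: "pts ?m (word S) j \<le> 3 * ?m + ?d ?m" if "j \<in> {1..<?m}" for j
      proof -
        have "real (pts ?m (word S) j) < (3 + \<delta>) * real ?m"
          using n1 that unfolding Q1_def by (auto simp: not_le)
        hence "real (pts ?m (word S) j) < 3 * real ?m + \<delta> * real ?m" by (simp add: algebra_simps)
        moreover have "0 \<le> \<delta> * real ?m" using \<delta> by simp
        ultimately show ?thesis by linarith
      qed
      have w: "word S \<in> words ?m 16" using word_in_words[OF S] gm gS by simp
      have "word S \<in> fwords ?m 16 (?d ?m)"
        unfolding fwords_def
      proof (rule PiE_I)
        fix i assume i: "i \<in> {1..<?m}"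
        hence "word S i \<in> {1..16}" using w by (auto simp: words_def)
        thus "word S i \<in> (if i \<le> ?d ?m then {1..16} else {1..2})"
          using letter_le_2[OF S low i] by auto
      qed (auto simp: word_def)
      hence "\<not> unlikely \<eta> ?m (word S)" using n2 by (auto simp: Q2_def)
      from likely_bounds[OF S \<delta> \<eta>(2) low this] show False using bad gS by auto
    qed
  qed
  have le: "rgold ^ g * real (card (?Bad g))
      \<le> rgold ^ g * real (card (?Small g)) + (rgold ^ g * real (card (?X Q1 g)) + rgold ^ g * real (card (?X Q2 g)))" for g
  proof -
    have "card (?Bad g) \<le> card (?Small g \<union> (?X Q1 g \<union> ?X Q2 g))"
      by (rule card_mono[OF _ sub]) (use finite_semigroups_of_genus in auto)
    also have "\<dots> \<le> card (?Small g) + (card (?X Q1 g) + card (?X Q2 g))"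
      by (meson add_le_cancel_left card_Un_le le_trans)
    finally have "real (card (?Bad g)) \<le> real (card (?Small g)) + (real (card (?X Q1 g)) + real (card (?X Q2 g)))"
      by (simp only: of_nat_add[symmetric] of_nat_le_iff)
    hence "rgold ^ g * real (card (?Bad g))
      \<le> rgold ^ g * (real (card (?Small g)) + (real (card (?X Q1 g)) + real (card (?X Q2 g))))"
      using rgold_pos by (intro mult_left_mono) auto
    thus ?thesis by (simp only: distrib_left)
  qed
  have lim: "(\<lambda>g. rgold ^ g * real (card (?Small g)) + (rgold ^ g * real (card (?X Q1 g)) + rgold ^ g * real (card (?X Q2 g))))
     \<longlonglongrightarrow> 0 + (0 + 0)"
    by (intro tendsto_add rgold_card_small_mult_tendsto_0 rgold_card_tendsto_0 s1 s2)
  show ?thesis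
  proof (rule tendsto_sandwich[OF always_eventually always_eventually tendsto_const])
    show "\<forall>g. 0 \<le> rgold ^ g * real (card (?Bad g))" using rgold_pos by simp
    show "\<forall>g. rgold ^ g * real (card (?Bad g)) \<le> rgold ^ g * real (card (?Small g))
        + (rgold ^ g * real (card (?X Q1 g)) + rgold ^ g * real (card (?X Q2 g)))"
      using le by blast
  qed (use lim in simp)
qed

lemma prob_genus_tendsto_1_of_likely:
  assumes \<epsilon>: "\<epsilon> > 0"
    and P: "\<And>\<eta> g S. real g * \<epsilon> > 5 * \<eta> * (real g + 1) + 3 \<Longrightarrow> S \<in> semigroups_of_genus g \<Longrightarrow>
       \<bar>real (embedding_dimension S) - real g / sqrt 5\<bar> \<le> 5 * \<eta> * (real g + 1) + 3 \<Longrightarrow>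
       \<bar>real (semigroup_type S) - (1 - (5 + sqrt 5) / 10) * real g\<bar> \<le> 5 * \<eta> * (real g + 1) + 3 \<Longrightarrow> P g S"
  shows "(\<lambda>g. prob_genus g (P g)) \<longlonglongrightarrow> 1"
proof (rule prob_genus_tendsto_1)
  \<comment> \<open>The linear part of the error uses at most half of \<open>\<epsilon> * g\<close>;
    the other half absorbs the constants once \<open>g\<close> is large.\<close>
  define \<eta> where "\<eta> = min (1/2) (\<epsilon> / 10)"
  have \<eta>: "0 < \<eta>" "\<eta> \<le> 1/2" "5 * \<eta> \<le> \<epsilon> / 2" using \<epsilon> by (auto simp: \<eta>_def)
  let ?Bad = "\<lambda>g. {S \<in> semigroups_of_genus g.
     \<not> (\<bar>real (embedding_dimension S) - real g / sqrt 5\<bar> \<le> 5 * \<eta> * (real g + 1) + 3 \<and>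
        \<bar>real (semigroup_type S) - (1 - (5 + sqrt 5) / 10) * real g\<bar> \<le> 5 * \<eta> * (real g + 1) + 3)}"
  show "(\<lambda>g. rgold ^ g * real (card {S \<in> semigroups_of_genus g. \<not> P g S})) \<longlonglongrightarrow> 0"
  proof (rule tendsto_sandwich[OF _ _ tendsto_const rgold_card_unlikely_tendsto_0[OF \<eta>(1,2)]])
    show "\<forall>\<^sub>F g in sequentially. rgold ^ g * real (card {S \<in> semigroups_of_genus g. \<not> P g S})
        \<le> rgold ^ g * real (card (?Bad g))"
      using eventually_real_ge[of "(\<epsilon> / 2 + 4) / (\<epsilon> / 2)"]
    proof eventually_elim
      case (elim g)
      hence "\<epsilon> / 2 + 4 \<le> \<epsilon> / 2 * real g" using \<epsilon> by (simp add: field_simps)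
      moreover have "5 * \<eta> * (real g + 1) \<le> \<epsilon> / 2 * (real g + 1)" using \<eta> by (intro mult_right_mono) auto
      ultimately have "real g * \<epsilon> > 5 * \<eta> * (real g + 1) + 3" by (simp add: algebra_simps)
      hence "{S \<in> semigroups_of_genus g. \<not> P g S} \<subseteq> ?Bad g" using P by blast
      hence "card {S \<in> semigroups_of_genus g. \<not> P g S} \<le> card (?Bad g)"
        by (intro card_mono) (use finite_semigroups_of_genus in auto)
      thus ?case using rgold_pos by (intro mult_left_mono) auto
    qed
  qed (use rgold_pos in auto)
qed

theorem theorem1p5:
  fixes \<epsilon> :: real
  assumes "\<epsilon> > 0"
  shows "((\<lambda>g. prob_genus g (\<lambda>S. \<bar>real (embedding_dimension S) - real g / sqrt 5\<bar> < \<epsilon> * real g))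
           \<longlonglongrightarrow> 1) \<and>
         ((\<lambda>g. prob_genus g (\<lambda>S. \<bar>real (semigroup_type S) - (1 - (5 + sqrt 5) / 10) * real g\<bar> < \<epsilon> * real g))
           \<longlonglongrightarrow> 1)"
proof
  show "(\<lambda>g. prob_genus g (\<lambda>S. \<bar>real (embedding_dimension S) - real g / sqrt 5\<bar> < \<epsilon> * real g)) \<longlonglongrightarrow> 1"
    by (rule prob_genus_tendsto_1_of_likely[OF assms]) (simp add: mult.commute)
  show "(\<lambda>g. prob_genus g (\<lambda>S. \<bar>real (semigroup_type S) - (1 - (5 + sqrt 5) / 10) * real g\<bar> < \<epsilon> * real g)) \<longlonglongrightarrow> 1"
    by (rule prob_genus_tendsto_1_of_likely[OF assms]) (simp add: mult.commute)
qed

end
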